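(* Let $d\ge 1$ be an integer and let $s,p$ be real numbers with $0<s<\min\{d/2,1\}$ and $2<p<\frac{2d}{d-2s}$. Then the Schrödinger group $\{e^{it\Delta}\}_{t\in\mathbb{R}}$ acts continuously on $\mathcal{Z}^s_p(\mathbb{R}^d)$. Moreover, there is a constant $C>0$ (independent of $t$ and $u_0$) such that for all $u_0\in \mathcal{Z}^s_p(\mathbb{R}^d)$ and all $t\in\mathbb{R}$, $$\|e^{it\Delta}u_0\|_{\mathcal{Z}^s_p}\le C(1+|t|)\,\|u_0\|_{\mathcal{Z}^s_p}.$$
   Context: $\mathcal{Z}^s_p(\mathbb{R}^d):=L^p(\mathbb{R}^d)\cap\dot H^s(\mathbb{R}^d)$ (complex-valued functions), with norm $\|u\|_{\mathcal{Z}^s_p}=\|u\|_{L^p}+\|u\|_{\dot H^s}$. Here $\dot H^s=\dot W^{s,2}$ is the homogeneous Sobolev space of tempered distributions $f$ (modulo constants) with $\mathcal{F}^{-1}(|\xi|^s\mathcal{F}f)\in L^2(\mathbb{R}^d)$, normed by the $L^2$ norm of this function, and $\mathcal{F}$ is the Fourier transform. The operator $e^{it\Delta}$ is the free Schrödinger propagator (solution operator of $iu_t+\Delta u=0$), i.e. the Fourier multiplier with symbol $e^{-it|\xi|^2}$ acting on tempered distributions. "Acts continuously" means that $\{e^{it\Delta}\}_{t\in\mathbb{R}}$ is a strongly continuous group of bounded linear operators: each $e^{it\Delta}$ maps $\mathcal{Z}^s_p(\mathbb{R}^d)$ boundedly into itself and $\lim_{t\to0}\|e^{it\Delta}\phi-\phi\|_{\mathcal{Z}^s_p}=0$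 for every $\phi\in\mathcal{Z}^s_p(\mathbb{R}^d)$. *)

theory Defs
  imports "HOL-Analysis.Analysis"
begin

definition partial_deriv :: "'n \<Rightarrow> (real ^ 'n \<Rightarrow> complex) \<Rightarrow> real ^ 'n \<Rightarrow> complex" where
  "partial_deriv i f = (\<lambda>x. frechet_derivative f (at x) (axis i 1))"

text \<open>A multi-index is a list of coordinate directions, listed with repetition.\<close>

definition partial_derivs :: "'n list \<Rightarrow> (real ^ 'n \<Rightarrow> complex) \<Rightarrow> real ^ 'n \<Rightarrow> complex" where
  "partial_derivs \<alpha> f = foldr partial_deriv \<alpha> f"

definition schwartz_space :: "(real ^ 'n \<Rightarrow> complex) set" where
  "schwartz_space =
    {\<phi>. (\<forall>\<alpha> x. partial_derivs \<alpha> \<phi> differentiable (at x)) \<and>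
        (\<forall>k \<alpha>. bounded (range (\<lambda>x. norm x ^ k * norm (partial_derivs \<alpha> \<phi> x))))}"

definition schwartz_seminorm :: "nat \<Rightarrow> 'n list \<Rightarrow> (real ^ 'n \<Rightarrow> complex) \<Rightarrow> real" where
  "schwartz_seminorm k \<alpha> \<phi> = (SUP x. norm x ^ k * norm (partial_derivs \<alpha> \<phi> x))"

definition fourier :: "(real ^ 'n \<Rightarrow> complex) \<Rightarrow> real ^ 'n \<Rightarrow> complex" where
  "fourier \<phi> = (\<lambda>\<xi>. complex_of_real ((2 * pi) powr (- (real CARD('n) / 2))) *
                    (LINT x|lborel. cis (- (x \<bullet> \<xi>)) * \<phi> x))"

definition inv_fourier :: "(real ^ 'n \<Rightarrow> complex) \<Rightarrow> real ^ 'n \<Rightarrow> complex" where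
  "inv_fourier \<phi> = (\<lambda>x. complex_of_real ((2 * pi) powr (- (real CARD('n) / 2))) *
                    (LINT \<xi>|lborel. cis (x \<bullet> \<xi>) * \<phi> \<xi>))"

text \<open>
  Functionals are taken to vanish off the Schwartz space, so that equality of tempered
  distributions is equality of HOL functions.
\<close>

type_synonym 'n functional = "(real ^ 'n \<Rightarrow> complex) \<Rightarrow> complex"

definition tempered_distributions :: "'n::finite functional set" where
  "tempered_distributions =
    {T. (\<forall>\<phi>. \<phi> \<notin> schwartz_space \<longrightarrow> T \<phi> = 0) \<and>
        (\<forall>a b. \<forall>\<phi>\<in>schwartz_space. \<forall>\<psi>\<in>schwartz_space.
            T (\<lambda>x. a * \<phi> x + b * \<psi> x) = a * T \<phi> + b * T \<psi>) \<and>
        (\<exists>C N. \<forall>\<phi>\<in>schwartz_space.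
            norm (T \<phi>) \<le> C * (\<Sum>k\<le>N. \<Sum>\<alpha> | length \<alpha> \<le> N. schwartz_seminorm k \<alpha> \<phi>))}"

definition fourier_dist :: "'n::finite functional \<Rightarrow> 'n functional" where
  "fourier_dist T = (\<lambda>\<phi>. if \<phi> \<in> schwartz_space then T (fourier \<phi>) else 0)"

definition inv_fourier_dist :: "'n::finite functional \<Rightarrow> 'n functional" where
  "inv_fourier_dist T = (\<lambda>\<phi>. if \<phi> \<in> schwartz_space then T (inv_fourier \<phi>) else 0)"

text \<open>Only meant for smooth \<open>m\<close> all of whose derivatives have at most polynomial growth.\<close>

definition mult_dist :: "(real ^ 'n \<Rightarrow> complex) \<Rightarrow> 'n::finite functional \<Rightarrow> 'n functional" where
  "mult_dist m T = (\<lambda>\<phi>. if \<phi> \<in> schwartz_space then T (\<lambda>\<xi>. m \<xi> * \<phi> \<xi>) else 0)"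

text \<open>
  Measurable functions that pair absolutely with every Schwartz function; in particular they
  are locally integrable.
\<close>

definition tempered_functions :: "(real ^ 'n \<Rightarrow> complex) set" where
  "tempered_functions =
    {f \<in> borel_measurable lborel. \<forall>\<phi>\<in>schwartz_space. integrable lborel (\<lambda>x. f x * \<phi> x)}"

definition dist_of :: "(real ^ 'n \<Rightarrow> complex) \<Rightarrow> 'n::finite functional" where
  "dist_of f = (\<lambda>\<phi>. if \<phi> \<in> schwartz_space then LINT x|lborel. f x * \<phi> x else 0)"

definition Lp_functions :: "real \<Rightarrow> (real ^ 'n \<Rightarrow> complex) set" where
  "Lp_functions p =
    {f \<in> borel_measurable lborel. integrable lborel (\<lambda>x. norm (f x) powr p)}"

definition Lp_fun_norm :: "real \<Rightarrow> (real ^ 'n \<Rightarrow> complex) \<Rightarrow> real" where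
  "Lp_fun_norm p f = (LINT x|lborel. norm (f x) powr p) powr (1 / p)"

definition Lp_space :: "real \<Rightarrow> 'n::finite functional set" where
  "Lp_space p = {T \<in> tempered_distributions. \<exists>f\<in>Lp_functions p. T = dist_of f}"

text \<open>The representative \<open>f\<close> is unique up to null sets, so the choice is immaterial.\<close>

definition Lp_norm :: "real \<Rightarrow> 'n::finite functional \<Rightarrow> real" where
  "Lp_norm p T = Lp_fun_norm p (SOME f. f \<in> Lp_functions p \<and> T = dist_of f)"

text \<open>
  \<open>is_frac_deriv s T g\<close> says that \<open>g\<close> is \<open>\<F>\<^sup>-\<^sup>1(|\<xi>|\<^sup>s \<F>T)\<close>. Since \<open>|\<xi>|\<^sup>s\<close> is not smooth at
  the origin, the product is read pointwise, for \<open>\<F>T\<close> a function. Working modulo constants,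
  this is required only after subtracting a constant \<open>c\<close> from \<open>T\<close>; that is,
  \<open>\<F>T\<close> may carry a multiple of the Dirac mass at \<open>0\<close>, which \<open>|\<xi>|\<^sup>s\<close> annihilates.
\<close>

definition is_frac_deriv :: "real \<Rightarrow> 'n::finite functional \<Rightarrow> (real ^ 'n \<Rightarrow> complex) \<Rightarrow> bool" where
  "is_frac_deriv s T g \<longleftrightarrow>
    (\<exists>c. \<exists>h\<in>tempered_functions.
        fourier_dist (\<lambda>\<phi>. T \<phi> - dist_of (\<lambda>_. c) \<phi>) = dist_of h \<and>
        dist_of g = inv_fourier_dist (dist_of (\<lambda>\<xi>. complex_of_real (norm \<xi> powr s) * h \<xi>)))"

definition hom_sobolev_space :: "real \<Rightarrow> 'n::finite functional set" where
  "hom_sobolev_space s =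
    {T \<in> tempered_distributions. \<exists>g\<in>Lp_functions 2. is_frac_deriv s T g}"

definition hom_sobolev_norm :: "real \<Rightarrow> 'n::finite functional \<Rightarrow> real" where
  "hom_sobolev_norm s T = Lp_fun_norm 2 (SOME g. g \<in> Lp_functions 2 \<and> is_frac_deriv s T g)"

definition Z_space :: "real \<Rightarrow> real \<Rightarrow> 'n::finite functional set" where
  "Z_space s p = Lp_space p \<inter> hom_sobolev_space s"

definition Z_norm :: "real \<Rightarrow> real \<Rightarrow> 'n::finite functional \<Rightarrow> real" where
  "Z_norm s p T = Lp_norm p T + hom_sobolev_norm s T"

definition schroedinger :: "real \<Rightarrow> 'n::finite functional \<Rightarrow> 'n functional" where
  "schroedinger t T =
    inv_fourier_dist (mult_dist (\<lambda>\<xi>. cis (- (t * (norm \<xi>)\<^sup>2))) (fourier_dist T))"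

definition bounded_linear_operator_on ::
    "'n::finite functional set \<Rightarrow> ('n functional \<Rightarrow> real) \<Rightarrow>
      ('n functional \<Rightarrow> 'n functional) \<Rightarrow> bool" where
  "bounded_linear_operator_on X N A \<longleftrightarrow>
    (\<forall>u\<in>X. A u \<in> X) \<and>
    (\<forall>a b. \<forall>u\<in>X. \<forall>v\<in>X.
        A (\<lambda>\<phi>. a * u \<phi> + b * v \<phi>) = (\<lambda>\<phi>. a * A u \<phi> + b * A v \<phi>)) \<and>
    (\<exists>M. \<forall>u\<in>X. N (A u) \<le> M * N u)"

definition strongly_continuous_group_on ::
    "'n::finite functional set \<Rightarrow> ('n functional \<Rightarrow> real) \<Rightarrow>
      (real \<Rightarrow> 'n functional \<Rightarrow> 'n functional) \<Rightarrow> bool" where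
  "strongly_continuous_group_on X N U \<longleftrightarrow>
    (\<forall>t. bounded_linear_operator_on X N (U t)) \<and>
    (\<forall>u\<in>X. U 0 u = u) \<and>
    (\<forall>t r. \<forall>u\<in>X. U (t + r) u = U t (U r u)) \<and>
    (\<forall>u\<in>X. ((\<lambda>t. N (\<lambda>\<phi>. U t u \<phi> - u \<phi>)) \<longlongrightarrow> 0) (at 0))"

end

theory Submission
  imports Defs "HOL-Probability.Characteristic_Functions" "HOL-Probability.Sinc_Integral"
begin

text \<open>
  The propagator multiplies the Fourier transform by the symbol \<open>m(\<xi>) = exp(-i t |\<xi>|\<^sup>2)\<close>. This has
  modulus one, so the homogeneous Sobolev norm is preserved. The space \<open>L\<^sup>p\<close> is not preserved, and \<open>u\<close>
  need not be square integrable; but the difference \<open>w = e\<^sup>i\<^sup>t\<^sup>\<Delta>u - u\<close> is better than \<open>u\<close>. Its transform is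
  \<open>(m - 1) h\<close>, where \<open>h\<close> is the transform of \<open>u\<close>, and \<open>|m(\<xi>) - 1|\<^sup>2 \<le> 4 |t|\<^sup>s |\<xi>|\<^sup>2\<^sup>s\<close>
  (lemma \<open>norm_schroedinger_symbol_minus_1\<close>). So \<open>w\<close> lies in \<open>L\<^sup>2\<close>, with norm at most \<open>2 |t|\<^sup>s\<^sup>/\<^sup>2\<close> times
  the homogeneous Sobolev norm of \<open>u\<close>, and it has a finite homogeneous Sobolev norm itself. Hence \<open>w\<close> belongs to the inhomogeneous space \<open>H\<^sup>s\<close>, which embeds in \<open>L\<^sup>p\<close> for subcritical \<open>p\<close>
  (lemma \<open>sobolev_embedding\<close>). This gives \<open>e\<^sup>i\<^sup>t\<^sup>\<Delta>u = u + w\<close> in \<open>L\<^sup>p\<close> with a bound of order \<open>1 + |t|\<^sup>s\<^sup>/\<^sup>2\<close>, and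
  therefore the growth bound (lemma \<open>schroedinger_perturbation\<close>). By dominated convergence the \<open>H\<^sup>s\<close>
  norm of \<open>w\<close> tends to zero with \<open>t\<close>, which is the strong continuity (lemma \<open>defect_norm_tendsto_0\<close>).

  The Sobolev embedding is proved by cutting the frequency space into dyadic annuli. A piece with
  bounded frequencies is controlled in \<open>L\<^sup>2\<close> by the Plancherel inequality \<open>inv_fourier_L2_le\<close> and in the sup
  norm by the Cauchy--Schwarz inequality, hence in \<open>L\<^sup>p\<close>; the pieces decay geometrically because \<open>p\<close> is
  subcritical, and \<open>Lp_series\<close> sums them. The same summation, with annuli adapted to the function,
  extends the Fourier transform to \<open>L\<^sup>2\<close>.

  The spaces consist of distributions, and their norms are defined through arbitrarily chosen
  representatives. It is therefore needed that a function is determined almost everywhere by its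
  pairing with Schwartz functions (\<open>dist_of_eq_imp_AE_eq\<close>), and that working modulo constants is
  harmless: a constant contributes a Dirac mass at frequency zero, where the weight
  \<open>|\<xi>|\<^sup>s\<close> vanishes and the symbol of the propagator equals one. The underlying Fourier analysis on the
  Schwartz space, up to the inversion theorem, rests on regularisation by the heat kernel.
\<close>

section \<open>Closure properties of the Schwartz space\<close>

definition rapidly_decaying :: "(real ^ 'n::finite \<Rightarrow> complex) \<Rightarrow> bool" where
  "rapidly_decaying f \<longleftrightarrow> (\<forall>k. \<exists>B. \<forall>x. norm x ^ k * norm (f x) \<le> B)"

text \<open>
  Iterated partial derivatives of a member never leave \<open>X\<close>, so a class that is closed under partial
  derivatives and consists of differentiable, rapidly decaying functions lies in the Schwartz space.
  The closure properties of the Schwartz space below are obtained by naming such a class; this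
  replaces Leibniz formulas for multi-indices by a single application of the product rule.
\<close>

lemma schwartz_coinduct:
  fixes X :: "(real ^ 'n::finite \<Rightarrow> complex) set"
  assumes "f \<in> X"
    and "\<And>f x. f \<in> X \<Longrightarrow> f differentiable (at x)"
    and "\<And>f i. f \<in> X \<Longrightarrow> partial_deriv i f \<in> X"
    and "\<And>f. f \<in> X \<Longrightarrow> rapidly_decaying f"
  shows "f \<in> schwartz_space"
proof -
  have in_X: "partial_derivs \<alpha> f \<in> X" for \<alpha>
    by (induction \<alpha>) (auto simp: partial_derivs_def assms)
  have "bounded (range (\<lambda>x. norm x ^ k * norm (partial_derivs \<alpha> f x)))" for k \<alpha>
    using assms(4)[OF in_X, of \<alpha>] unfolding rapidly_decaying_def bounded_iff
    by (auto simp: abs_mult)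
  then show ?thesis
    using in_X assms(2) by (auto simp: schwartz_space_def)
qed

lemma schwartz_differentiable:
  "\<phi> \<in> schwartz_space \<Longrightarrow> \<phi> differentiable (at x)"
  unfolding schwartz_space_def partial_derivs_def by (auto dest!: spec[of _ "[]"])

lemma schwartz_partial_deriv:
  assumes "\<phi> \<in> schwartz_space"
  shows "partial_deriv i \<phi> \<in> schwartz_space"
proof -
  have "partial_derivs \<alpha> (partial_deriv i \<phi>) = partial_derivs (\<alpha> @ [i]) \<phi>" for \<alpha>
    by (simp add: partial_derivs_def)
  then show ?thesis using assms unfolding schwartz_space_def by auto
qed

lemma schwartz_rapidly_decaying:
  assumes "\<phi> \<in> schwartz_space"
  shows "rapidly_decaying \<phi>"
  unfolding rapidly_decaying_def
proof
  fix k
  have "bounded (range (\<lambda>x. norm x ^ k * norm (partial_derivs [] \<phi> x)))"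
    using assms unfolding schwartz_space_def by blast
  then show "\<exists>B. \<forall>x. norm x ^ k * norm (\<phi> x) \<le> B"
    unfolding bounded_iff partial_derivs_def by (auto simp: abs_mult)
qed

lemma schwartz_has_derivative:
  assumes "\<phi> \<in> schwartz_space"
  shows "(\<phi> has_derivative (\<lambda>h. \<Sum>i\<in>UNIV. (h $ i) *\<^sub>R partial_deriv i \<phi> x)) (at x)"
proof -
  let ?D = "frechet_derivative \<phi> (at x)"
  have D: "(\<phi> has_derivative ?D) (at x)"
    using schwartz_differentiable[OF assms] frechet_derivative_works by blast
  interpret D: linear ?D
    using D has_derivative_linear by blast
  have "?D h = (\<Sum>i\<in>UNIV. (h $ i) *\<^sub>R partial_deriv i \<phi> x)" for h
  proof -
    have "h = (\<Sum>i\<in>UNIV. (h $ i) *\<^sub>R axis i 1)"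
      using basis_expansion[of h] by (simp add: scalar_mult_eq_scaleR)
    then have "?D h = ?D (\<Sum>i\<in>UNIV. (h $ i) *\<^sub>R axis i 1)" by simp
    also have "\<dots> = (\<Sum>i\<in>UNIV. (h $ i) *\<^sub>R partial_deriv i \<phi> x)"
      by (simp add: D.sum D.scale partial_deriv_def)
    finally show ?thesis .
  qed
  then have "?D = (\<lambda>h. \<Sum>i\<in>UNIV. (h $ i) *\<^sub>R partial_deriv i \<phi> x)" by blast
  with D show ?thesis by simp
qed

lemma partial_deriv_eq:
  assumes "(f has_derivative D) (at x)"
  shows "partial_deriv i f x = D (axis i 1)"
  using frechet_derivative_at[OF assms] by (simp add: partial_deriv_def)

lemma sum_axis_scaleR: "(\<Sum>i\<in>UNIV. (axis j (1::real) $ i) *\<^sub>R (c i :: complex)) = c (j::'n::finite)"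
proof -
  have "(\<Sum>i\<in>UNIV. (axis j (1::real) $ i) *\<^sub>R c i) = (\<Sum>i\<in>UNIV. if i = j then c i else 0)"
    by (intro sum.cong) (auto simp: axis_def)
  then show ?thesis by simp
qed

lemma rapidly_decaying_bounded:
  assumes "rapidly_decaying f"
  obtains B where "\<And>x. norm (f x) \<le> B" "B > 0"
proof -
  obtain B where B: "\<And>x. norm x ^ 0 * norm (f x) \<le> B"
    using assms unfolding rapidly_decaying_def by blast
  have "norm (f x) \<le> max B 1" for x
    using B[of x] by simp
  then show ?thesis using that[of "max B 1"] by simp
qed

lemma rapidly_decaying_mono:
  assumes "rapidly_decaying f" and "\<And>x. norm (g x) \<le> c * norm (f x)" and "c \<ge> 0"
  shows "rapidly_decaying g"
  unfolding rapidly_decaying_def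
proof
  fix k
  obtain B where B: "\<And>x. norm x ^ k * norm (f x) \<le> B"
    using assms(1) unfolding rapidly_decaying_def by blast
  have "norm x ^ k * norm (g x) \<le> c * B" for x
  proof -
    have "norm x ^ k * norm (g x) \<le> norm x ^ k * (c * norm (f x))"
      by (intro mult_left_mono assms) auto
    also have "\<dots> = c * (norm x ^ k * norm (f x))" by simp
    also have "\<dots> \<le> c * B" by (intro mult_left_mono B assms)
    finally show ?thesis .
  qed
  then show "\<exists>B. \<forall>x. norm x ^ k * norm (g x) \<le> B" by blast
qed

lemma rapidly_decaying_add:
  assumes "rapidly_decaying f" "rapidly_decaying g"
  shows "rapidly_decaying (\<lambda>x. f x + g x)"
  unfolding rapidly_decaying_def
proof
  fix k
  obtain A where A: "\<And>x. norm x ^ k * norm (f x) \<le> A"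
    using assms(1) unfolding rapidly_decaying_def by blast
  obtain B where B: "\<And>x. norm x ^ k * norm (g x) \<le> B"
    using assms(2) unfolding rapidly_decaying_def by blast
  have "norm x ^ k * norm (f x + g x) \<le> A + B" for x
  proof -
    have "norm x ^ k * norm (f x + g x) \<le> norm x ^ k * (norm (f x) + norm (g x))"
      by (intro mult_left_mono norm_triangle_ineq) auto
    then show ?thesis using A[of x] B[of x] by (simp add: algebra_simps)
  qed
  then show "\<exists>B. \<forall>x. norm x ^ k * norm (f x + g x) \<le> B" by blast
qed

lemma rapidly_decaying_cmult:
  "rapidly_decaying f \<Longrightarrow> rapidly_decaying (\<lambda>x. c * f x)"
  by (erule rapidly_decaying_mono[of _ _ "norm c"]) (auto simp: norm_mult)

lemma rapidly_decaying_coord: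
  assumes "rapidly_decaying f"
  shows "rapidly_decaying (\<lambda>x. of_real (x $ i) * f x)"
  unfolding rapidly_decaying_def
proof
  fix k
  obtain A where A: "\<And>x. norm x ^ Suc k * norm (f x) \<le> A"
    using assms(1) unfolding rapidly_decaying_def by blast
  have "norm x ^ k * norm (of_real (x $ i) * f x) \<le> A" for x
  proof -
    have "norm x ^ k * norm (of_real (x $ i) * f x) \<le> norm x ^ k * (norm x * norm (f x))"
      by (auto simp: norm_mult intro!: mult_left_mono mult_right_mono component_le_norm_cart)
    then show ?thesis using A[of x] by (simp add: algebra_simps)
  qed
  then show "\<exists>B. \<forall>x. norm x ^ k * norm (of_real (x $ i) * f x) \<le> B" by blast
qed

lemma schwartz_lincomb:
  assumes "\<phi> \<in> schwartz_space" "\<psi> \<in> schwartz_space"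
  shows "(\<lambda>x. a * \<phi> x + b * \<psi> x) \<in> schwartz_space"
proof -
  let ?X = "{\<lambda>x. a * \<phi> x + b * \<psi> x |\<phi> \<psi>. \<phi> \<in> schwartz_space \<and> \<psi> \<in> schwartz_space}"
  have der: "((\<lambda>x. a * \<phi> x + b * \<psi> x) has_derivative
      (\<lambda>h. a * (\<Sum>i\<in>UNIV. (h $ i) *\<^sub>R partial_deriv i \<phi> x)
        + b * (\<Sum>i\<in>UNIV. (h $ i) *\<^sub>R partial_deriv i \<psi> x))) (at x)"
    if "\<phi> \<in> schwartz_space" "\<psi> \<in> schwartz_space" for \<phi> \<psi> x
    by (intro has_derivative_add has_derivative_mult_right schwartz_has_derivative that)
  show ?thesis
  proof (rule schwartz_coinduct[of _ ?X])
    show "f differentiable (at x)" if "f \<in> ?X" for f x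
      using that der unfolding differentiable_def by blast
    show "partial_deriv i f \<in> ?X" if "f \<in> ?X" for f i
    proof -
      obtain \<phi> \<psi> where f: "f = (\<lambda>x. a * \<phi> x + b * \<psi> x)"
        and S: "\<phi> \<in> schwartz_space" "\<psi> \<in> schwartz_space"
        using \<open>f \<in> ?X\<close> by blast
      have "partial_deriv i f = (\<lambda>x. a * partial_deriv i \<phi> x + b * partial_deriv i \<psi> x)"
        unfolding f by (rule ext, subst partial_deriv_eq[OF der[OF S]]) (simp only: sum_axis_scaleR)
      then show ?thesis using S schwartz_partial_deriv by blast
    qed
    show "rapidly_decaying f" if "f \<in> ?X" for f
      using that by (auto intro!: rapidly_decaying_add rapidly_decaying_cmult intro: schwartz_rapidly_decaying)
  qed (use assms in blast)
qed

lemma schwartz_add: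
  "\<phi> \<in> schwartz_space \<Longrightarrow> \<psi> \<in> schwartz_space \<Longrightarrow> (\<lambda>x. \<phi> x + \<psi> x) \<in> schwartz_space"
  using schwartz_lincomb[of \<phi> \<psi> 1 1] by simp

lemma schwartz_cmult: "\<phi> \<in> schwartz_space \<Longrightarrow> (\<lambda>x. c * \<phi> x) \<in> schwartz_space"
  using schwartz_lincomb[of \<phi> \<phi> c 0] by simp

lemma schwartz_zero: "(\<lambda>x. 0) \<in> schwartz_space"
proof (rule schwartz_coinduct[of _ "{\<lambda>x. 0}"])
  show "partial_deriv i f \<in> {\<lambda>x. 0}" if "f \<in> {\<lambda>x. 0}" for f :: "real ^ 'n \<Rightarrow> complex" and i :: 'n
    using that partial_deriv_eq[OF has_derivative_const, of i 0] by auto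
qed (auto simp: rapidly_decaying_def)

lemma schwartz_sum:
  assumes "\<And>i. i \<in> I \<Longrightarrow> \<phi> i \<in> schwartz_space"
  shows "(\<lambda>x. \<Sum>i\<in>I. \<phi> i x) \<in> schwartz_space"
  using assms
proof (induction I rule: infinite_finite_induct)
  case (insert i I)
  then show ?case using schwartz_add[of "\<phi> i" "\<lambda>x. \<Sum>i\<in>I. \<phi> i x"] by simp
qed (simp_all add: schwartz_zero)

text \<open>
  Differentiating \<open>x\<^sub>i \<phi>\<close> produces the extra term \<open>\<phi>\<close>, so the class of all \<open>x\<^sub>i \<phi>\<close> is not closed
  under derivatives, but the class of all \<open>x\<^sub>i \<phi> + \<psi>\<close> is.
\<close>

lemma schwartz_coord_mult:
  assumes "\<phi> \<in> schwartz_space"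
  shows "(\<lambda>x. of_real (x $ i) * \<phi> x) \<in> schwartz_space"
proof -
  let ?X = "{\<lambda>x. of_real (x $ i) * \<phi> x + \<psi> x |\<phi> \<psi>. \<phi> \<in> schwartz_space \<and> \<psi> \<in> schwartz_space}"
  have der: "((\<lambda>x. of_real (x $ i) * \<phi> x + \<psi> x) has_derivative
      (\<lambda>h. of_real (x $ i) * (\<Sum>j\<in>UNIV. (h $ j) *\<^sub>R partial_deriv j \<phi> x)
        + of_real (h $ i) * \<phi> x
        + (\<Sum>j\<in>UNIV. (h $ j) *\<^sub>R partial_deriv j \<psi> x))) (at x)"
    if "\<phi> \<in> schwartz_space" "\<psi> \<in> schwartz_space" for \<phi> \<psi> x
    by (intro has_derivative_add has_derivative_mult has_derivative_of_real
        bounded_linear_imp_has_derivative bounded_linear_vec_nth schwartz_has_derivative that)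
  show ?thesis
  proof (rule schwartz_coinduct[of _ ?X])
    show "f differentiable (at x)" if "f \<in> ?X" for f x
      using that der unfolding differentiable_def by blast
    show "partial_deriv j f \<in> ?X" if "f \<in> ?X" for f j
    proof -
      obtain \<phi> \<psi> where f: "f = (\<lambda>x. of_real (x $ i) * \<phi> x + \<psi> x)"
        and S: "\<phi> \<in> schwartz_space" "\<psi> \<in> schwartz_space"
        using \<open>f \<in> ?X\<close> by blast
      have "partial_deriv j f = (\<lambda>x. of_real (x $ i) * partial_deriv j \<phi> x
          + ((if i = j then 1 else 0) * \<phi> x + 1 * partial_deriv j \<psi> x))"
        unfolding f
        by (rule ext, subst partial_deriv_eq[OF der[OF S]]) (simp add: sum_axis_scaleR, simp add: axis_def)
      moreover have "(\<lambda>x. (if i = j then 1 else 0) * \<phi> x + 1 * partial_deriv j \<psi> x) \<in> schwartz_space"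
        by (intro schwartz_lincomb schwartz_partial_deriv S)
      ultimately show ?thesis
        using S(1) schwartz_partial_deriv[of \<phi> j] by (intro CollectI exI conjI)
    qed
    show "rapidly_decaying f" if "f \<in> ?X" for f
      using that by (auto intro!: rapidly_decaying_add rapidly_decaying_coord intro: schwartz_rapidly_decaying)
    show "(\<lambda>x. of_real (x $ i) * \<phi> x) \<in> ?X"
    proof -
      have "(\<lambda>x. of_real (x $ i) * \<phi> x) = (\<lambda>x. of_real (x $ i) * \<phi> x + (\<lambda>x. 0) x)" by simp
      then show ?thesis
        using assms schwartz_zero by (intro CollectI exI[of _ \<phi>] exI[of _ "\<lambda>x. 0"]) simp
    qed
  qed
qed

text \<open>
  The hypothesis on the derivative holds for multiples of the exponential of a quadratic polynomial:
  a derivative of \<open>m\<close> is \<open>m\<close> times an affine function, and \<open>{m \<phi> | \<phi> Schwartz}\<close> is closed under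
  derivatives. Characters, the symbol of the Schroedinger group and Gaussians are all of this form.
\<close>

lemma schwartz_exp_quadratic_mult:
  fixes m :: "real ^ 'n::finite \<Rightarrow> complex"
  assumes "\<phi> \<in> schwartz_space"
    and bdd: "\<And>x. norm (m x) \<le> 1"
    and dm: "\<And>x. (m has_derivative (\<lambda>h. (\<alpha> * of_real (x \<bullet> h) + \<beta> * of_real (\<xi> \<bullet> h)) * m x)) (at x)"
  shows "(\<lambda>x. m x * \<phi> x) \<in> schwartz_space"
proof -
  let ?X = "{\<lambda>x. m x * \<phi> x |\<phi>. \<phi> \<in> schwartz_space}"
  have der: "((\<lambda>x. m x * \<phi> x) has_derivative
      (\<lambda>h. m x * (\<Sum>j\<in>UNIV. (h $ j) *\<^sub>R partial_deriv j \<phi> x)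
        + (\<alpha> * of_real (x \<bullet> h) + \<beta> * of_real (\<xi> \<bullet> h)) * m x * \<phi> x)) (at x)"
    if "\<phi> \<in> schwartz_space" for \<phi> x
    by (intro has_derivative_mult dm schwartz_has_derivative that)
  show ?thesis
  proof (rule schwartz_coinduct[of _ ?X])
    show "f differentiable (at x)" if "f \<in> ?X" for f x
      using that der unfolding differentiable_def by blast
    show "partial_deriv j f \<in> ?X" if "f \<in> ?X" for f j
    proof -
      obtain \<phi> where f: "f = (\<lambda>x. m x * \<phi> x)" and S: "\<phi> \<in> schwartz_space"
        using \<open>f \<in> ?X\<close> by blast
      define \<psi> where "\<psi> = (\<lambda>x. 1 * partial_deriv j \<phi> x
        + 1 * (\<alpha> * (of_real (x $ j) * \<phi> x) + (\<beta> * of_real (\<xi> $ j)) * \<phi> x))"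
      have "partial_deriv j f = (\<lambda>x. m x * \<psi> x)"
        unfolding f \<psi>_def
        by (rule ext, subst partial_deriv_eq[OF der[OF S]])
           (simp add: sum_axis_scaleR inner_axis algebra_simps)
      moreover have "\<psi> \<in> schwartz_space"
        unfolding \<psi>_def by (intro schwartz_lincomb schwartz_partial_deriv schwartz_coord_mult S)
      ultimately show ?thesis by blast
    qed
    show "rapidly_decaying f" if "f \<in> ?X" for f
    proof -
      obtain \<phi> where f: "f = (\<lambda>x. m x * \<phi> x)" and S: "\<phi> \<in> schwartz_space"
        using \<open>f \<in> ?X\<close> by blast
      have "norm (m x * \<phi> x) \<le> 1 * norm (\<phi> x)" for x
        unfolding norm_mult by (intro mult_right_mono bdd) auto
      then show ?thesis
        unfolding f using rapidly_decaying_mono[OF schwartz_rapidly_decaying[OF S], of "\<lambda>x. m x * \<phi> x" 1] by simp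
    qed
  qed (use assms in blast)
qed

lemma has_derivative_norm_square:
  "((\<lambda>x::'a::real_inner. (norm x)\<^sup>2) has_derivative (\<lambda>h. 2 * (x \<bullet> h))) (at x)"
  unfolding power2_norm_eq_inner
  by (auto intro!: derivative_eq_intros simp: inner_commute)

lemma has_derivative_cis:
  assumes "(g has_derivative g') (at x)"
  shows "((\<lambda>x. cis (g x)) has_derivative (\<lambda>h. \<i> * of_real (g' h) * cis (g x))) (at x)"
proof -
  have "((\<lambda>x. exp (\<i> * of_real (g x))) has_derivative (\<lambda>h. \<i> * of_real (g' h) * exp (\<i> * of_real (g x)))) (at x)"
    by (rule has_derivative_eq_rhs[OF has_derivative_compose[OF _ has_field_derivative_imp_has_derivative[OF DERIV_exp]]])
       (auto intro!: has_derivative_mult_right has_derivative_of_real assms)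
  then show ?thesis by (simp add: cis_conv_exp)
qed

lemma schwartz_character_mult:
  fixes \<phi> :: "real ^ 'n::finite \<Rightarrow> complex"
  assumes "\<phi> \<in> schwartz_space"
  shows "(\<lambda>x. cis (x \<bullet> \<xi>) * \<phi> x) \<in> schwartz_space"
proof (rule schwartz_exp_quadratic_mult[where \<alpha> = 0 and \<beta> = \<i> and \<xi> = \<xi>, OF assms])
  fix x :: "real ^ 'n"
  have "((\<lambda>x. x \<bullet> \<xi>) has_derivative (\<lambda>h. h \<bullet> \<xi>)) (at x)"
    by (auto intro!: derivative_eq_intros)
  from has_derivative_cis[OF this]
  show "((\<lambda>x. cis (x \<bullet> \<xi>)) has_derivative
      (\<lambda>h. (0 * of_real (x \<bullet> h) + \<i> * of_real (\<xi> \<bullet> h)) * cis (x \<bullet> \<xi>))) (at x)"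
    by (simp add: inner_commute)
qed simp

lemma schwartz_schroedinger_mult:
  fixes \<phi> :: "real ^ 'n::finite \<Rightarrow> complex"
  assumes "\<phi> \<in> schwartz_space"
  shows "(\<lambda>\<xi>. cis (- (t * (norm \<xi>)\<^sup>2)) * \<phi> \<xi>) \<in> schwartz_space"
proof (rule schwartz_exp_quadratic_mult[where \<alpha> = "- 2 * \<i> * of_real t" and \<beta> = 0 and \<xi> = 0, OF assms])
  fix x :: "real ^ 'n"
  have "((\<lambda>x::real ^ 'n. - (t * (norm x)\<^sup>2)) has_derivative (\<lambda>h. - (t * (2 * (x \<bullet> h))))) (at x)"
    by (intro has_derivative_minus has_derivative_mult_right has_derivative_norm_square)
  from has_derivative_cis[OF this]
  show "((\<lambda>x. cis (- (t * (norm x)\<^sup>2))) has_derivative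
      (\<lambda>h. ((- 2 * \<i> * of_real t) * of_real (x \<bullet> h) + 0 * of_real (0 \<bullet> h)) * cis (- (t * (norm x)\<^sup>2)))) (at x)"
    by (simp add: algebra_simps)
qed simp

definition gauss :: "real \<Rightarrow> real ^ 'n::finite \<Rightarrow> real" where
  "gauss \<epsilon> x = exp (- (\<epsilon> * (norm x)\<^sup>2 / 2))"

lemma gauss_has_derivative:
  fixes x :: "real ^ 'n::finite"
  shows   "((\<lambda>x. complex_of_real (gauss \<epsilon> x)) has_derivative
    (\<lambda>h. (- of_real \<epsilon> * of_real (x \<bullet> h)) * complex_of_real (gauss \<epsilon> x))) (at x)"
proof -
  have "((\<lambda>x::real ^ 'n. - (\<epsilon> * (norm x)\<^sup>2 / 2)) has_derivative (\<lambda>h. - (\<epsilon> * (2 * (x \<bullet> h)) / 2))) (at x)"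
    using has_derivative_mult_right[OF has_derivative_norm_square, of "- (\<epsilon> / 2)" x] by (simp add: algebra_simps)
  then have "((\<lambda>x. gauss \<epsilon> x) has_derivative (\<lambda>h. - (\<epsilon> * (x \<bullet> h)) * gauss \<epsilon> x)) (at x)"
    unfolding gauss_def by (auto intro!: derivative_eq_intros)
  then have "((\<lambda>x. complex_of_real (gauss \<epsilon> x)) has_derivative
      (\<lambda>h. complex_of_real (- (\<epsilon> * (x \<bullet> h)) * gauss \<epsilon> x))) (at x)"
    by (rule has_derivative_of_real)
  then show ?thesis by simp
qed

lemma schwartz_gauss_mult:
  fixes \<phi> :: "real ^ 'n::finite \<Rightarrow> complex"
  assumes "\<phi> \<in> schwartz_space" "\<epsilon> \<ge> 0"
  shows "(\<lambda>x. of_real (gauss \<epsilon> x) * \<phi> x) \<in> schwartz_space"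
proof (rule schwartz_exp_quadratic_mult[where \<alpha> = "- of_real \<epsilon>" and \<beta> = 0 and \<xi> = 0, OF assms(1)])
  show "norm (of_real (gauss \<epsilon> x) :: complex) \<le> 1" for x :: "real ^ 'n"
    using assms(2) by (simp add: gauss_def)
  show "((\<lambda>x. of_real (gauss \<epsilon> x)) has_derivative
      (\<lambda>h. (- of_real \<epsilon> * of_real (x \<bullet> h) + 0 * of_real (0 \<bullet> h)) * complex_of_real (gauss \<epsilon> x))) (at x)"
    for x :: "real ^ 'n"
    using gauss_has_derivative[of \<epsilon> x] by simp
qed

text \<open>
  Polynomials times a Gaussian: the closure of the Gaussian under the operations that the product
  rule produces.
\<close>

inductive_set gauss_polys :: "real \<Rightarrow> (real ^ 'n::finite \<Rightarrow> complex) set" for \<epsilon> where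
  base: "(\<lambda>x. of_real (gauss \<epsilon> x)) \<in> gauss_polys \<epsilon>"
| lincomb: "f \<in> gauss_polys \<epsilon> \<Longrightarrow> g \<in> gauss_polys \<epsilon> \<Longrightarrow> (\<lambda>x. a * f x + b * g x) \<in> gauss_polys \<epsilon>"
| coord: "f \<in> gauss_polys \<epsilon> \<Longrightarrow> (\<lambda>x. of_real (x $ i) * f x) \<in> gauss_polys \<epsilon>"

lemma gauss_rapidly_decaying:
  assumes "\<epsilon> > 0"
  shows "rapidly_decaying (\<lambda>x::real ^ 'n::finite. complex_of_real (gauss \<epsilon> x))"
  unfolding rapidly_decaying_def
proof
  fix k
  define B where "B = 1 + (2 * real k / \<epsilon>) ^ k"
  have "norm x ^ k * norm (complex_of_real (gauss \<epsilon> x)) \<le> B" for x :: "real ^ 'n"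
  proof -
    let ?u = "\<epsilon> * (norm x)\<^sup>2 / 2"
    have "((norm x)\<^sup>2) ^ k * exp (- ?u) \<le> (2 * real k / \<epsilon>) ^ k"
    proof (cases "k = 0")
      case False
      have "((norm x)\<^sup>2) ^ k = (2 * real k / \<epsilon>) ^ k * (?u / real k) ^ k"
        using assms False by (simp flip: power_mult_distrib)
      also have "\<dots> \<le> (2 * real k / \<epsilon>) ^ k * exp (?u / real k) ^ k"
        using assms exp_ge_add_one_self[of "?u / real k"]
        by (intro mult_left_mono power_mono) (auto simp del: exp_ge_add_one_self)
      also have "exp (?u / real k) ^ k = exp ?u"
        using False by (simp flip: exp_of_nat_mult)
      finally show ?thesis by (simp add: exp_minus field_simps)
    qed (use assms in simp)
    moreover have "norm x ^ k \<le> 1 + ((norm x)\<^sup>2) ^ k"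
    proof (cases "norm x \<le> 1")
      case True
      then show ?thesis by (simp add: power_le_one add_increasing2)
    next
      case False
      then have "norm x ^ k \<le> norm x ^ (2 * k)" by (intro power_increasing) auto
      then show ?thesis by (simp add: power_mult)
    qed
    then have "norm x ^ k * exp (- ?u) \<le> (1 + ((norm x)\<^sup>2) ^ k) * exp (- ?u)"
      by (intro mult_right_mono) auto
    moreover have "exp (- ?u) \<le> 1" using assms by simp
    ultimately show ?thesis
      unfolding gauss_def B_def norm_of_real abs_exp_cancel distrib_right by linarith
  qed
  then show "\<exists>B. \<forall>x::real ^ 'n. norm x ^ k * norm (complex_of_real (gauss \<epsilon> x)) \<le> B" by blast
qed

lemma schwartz_gauss:
  assumes "\<epsilon> > 0"
  shows "(\<lambda>x::real ^ 'n::finite. complex_of_real (gauss \<epsilon> x)) \<in> schwartz_space"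
proof -
  have der: "(\<forall>x. f differentiable (at x)) \<and> (\<forall>i. partial_deriv i f \<in> gauss_polys \<epsilon>) \<and> rapidly_decaying f"
    if "f \<in> gauss_polys \<epsilon>" for f :: "real ^ 'n \<Rightarrow> complex"
    using that
  proof induction
    case base
    have "partial_deriv i (\<lambda>x::real ^ 'n. complex_of_real (gauss \<epsilon> x)) =
      (\<lambda>x. (- of_real \<epsilon>) * (of_real (x $ i) * of_real (gauss \<epsilon> x)) + 0 * of_real (gauss \<epsilon> x))" for i
      by (rule ext, subst partial_deriv_eq[OF gauss_has_derivative]) (simp add: inner_axis)
    then have "partial_deriv i (\<lambda>x::real ^ 'n. complex_of_real (gauss \<epsilon> x)) \<in> gauss_polys \<epsilon>" for i
      by (simp only:) (intro gauss_polys.intros)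
    then show ?case
      using gauss_has_derivative gauss_rapidly_decaying[OF assms] unfolding differentiable_def by blast
  next
    case (lincomb f g a b)
    let ?h = "\<lambda>x. a * f x + b * g x"
    have d: "(?h has_derivative (\<lambda>h. a * frechet_derivative f (at x) h + b * frechet_derivative g (at x) h)) (at x)" for x
      using lincomb.IH frechet_derivative_works
      by (intro has_derivative_add has_derivative_mult_right) auto
    have "partial_deriv i ?h = (\<lambda>x. a * partial_deriv i f x + b * partial_deriv i g x)" for i
      by (rule ext, subst partial_deriv_eq[OF d]) (simp add: partial_deriv_def)
    then have "partial_deriv i ?h \<in> gauss_polys \<epsilon>" for i
      using lincomb.IH by (auto intro: gauss_polys.intros)
    then show ?case
      using d lincomb.IH unfolding differentiable_def
      by (auto intro!: rapidly_decaying_add rapidly_decaying_cmult)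
  next
    case (coord f i)
    let ?h = "\<lambda>x. of_real (x $ i) * f x"
    have d: "(?h has_derivative (\<lambda>h. of_real (x $ i) * frechet_derivative f (at x) h + of_real (h $ i) * f x)) (at x)" for x
      using coord.IH frechet_derivative_works
      by (intro has_derivative_mult has_derivative_of_real
        bounded_linear_imp_has_derivative bounded_linear_vec_nth) auto
    have "partial_deriv j ?h = (\<lambda>x. 1 * (of_real (x $ i) * partial_deriv j f x) + (if i = j then 1 else 0) * f x)" for j
      by (rule ext, subst partial_deriv_eq[OF d]) (simp add: partial_deriv_def, simp add: axis_def)
    then have "partial_deriv j ?h \<in> gauss_polys \<epsilon>" for j
      using coord.IH coord.hyps by (simp only:) (intro gauss_polys.lincomb gauss_polys.coord, blast+)
    then show ?case
      using d coord.IH unfolding differentiable_def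
      by (auto intro!: rapidly_decaying_coord)
  qed
  show ?thesis
    by (rule schwartz_coinduct[of _ "gauss_polys \<epsilon>"]) (use der gauss_polys.base in auto)
qed

lemma schwartz_translate:
  assumes "\<phi> \<in> schwartz_space"
  shows "(\<lambda>x. \<phi> (x - y)) \<in> schwartz_space"
proof -
  let ?X = "{\<lambda>x. \<phi> (x - y) |\<phi>. \<phi> \<in> schwartz_space}"
  have der: "((\<lambda>x. \<phi> (x - y)) has_derivative
      (\<lambda>h. \<Sum>j\<in>UNIV. (h $ j) *\<^sub>R partial_deriv j \<phi> (x - y))) (at x)"
    if "\<phi> \<in> schwartz_space" for \<phi> x
  proof -
    have "((\<lambda>x. x - y) has_derivative (\<lambda>h. h)) (at x)"
      by (auto intro!: derivative_eq_intros)
    from has_derivative_compose[OF this schwartz_has_derivative[OF that]] show ?thesis .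
  qed
  show ?thesis
  proof (rule schwartz_coinduct[of _ ?X])
    show "f differentiable (at x)" if "f \<in> ?X" for f x
      using that der unfolding differentiable_def by blast
    show "partial_deriv j f \<in> ?X" if "f \<in> ?X" for f j
    proof -
      obtain \<phi> where f: "f = (\<lambda>x. \<phi> (x - y))" and S: "\<phi> \<in> schwartz_space"
        using \<open>f \<in> ?X\<close> by blast
      have "partial_deriv j f = (\<lambda>x. partial_deriv j \<phi> (x - y))"
        unfolding f
        by (rule ext, subst partial_deriv_eq[OF der[OF S]]) (simp add: sum_axis_scaleR)
      then show ?thesis using S schwartz_partial_deriv by blast
    qed
    show "rapidly_decaying f" if "f \<in> ?X" for f
    proof -
      obtain \<phi> where f: "f = (\<lambda>x. \<phi> (x - y))" and S: "\<phi> \<in> schwartz_space"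
        using \<open>f \<in> ?X\<close> by blast
      show ?thesis
        unfolding rapidly_decaying_def
      proof
        fix k
        obtain A where A: "\<And>x. norm x ^ k * norm (\<phi> x) \<le> A"
          using schwartz_rapidly_decaying[OF S] unfolding rapidly_decaying_def by blast
        obtain B where B: "\<And>x. norm (\<phi> x) \<le> B" "B > 0"
          using rapidly_decaying_bounded schwartz_rapidly_decaying[OF S] by blast
        have "norm x ^ k * norm (f x) \<le> 2 ^ k * (A + norm y ^ k * B)" for x
        proof -
          have "norm x \<le> 2 * max (norm (x - y)) (norm y)"
            using norm_triangle_sub[of x y] by (auto simp: max_def)
          then have "norm x ^ k \<le> (2 * max (norm (x - y)) (norm y)) ^ k"
            by (intro power_mono) auto
          also have "\<dots> \<le> 2 ^ k * (norm (x - y) ^ k + norm y ^ k)"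
            by (auto simp: max_def power_mult_distrib)
          finally have "norm x ^ k * norm (f x) \<le> (2 ^ k * (norm (x - y) ^ k + norm y ^ k)) * norm (f x)"
            by (intro mult_right_mono) auto
          also have "\<dots> = 2 ^ k * (norm (x - y) ^ k * norm (\<phi> (x - y)) + norm y ^ k * norm (\<phi> (x - y)))"
            unfolding f by (simp add: algebra_simps)
          also have "\<dots> \<le> 2 ^ k * (A + norm y ^ k * B)"
            by (intro mult_left_mono add_mono A B) auto
          finally show ?thesis .
        qed
        then show "\<exists>B. \<forall>x. norm x ^ k * norm (f x) \<le> B" by blast
      qed
    qed
  qed (use assms in blast)
qed

lemma schwartz_cnj:
  assumes "\<phi> \<in> schwartz_space"
  shows "(\<lambda>x. cnj (\<phi> x)) \<in> schwartz_space"
proof -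
  let ?X = "{\<lambda>x. cnj (\<phi> x) |\<phi>. \<phi> \<in> schwartz_space}"
  have der: "((\<lambda>x. cnj (\<phi> x)) has_derivative
      (\<lambda>h. cnj (\<Sum>j\<in>UNIV. (h $ j) *\<^sub>R partial_deriv j \<phi> x))) (at x)"
    if "\<phi> \<in> schwartz_space" for \<phi> x
    by (intro has_derivative_cnj schwartz_has_derivative that)
  show ?thesis
  proof (rule schwartz_coinduct[of _ ?X])
    show "f differentiable (at x)" if "f \<in> ?X" for f x
      using that der unfolding differentiable_def by blast
    show "partial_deriv j f \<in> ?X" if "f \<in> ?X" for f j
    proof -
      obtain \<phi> where f: "f = (\<lambda>x. cnj (\<phi> x))" and S: "\<phi> \<in> schwartz_space"
        using \<open>f \<in> ?X\<close> by blast
      have "partial_deriv j f = (\<lambda>x. cnj (partial_deriv j \<phi> x))"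
        unfolding f
        by (rule ext, subst partial_deriv_eq[OF der[OF S]]) (simp only: sum_axis_scaleR)
      then show ?thesis using S schwartz_partial_deriv by blast
    qed
    show "rapidly_decaying f" if "f \<in> ?X" for f
      using that schwartz_rapidly_decaying by (fastforce simp: rapidly_decaying_def)
  qed (use assms in blast)
qed

section \<open>Integrals of Schwartz functions and Gaussians\<close>

lemma lborel_integral_prod_Basis:
  fixes f :: "'a::euclidean_space \<Rightarrow> real \<Rightarrow> 'b::{real_normed_field,banach,second_countable_topology}"
  assumes f: "\<And>b. b \<in> Basis \<Longrightarrow> integrable lborel (f b)"
  shows "integrable lborel (\<lambda>x. \<Prod>b\<in>Basis. f b (x \<bullet> b))" (is ?int)
    and "(LINT x|lborel. (\<Prod>b\<in>Basis. f b (x \<bullet> b))) = (\<Prod>b\<in>Basis. (LINT x|lborel. f b x))" (is ?eq)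
proof -
  interpret product_sigma_finite "\<lambda>_::'a. lborel :: real measure" ..
  let ?T = "\<lambda>f. \<Sum>b\<in>Basis. f b *\<^sub>R b :: 'a"
  have T: "?T \<in> measurable (\<Pi>\<^sub>M b\<in>(Basis::'a set). lborel) borel"
    by measurable
  have [measurable]: "f b \<in> borel_measurable borel" if "b \<in> Basis" for b
    using borel_measurable_integrable[OF f[OF that]] by simp
  have m: "(\<lambda>x. \<Prod>b\<in>Basis. f b (x \<bullet> b)) \<in> borel_measurable borel"
    by measurable
  have comp: "(\<Prod>b\<in>Basis. f b (?T g \<bullet> b)) = (\<Prod>b\<in>Basis. f b (g b))" for g
    by (intro prod.cong refl) simp
  have leq: "(lborel :: 'a measure) = distr (\<Pi>\<^sub>M b\<in>Basis. lborel) borel ?T"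
    by (rule lborel_eq)
  show ?int
    unfolding leq using product_integrable_prod[of Basis f] f
    by (simp add: integrable_distr_eq[OF T m] comp)
  show ?eq
    unfolding leq using product_integral_prod[of Basis f] f
    by (simp add: integral_distr[OF T m] comp)
qed

text \<open>
  An integrable function that decays quadratically in each variable. The product form reduces its
  integrability to dimension one.
\<close>

definition weight :: "'a::euclidean_space \<Rightarrow> real" where
  "weight x = (\<Prod>b\<in>Basis. inverse (1 + (x \<bullet> b)\<^sup>2))"

lemma weight_pos: "weight x > 0"
  unfolding weight_def by (intro prod_pos) (auto intro: add_pos_nonneg)

lemma integrable_weight: "integrable lborel (weight :: 'a::euclidean_space \<Rightarrow> real)"
proof -
  have "integrable lborel (\<lambda>x::real. inverse (1 + x\<^sup>2))"
    using integrable_inverse_1_plus_square by (simp add: set_integrable_def einterval_def)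
  from lborel_integral_prod_Basis(1)[OF this, where ?'a = 'a] show ?thesis
    by (simp add: weight_def[abs_def])
qed

text \<open>
  \<open>\<Prod>\<^sub>b (1 + x\<^sub>b\<^sup>2) \<le> (1 + |x|\<^sup>2)\<^sup>n\<close>, so bounds for \<open>z\<close> and \<open>|x|\<^sup>2\<^sup>n z\<close> make \<open>z\<close> integrable. The bound is
  linear in \<open>z\<close>, which is what continuity with respect to the Schwartz seminorms requires.
\<close>

lemma le_weight:
  fixes x :: "'a::euclidean_space"
  assumes "z \<ge> 0"
  shows "z \<le> 2 ^ DIM('a) * (z + norm x ^ (2 * DIM('a)) * z) * weight x"
proof -
  let ?n = "DIM('a)"
  have "(\<Prod>b\<in>Basis. 1 + (x \<bullet> b)\<^sup>2) \<le> (\<Prod>b\<in>(Basis::'a set). 1 + (norm x)\<^sup>2)"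
  proof (intro prod_mono conjI)
    fix b :: 'a assume b: "b \<in> Basis"
    have "\<bar>x \<bullet> b\<bar> \<le> norm x" using Basis_le_norm[OF b] .
    then show "1 + (x \<bullet> b)\<^sup>2 \<le> 1 + (norm x)\<^sup>2"
      using power_mono[of "\<bar>x \<bullet> b\<bar>" "norm x" 2] by simp
  qed auto
  also have "\<dots> = (1 + (norm x)\<^sup>2) ^ ?n" by simp
  also have "\<dots> \<le> (2 * max 1 ((norm x)\<^sup>2)) ^ ?n"
    by (intro power_mono) (auto simp: max_def)
  also have "\<dots> \<le> 2 ^ ?n * (1 + norm x ^ (2 * ?n))"
    by (auto simp: max_def power_mult_distrib power_mult)
  finally have le: "(\<Prod>b\<in>Basis. 1 + (x \<bullet> b)\<^sup>2) \<le> 2 ^ ?n * (1 + norm x ^ (2 * ?n))" .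
  have "1 = (\<Prod>b\<in>Basis. 1 + (x \<bullet> b)\<^sup>2) * weight x"
    unfolding weight_def prod.distrib[symmetric]
    by (intro prod.neutral[symmetric] ballI right_inverse) (metis add_pos_nonneg less_numeral_extra(1) order_less_irrefl zero_le_power2)
  also have "\<dots> \<le> 2 ^ ?n * (1 + norm x ^ (2 * ?n)) * weight x"
    using le weight_pos[of x] by (intro mult_right_mono) auto
  finally have "z * 1 \<le> z * (2 ^ ?n * (1 + norm x ^ (2 * ?n)) * weight x)"
    by (intro mult_left_mono assms)
  then show ?thesis by (simp add: algebra_simps)
qed

lemma schwartz_continuous_on: "\<phi> \<in> schwartz_space \<Longrightarrow> continuous_on UNIV \<phi>"
  by (metis differentiable_at_withinI differentiable_imp_continuous_on differentiable_on_def schwartz_differentiable)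

lemma schwartz_measurable: "\<phi> \<in> schwartz_space \<Longrightarrow> \<phi> \<in> borel_measurable borel"
  by (intro borel_measurable_continuous_onI schwartz_continuous_on)

lemma schwartz_integrable:
  fixes \<phi> :: "real ^ 'n::finite \<Rightarrow> complex"
  assumes "\<phi> \<in> schwartz_space"
  shows "integrable lborel \<phi>"
proof -
  let ?n = "CARD('n)"
  note rd = schwartz_rapidly_decaying[OF assms, unfolded rapidly_decaying_def]
  obtain A where A: "\<And>x. norm (\<phi> x) \<le> A"
    using spec[OF rd, of 0] by auto
  obtain B where B: "\<And>x. norm x ^ (2 * ?n) * norm (\<phi> x) \<le> B"
    using rd by blast
  show ?thesis
  proof (rule Bochner_Integration.integrable_bound)
    show "integrable lborel (\<lambda>x::real ^ 'n. 2 ^ ?n * (A + B) * weight x)"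
      by (simp add: integrable_weight)
    have "norm (\<phi> x) \<le> 2 ^ ?n * (A + B) * weight x" for x
    proof -
      have "norm (\<phi> x) \<le> 2 ^ ?n * (norm (\<phi> x) + norm x ^ (2 * ?n) * norm (\<phi> x)) * weight x"
        using le_weight[of "norm (\<phi> x)" x] by simp
      also have "\<dots> \<le> 2 ^ ?n * (A + B) * weight x"
        using A[of x] B[of x] weight_pos[of x] by (intro mult_right_mono mult_left_mono add_mono) auto
      finally show ?thesis .
    qed
    moreover have "\<bar>2 ^ ?n * (A + B) * weight x\<bar> = 2 ^ ?n * (A + B) * weight x" for x :: "real ^ 'n"
      by (metis abs_of_nonneg calculation norm_ge_zero order_trans)
    ultimately show "AE x in lborel. norm (\<phi> x) \<le> norm (2 ^ ?n * (A + B) * weight x)"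
      by simp
  qed (use schwartz_measurable[OF assms] in simp)
qed

lemma schwartz_bounded:
  assumes "\<phi> \<in> schwartz_space"
  obtains B where "\<And>x. norm (\<phi> x) \<le> B" "B > 0"
  using rapidly_decaying_bounded schwartz_rapidly_decaying[OF assms] by blast

lemma schwartz_norm_square_mult:
  fixes \<phi> :: "real ^ 'n::finite \<Rightarrow> complex"
  assumes "\<phi> \<in> schwartz_space"
  shows "(\<lambda>x. of_real ((norm x)\<^sup>2) * \<phi> x) \<in> schwartz_space"
proof -
  have "(\<lambda>x. \<Sum>i\<in>UNIV. of_real (x $ i) * (of_real (x $ i) * \<phi> x)) \<in> schwartz_space"
    by (intro schwartz_sum schwartz_coord_mult assms)
  moreover have "(norm x)\<^sup>2 = (\<Sum>i\<in>UNIV. x $ i * x $ i)" for x :: "real ^ 'n"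
    unfolding power2_norm_eq_inner inner_vec_def by simp
  then have "(\<lambda>x. \<Sum>i\<in>UNIV. of_real (x $ i) * (of_real (x $ i) * \<phi> x)) = (\<lambda>x. of_real ((norm x)\<^sup>2) * \<phi> x)"
    by (simp add: sum_distrib_right mult.assoc)
  ultimately show ?thesis by simp
qed

lemma schwartz_lipschitz:
  fixes \<phi> :: "real ^ 'n::finite \<Rightarrow> complex"
  assumes "\<phi> \<in> schwartz_space"
  obtains L where "\<And>x y. norm (\<phi> x - \<phi> y) \<le> L * norm (x - y)" "L \<ge> 0"
proof -
  have "\<forall>i. \<exists>B>0. \<forall>x. norm (partial_deriv i \<phi> x) \<le> B"
    using schwartz_bounded schwartz_partial_deriv[OF assms] by metis
  then obtain B where B: "\<And>i x. norm (partial_deriv i \<phi> x) \<le> B i" "\<And>i. B i > 0"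
    by metis
  have "norm (\<phi> x - \<phi> y) \<le> (\<Sum>i\<in>UNIV. B i) * norm (x - y)" for x y
  proof (rule differentiable_bound[of UNIV])
    show "(\<phi> has_derivative (\<lambda>h. \<Sum>i\<in>UNIV. (h $ i) *\<^sub>R partial_deriv i \<phi> x)) (at x within UNIV)" for x
      using schwartz_has_derivative[OF assms] by simp
    show "onorm (\<lambda>h. \<Sum>i\<in>UNIV. (h $ i) *\<^sub>R partial_deriv i \<phi> x) \<le> (\<Sum>i\<in>UNIV. B i)" for x
    proof (rule onorm_le)
      fix h :: "real ^ 'n"
      have "norm (\<Sum>i\<in>UNIV. (h $ i) *\<^sub>R partial_deriv i \<phi> x) \<le> (\<Sum>i\<in>UNIV. norm h * B i)"
        using B by (intro sum_norm_le) (auto intro!: mult_mono component_le_norm_cart)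
      then show "norm (\<Sum>i\<in>UNIV. (h $ i) *\<^sub>R partial_deriv i \<phi> x) \<le> (\<Sum>i\<in>UNIV. B i) * norm h"
        by (simp add: sum_distrib_left mult.commute)
    qed
  qed auto
  then show ?thesis using that[of "\<Sum>i\<in>UNIV. B i"] B(2) by (simp add: sum_nonneg less_imp_le)
qed

lemma lborel_integral_translate:
  fixes f :: "'a::euclidean_space \<Rightarrow> 'b::{banach,second_countable_topology}"
  assumes [measurable]: "f \<in> borel_measurable borel"
  shows "(LINT x|lborel. f (x + c)) = (LINT x|lborel. f x)"
proof -
  have "(LINT x|lborel. f x) = (LINT x|distr lborel borel ((+) c). f x)"
    by (simp add: lborel_distr_plus)
  also have "\<dots> = (LINT x|lborel. f (c + x))"
    by (subst integral_distr) auto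
  finally show ?thesis by (simp add: add.commute)
qed

lemma lborel_integrable_translate:
  fixes f :: "'a::euclidean_space \<Rightarrow> 'b::{banach,second_countable_topology}"
  assumes "integrable lborel f"
  shows "integrable lborel (\<lambda>x. f (x + c))"
proof -
  have "integrable (distr lborel borel ((+) c)) f"
    using assms by (simp add: lborel_distr_plus)
  then have "integrable lborel (\<lambda>x. f (c + x))"
    by (subst (asm) integrable_distr_eq) (use borel_measurable_integrable[OF assms] in auto)
  then show ?thesis by (simp add: add.commute)
qed

text \<open>
  By translation invariance \<open>\<phi>(x + e\<^sub>i) - \<phi>(x)\<close> has integral zero. It equals the average over
  \<open>s \<in> [0, 1]\<close> of \<open>\<partial>\<^sub>i \<phi>(x + s e\<^sub>i)\<close>, and all these translates have the same integral.
\<close>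

lemma schwartz_integral_partial_deriv:
  fixes \<phi> :: "real ^ 'n::finite \<Rightarrow> complex"
  assumes S: "\<phi> \<in> schwartz_space"
  shows "(LINT x|lborel. partial_deriv i \<phi> x) = 0"
proof -
  let ?e = "axis i 1 :: real ^ 'n"
  let ?D = "partial_deriv i \<phi>"
  have DS: "?D \<in> schwartz_space" using schwartz_partial_deriv[OF S] .
  note [measurable] = schwartz_measurable[OF S] schwartz_measurable[OF DS]
  let ?F = "\<lambda>(s::real, x). indicator {0..1} s *\<^sub>R ?D (x + s *\<^sub>R ?e)"
  have inner: "(LINT s|lborel. ?F (s, x)) = \<phi> (x + ?e) - \<phi> x" for x
  proof -
    have "((\<lambda>s. \<phi> (x + s *\<^sub>R ?e)) has_vector_derivative ?D (x + s *\<^sub>R ?e)) (at s within {0..1})" for s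
    proof -
      have "((\<lambda>s. x + s *\<^sub>R ?e) has_derivative (\<lambda>h. h *\<^sub>R ?e)) (at s)"
        by (auto intro!: derivative_eq_intros)
      from has_derivative_compose[OF this schwartz_has_derivative[OF S]]
      have "((\<lambda>s. \<phi> (x + s *\<^sub>R ?e)) has_derivative
        (\<lambda>h. \<Sum>j\<in>UNIV. (h *\<^sub>R ?e) $ j *\<^sub>R partial_deriv j \<phi> (x + s *\<^sub>R ?e))) (at s)" .
      moreover have "(\<Sum>j\<in>UNIV. (h *\<^sub>R ?e) $ j *\<^sub>R partial_deriv j \<phi> (x + s *\<^sub>R ?e)) = h *\<^sub>R ?D (x + s *\<^sub>R ?e)" for h
      proof -
        have "(\<Sum>j\<in>UNIV. (h *\<^sub>R ?e) $ j *\<^sub>R partial_deriv j \<phi> (x + s *\<^sub>R ?e)) =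
          h *\<^sub>R (\<Sum>j\<in>UNIV. (?e $ j) *\<^sub>R partial_deriv j \<phi> (x + s *\<^sub>R ?e))"
          by (simp add: scaleR_sum_right)
        then show ?thesis by (simp only: sum_axis_scaleR)
      qed
      ultimately show ?thesis
        by (simp add: has_vector_derivative_def has_derivative_at_withinI)
    qed
    moreover have "continuous_on {0..1} (\<lambda>s. ?D (x + s *\<^sub>R ?e))"
      by (intro continuous_on_compose2[OF schwartz_continuous_on[OF DS]] continuous_intros) auto
    ultimately have "has_bochner_integral lborel (\<lambda>s. indicator {0..1} s *\<^sub>R ?D (x + s *\<^sub>R ?e))
        (\<phi> (x + 1 *\<^sub>R ?e) - \<phi> (x + 0 *\<^sub>R ?e))"
      by (intro has_bochner_integral_FTC_Icc) auto
    then show ?thesis by (simp add: has_bochner_integral_integral_eq)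
  qed
  have int: "integrable (lborel \<Otimes>\<^sub>M lborel) ?F"
  proof (rule lborel_pair.Fubini_integrable)
    have "(LINT x|lborel. norm (?F (s, x))) = indicator {0..1} s *\<^sub>R (LINT x|lborel. norm (?D x))" for s
      using lborel_integral_translate[of "\<lambda>x. norm (?D x)" "s *\<^sub>R ?e"] by (simp add: indicator_def)
    then show "integrable lborel (\<lambda>s. (LINT x|lborel. norm (?F (s, x))))"
      by (simp only:) (intro integrable_scaleR_left, simp)
    show "AE s in lborel. integrable lborel (\<lambda>x. ?F (s, x))"
      using lborel_integrable_translate[OF schwartz_integrable[OF DS]] by simp
  qed measurable
  have "0 = (LINT x|lborel. \<phi> (x + ?e) - \<phi> x)"
    using lborel_integral_translate[of \<phi> ?e] schwartz_integrable[OF S]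
      lborel_integrable_translate[OF schwartz_integrable[OF S], of ?e] by simp
  also have "\<dots> = (LINT x|lborel. (LINT s|lborel. ?F (s, x)))"
    unfolding inner ..
  also have "\<dots> = (LINT s|lborel. (LINT x|lborel. ?F (s, x)))"
    using lborel_pair.Fubini_integral[of "\<lambda>s x. ?F (s, x)"] int by simp
  also have "\<dots> = (LINT x|lborel. ?D x)"
    using lborel_integral_translate[of ?D] by simp
  finally show ?thesis by simp
qed

lemma borel_measurable_cis [measurable]: "cis \<in> borel_measurable borel"
  by (intro borel_measurable_continuous_onI continuous_intros)

text \<open>
  The characteristic function of the standard normal distribution, rescaled.
\<close>

lemma gauss_char_1d:
  assumes "\<epsilon> > 0"
  shows "integrable lborel (\<lambda>x. cis (x * \<xi>) * complex_of_real (exp (- (\<epsilon> * x\<^sup>2 / 2))))" (is ?int)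
    and "(LINT x|lborel. cis (x * \<xi>) * complex_of_real (exp (- (\<epsilon> * x\<^sup>2 / 2)))) =
         complex_of_real (sqrt (2 * pi / \<epsilon>) * exp (- (\<xi>\<^sup>2 / \<epsilon> / 2)))" (is ?eq)
proof -
  have "integrable lborel (\<lambda>x. sqrt (2 * pi / \<epsilon>) * normal_density 0 (1 / sqrt \<epsilon>) x)"
    using assms by (intro integrable_mult_right integrable_normal_density) auto
  moreover have "sqrt (2 * pi / \<epsilon>) * normal_density 0 (1 / sqrt \<epsilon>) x = exp (- (\<epsilon> * x\<^sup>2 / 2))" for x
    using assms by (simp add: normal_density_def power_divide real_sqrt_divide real_sqrt_mult mult.commute)
  ultimately have i: "integrable lborel (\<lambda>x. exp (- (\<epsilon> * x\<^sup>2 / 2)))"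
    by simp
  show ?int
    by (rule Bochner_Integration.integrable_bound[OF i]) (auto simp: norm_mult)
  let ?t = "\<xi> / sqrt \<epsilon>"
  let ?f = "\<lambda>x. (1 / sqrt (2 * pi)) *\<^sub>R (complex_of_real (exp (- x\<^sup>2 / 2)) * cis (?t * x))"
  have "complex_of_real (exp (- (?t\<^sup>2) / 2)) = (CLINT x|std_normal_distribution. iexp (?t * x))"
    using fun_cong[OF char_std_normal_distribution, of ?t] by (simp add: char_def)
  also have "\<dots> = (LINT x|lborel. std_normal_density x *\<^sub>R iexp (?t * x))"
    by (subst integral_density) (auto simp: normal_density_nonneg)
  also have "\<dots> = (LINT x|lborel. ?f x)"
    by (intro Bochner_Integration.integral_cong)
       (auto simp: std_normal_density_def cis_conv_exp scaleR_conv_of_real)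
  also have "\<dots> = sqrt \<epsilon> *\<^sub>R (LINT x|lborel. ?f (0 + sqrt \<epsilon> * x))"
    using lborel_integral_real_affine[of "sqrt \<epsilon>" ?f 0] assms by simp
  also have "(\<lambda>x. ?f (0 + sqrt \<epsilon> * x)) =
      (\<lambda>x. (1 / sqrt (2 * pi)) *\<^sub>R (cis (x * \<xi>) * complex_of_real (exp (- (\<epsilon> * x\<^sup>2 / 2)))))"
    using assms by (simp add: power_mult_distrib fun_eq_iff mult.commute)
  finally have "complex_of_real (exp (- (?t\<^sup>2) / 2)) = (sqrt \<epsilon> / sqrt (2 * pi)) *\<^sub>R
     (LINT x|lborel. cis (x * \<xi>) * complex_of_real (exp (- (\<epsilon> * x\<^sup>2 / 2))))"
    by simp
  then have "(sqrt (2 * pi) / sqrt \<epsilon>) *\<^sub>R complex_of_real (exp (- (?t\<^sup>2) / 2)) =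
     (LINT x|lborel. cis (x * \<xi>) * complex_of_real (exp (- (\<epsilon> * x\<^sup>2 / 2))))"
    using assms by simp
  then show ?eq
    using assms by (simp add: power_divide real_sqrt_divide scaleR_conv_of_real)
qed

lemma gauss_char:
  assumes "\<epsilon> > 0"
  shows "integrable lborel (\<lambda>x::real ^ 'n::finite. cis (x \<bullet> \<xi>) * complex_of_real (gauss \<epsilon> x))" (is ?int)
    and "(LINT x|lborel. cis (x \<bullet> \<xi>) * complex_of_real (gauss \<epsilon> (x::real ^ 'n::finite))) =
         complex_of_real ((2 * pi / \<epsilon>) powr (real CARD('n) / 2) * gauss (1 / \<epsilon>) \<xi>)" (is ?eq)
proof -
  let ?f = "\<lambda>(b::real ^ 'n) x. cis (x * (\<xi> \<bullet> b)) * complex_of_real (exp (- (\<epsilon> * x\<^sup>2 / 2)))"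
  have norm2: "(norm x)\<^sup>2 = (\<Sum>b\<in>Basis. (x \<bullet> b)\<^sup>2)" for x :: "real ^ 'n"
    unfolding power2_norm_eq_inner by (subst euclidean_inner) (simp add: power2_eq_square)
  have eq: "(\<Prod>b\<in>Basis. ?f b (x \<bullet> b)) = cis (x \<bullet> \<xi>) * complex_of_real (gauss \<epsilon> x)" for x
  proof -
    have "gauss \<epsilon> x = (\<Prod>b\<in>Basis. exp (- (\<epsilon> * (x \<bullet> b)\<^sup>2 / 2)))"
      unfolding gauss_def norm2
      by (subst exp_sum[symmetric]) (auto simp: sum_negf sum_distrib_left sum_divide_distrib)
    moreover have "cis (x \<bullet> \<xi>) = (\<Prod>b\<in>Basis. cis ((x \<bullet> b) * (\<xi> \<bullet> b)))"
      unfolding cis_conv_exp by (subst exp_sum[symmetric]) (auto simp: euclidean_inner[of x \<xi>] sum_distrib_left)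
    ultimately show ?thesis by (simp add: prod.distrib)
  qed
  note p = lborel_integral_prod_Basis[of ?f, OF gauss_char_1d(1)[OF assms]]
  show ?int using p(1) unfolding eq .
  have "(LINT x|lborel. cis (x \<bullet> \<xi>) * complex_of_real (gauss \<epsilon> (x::real ^ 'n))) =
    (\<Prod>b\<in>(Basis::(real ^ 'n) set). complex_of_real (sqrt (2 * pi / \<epsilon>) * exp (- ((\<xi> \<bullet> b)\<^sup>2 / \<epsilon> / 2))))"
    using p(2) unfolding eq gauss_char_1d(2)[OF assms] .
  also have "\<dots> = complex_of_real (sqrt (2 * pi / \<epsilon>) ^ CARD('n) * (\<Prod>b\<in>(Basis::(real ^ 'n) set). exp (- ((\<xi> \<bullet> b)\<^sup>2 / \<epsilon> / 2))))"
    by (simp add: prod.distrib)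
  also have "(\<Prod>b\<in>(Basis::(real ^ 'n) set). exp (- ((\<xi> \<bullet> b)\<^sup>2 / \<epsilon> / 2))) = gauss (1 / \<epsilon>) \<xi>"
    unfolding gauss_def norm2
    by (subst exp_sum[symmetric]) (auto simp: sum_negf sum_distrib_left sum_divide_distrib)
  also have "sqrt (2 * pi / \<epsilon>) ^ CARD('n) = (2 * pi / \<epsilon>) powr (real CARD('n) / 2)"
    using assms by (simp add: powr_half_sqrt[symmetric] powr_power)
  finally show ?eq .
qed

section \<open>The Fourier transform on the Schwartz space\<close>

lemma borel_measurable_cnj [measurable]: "cnj \<in> borel_measurable borel"
  by (intro borel_measurable_continuous_onI continuous_intros)

definition fourier_const :: "'n itself \<Rightarrow> real" where
  "fourier_const _ = (2 * pi) powr (- (real CARD('n) / 2))"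

lemma fourier_const_pos [simp]: "fourier_const TYPE('n) > 0"
  by (simp add: fourier_const_def)

lemma fourier_altdef:
  "fourier \<phi> \<xi> = of_real (fourier_const TYPE('n)) * (LINT x|lborel. cis (- (x \<bullet> \<xi>)) * \<phi> x)"
  for \<phi> :: "real ^ 'n::finite \<Rightarrow> complex"
  by (simp add: fourier_def fourier_const_def)

lemma inv_fourier_altdef:
  "inv_fourier \<phi> x = of_real (fourier_const TYPE('n)) * (LINT \<xi>|lborel. cis (x \<bullet> \<xi>) * \<phi> \<xi>)"
  for \<phi> :: "real ^ 'n::finite \<Rightarrow> complex"
  by (simp add: inv_fourier_def fourier_const_def)

text \<open>
  Conjugation exchanges the two transforms, so that statements about one of them carry over to the
  other.
\<close>

lemma inv_fourier_conv_fourier: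
  fixes \<phi> :: "real ^ 'n::finite \<Rightarrow> complex"
  shows "inv_fourier \<phi> = (\<lambda>x. cnj (fourier (\<lambda>y. cnj (\<phi> y)) x))"
proof
  fix x :: "real ^ 'n"
  have "cnj (LINT y|lborel. cis (- (y \<bullet> x)) * cnj (\<phi> y)) = (LINT y|lborel. cnj (cis (- (y \<bullet> x)) * cnj (\<phi> y)))"
    by (rule Bochner_Integration.integral_cnj[symmetric])
  then show "inv_fourier \<phi> x = cnj (fourier (\<lambda>y. cnj (\<phi> y)) x)"
    by (simp add: inv_fourier_altdef fourier_altdef cis_cnj inner_commute)
qed

lemma fourier_conv_inv_fourier:
  "fourier \<phi> = (\<lambda>x. cnj (inv_fourier (\<lambda>y. cnj (\<phi> y)) x))"
  by (simp add: inv_fourier_conv_fourier)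

lemma integrable_character_mult:
  fixes \<phi> :: "real ^ 'n::finite \<Rightarrow> complex"
  assumes "integrable lborel \<phi>" "g \<in> borel_measurable borel"
  shows "integrable lborel (\<lambda>x. cis (g x) * \<phi> x)"
  using assms(2) borel_measurable_integrable[OF assms(1)]
  by (intro Bochner_Integration.integrable_bound[OF assms(1)]) (auto simp: norm_mult)

lemma norm_fourier_le:
  fixes \<phi> :: "real ^ 'n::finite \<Rightarrow> complex"
  assumes "integrable lborel \<phi>"
  shows "norm (fourier \<phi> \<xi>) \<le> fourier_const TYPE('n) * (LINT x|lborel. norm (\<phi> x))"
proof -
  have "norm (LINT x|lborel. cis (- (x \<bullet> \<xi>)) * \<phi> x) \<le> (LINT x|lborel. norm (cis (- (x \<bullet> \<xi>)) * \<phi> x))"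
    by (rule integral_norm_bound)
  then show ?thesis
    by (simp add: fourier_altdef norm_mult abs_of_pos)
qed

lemma norm_inv_fourier_le:
  fixes \<phi> :: "real ^ 'n::finite \<Rightarrow> complex"
  assumes "integrable lborel \<phi>"
  shows "norm (inv_fourier \<phi> \<xi>) \<le> fourier_const TYPE('n) * (LINT x|lborel. norm (\<phi> x))"
  using norm_fourier_le[of "\<lambda>x. cnj (\<phi> x)"] assms by (simp add: inv_fourier_conv_fourier)

lemma borel_measurable_fourier:
  fixes \<phi> :: "real ^ 'n::finite \<Rightarrow> complex"
  assumes [measurable]: "\<phi> \<in> borel_measurable borel"
  shows "fourier \<phi> \<in> borel_measurable borel"
proof -
  have "(\<lambda>\<xi>. (LINT x|lborel. cis (- (x \<bullet> \<xi>)) * \<phi> x)) \<in> borel_measurable borel"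
    by (rule sigma_finite_measure.borel_measurable_lebesgue_integral[OF sigma_finite_lborel]) measurable
  then show ?thesis by (subst fourier_altdef[abs_def]) measurable
qed

lemma borel_measurable_inv_fourier:
  fixes \<phi> :: "real ^ 'n::finite \<Rightarrow> complex"
  assumes [measurable]: "\<phi> \<in> borel_measurable borel"
  shows "inv_fourier \<phi> \<in> borel_measurable borel"
proof -
  have [measurable]: "fourier (\<lambda>y. cnj (\<phi> y)) \<in> borel_measurable borel"
    by (rule borel_measurable_fourier) measurable
  show ?thesis unfolding inv_fourier_conv_fourier by measurable
qed

text \<open>
  Integration by parts: a derivative of \<open>e\<^sup>-\<^sup>i\<^sup>x\<^sup>\<xi> \<phi>(x)\<close>, which is again a Schwartz function, has integral
  zero.
\<close>

lemma fourier_partial_deriv: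
  fixes \<phi> :: "real ^ 'n::finite \<Rightarrow> complex"
  assumes S: "\<phi> \<in> schwartz_space"
  shows "fourier (partial_deriv j \<phi>) \<xi> = \<i> * of_real (\<xi> $ j) * fourier \<phi> \<xi>"
proof -
  let ?e = "\<lambda>x. cis (x \<bullet> (- \<xi>))"
  have "((\<lambda>x. x \<bullet> (- \<xi>)) has_derivative (\<lambda>h. h \<bullet> (- \<xi>))) (at x)" for x :: "real ^ 'n"
    by (auto intro!: derivative_eq_intros)
  from has_derivative_mult[OF has_derivative_cis[OF this] schwartz_has_derivative[OF S]]
  have "partial_deriv j (\<lambda>x. ?e x * \<phi> x) x = ?e x * partial_deriv j \<phi> x - \<i> * of_real (\<xi> $ j) * (?e x * \<phi> x)" for x
    by (subst partial_deriv_eq, assumption) (simp only: sum_axis_scaleR, simp add: inner_axis' algebra_simps)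
  then have "0 = (LINT x|lborel. ?e x * partial_deriv j \<phi> x - \<i> * of_real (\<xi> $ j) * (?e x * \<phi> x))"
    using schwartz_integral_partial_deriv[OF schwartz_character_mult[OF S, of "- \<xi>"], of j] by simp
  also have "\<dots> = (LINT x|lborel. ?e x * partial_deriv j \<phi> x) - \<i> * of_real (\<xi> $ j) * (LINT x|lborel. ?e x * \<phi> x)"
    using schwartz_integrable[OF schwartz_character_mult[OF S, of "- \<xi>"]]
      schwartz_integrable[OF schwartz_character_mult[OF schwartz_partial_deriv[OF S], of "- \<xi>" j]]
    by (simp del: inner_minus_right)
  finally show ?thesis by (simp add: fourier_altdef algebra_simps)
qed

lemma norm_cis_taylor: "norm (cis u - 1 - \<i> * of_real u) \<le> u\<^sup>2 / 2"
  using iexp_approx1[of u 1] by (simp add: cis_conv_exp power2_eq_square algebra_simps)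

text \<open>
  The second-order Taylor bound for the character gives an error
  \<open>O(|\<eta> - \<xi>|\<^sup>2) \<integral> |x|\<^sup>2 |\<phi>(x)| dx\<close>, which yields the total derivative at once.
\<close>

lemma fourier_has_derivative:
  fixes \<phi> :: "real ^ 'n::finite \<Rightarrow> complex"
  assumes S: "\<phi> \<in> schwartz_space"
  shows "(fourier \<phi> has_derivative
    (\<lambda>h. \<Sum>j\<in>UNIV. (h $ j) *\<^sub>R fourier (\<lambda>x. - \<i> * (of_real (x $ j) * \<phi> x)) \<xi>)) (at \<xi>)"
proof -
  let ?c = "fourier_const TYPE('n)"
  let ?D = "\<lambda>h. \<Sum>j\<in>UNIV. (h $ j) *\<^sub>R fourier (\<lambda>x. - \<i> * (of_real (x $ j) * \<phi> x)) \<xi>"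
  let ?M = "LINT x|lborel. norm (of_real ((norm x)\<^sup>2) * \<phi> x)"
  have iM: "integrable lborel (\<lambda>x. norm (of_real ((norm x)\<^sup>2) * \<phi> x))"
    using schwartz_integrable[OF schwartz_norm_square_mult[OF S]] by (rule integrable_norm)
  have i1: "integrable lborel (\<lambda>x. cis (- (x \<bullet> \<eta>)) * \<phi> x)" for \<eta>
    by (intro integrable_character_mult schwartz_integrable[OF S]) measurable
  have i2: "integrable lborel (\<lambda>x. cis (- (x \<bullet> \<xi>)) * (- \<i> * (of_real (x $ j) * \<phi> x)))" for j
    by (intro integrable_character_mult schwartz_integrable schwartz_cmult schwartz_coord_mult S) measurable
  have i3: "integrable lborel (\<lambda>x. cis (- (x \<bullet> \<xi>)) * (- \<i> * (of_real (x \<bullet> h) * \<phi> x)))"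
    and D: "?D h = of_real ?c * (LINT x|lborel. cis (- (x \<bullet> \<xi>)) * (- \<i> * (of_real (x \<bullet> h) * \<phi> x)))" for h
  proof -
    have eq: "(\<lambda>x. cis (- (x \<bullet> \<xi>)) * (- \<i> * (of_real (x \<bullet> h) * \<phi> x))) =
      (\<lambda>x. \<Sum>j\<in>UNIV. of_real (h $ j) * (cis (- (x \<bullet> \<xi>)) * (- \<i> * (of_real (x $ j) * \<phi> x))))"
      by (simp add: inner_vec_def sum_distrib_left sum_distrib_right sum_negf mult_ac)
    show "integrable lborel (\<lambda>x. cis (- (x \<bullet> \<xi>)) * (- \<i> * (of_real (x \<bullet> h) * \<phi> x)))"
      unfolding eq by (intro Bochner_Integration.integrable_sum integrable_mult_right i2)
    have "(LINT x|lborel. cis (- (x \<bullet> \<xi>)) * (- \<i> * (of_real (x \<bullet> h) * \<phi> x))) =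
      (\<Sum>j\<in>UNIV. of_real (h $ j) * (LINT x|lborel. cis (- (x \<bullet> \<xi>)) * (- \<i> * (of_real (x $ j) * \<phi> x))))"
      unfolding eq
      by (subst Bochner_Integration.integral_sum) (intro integrable_mult_right i2, simp only: integral_mult_right_zero)
    then show "?D h = of_real ?c * (LINT x|lborel. cis (- (x \<bullet> \<xi>)) * (- \<i> * (of_real (x \<bullet> h) * \<phi> x)))"
      by (simp add: fourier_altdef sum_distrib_left scaleR_conv_of_real mult_ac)
  qed
  have bound: "norm (fourier \<phi> \<eta> - fourier \<phi> \<xi> - ?D (\<eta> - \<xi>)) \<le> ?c * (?M * (norm (\<eta> - \<xi>))\<^sup>2)" for \<eta>
  proof -
    let ?h = "\<eta> - \<xi>"
    let ?R = "\<lambda>x. cis (- (x \<bullet> \<eta>)) * \<phi> x - cis (- (x \<bullet> \<xi>)) * \<phi> x - cis (- (x \<bullet> \<xi>)) * (- \<i> * (of_real (x \<bullet> ?h) * \<phi> x))"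
    have eq: "fourier \<phi> \<eta> - fourier \<phi> \<xi> - ?D ?h = of_real ?c * (LINT x|lborel. ?R x)"
      unfolding D unfolding fourier_altdef right_diff_distrib[symmetric]
      using i1[of \<eta>] i1[of \<xi>] i3[of ?h] by simp
    have "norm (fourier \<phi> \<eta> - fourier \<phi> \<xi> - ?D ?h) = ?c * norm (LINT x|lborel. ?R x)"
      unfolding eq by (simp add: norm_mult abs_of_pos)
    also have "\<dots> \<le> ?c * (LINT x|lborel. norm (of_real ((norm x)\<^sup>2) * \<phi> x) * (norm ?h)\<^sup>2)"
    proof (intro mult_left_mono Bochner_Integration.integral_norm_bound_integral)
      show "integrable lborel ?R"
        by (intro Bochner_Integration.integrable_diff i1 i3)
      show "integrable lborel (\<lambda>x. norm (of_real ((norm x)\<^sup>2) * \<phi> x) * (norm ?h)\<^sup>2)"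
        using iM by (rule integrable_mult_left)
      fix x
      have "?R x = cis (- (x \<bullet> \<xi>)) * (cis (- (x \<bullet> ?h)) - 1 - \<i> * of_real (- (x \<bullet> ?h))) * \<phi> x"
        by (simp add: algebra_simps cis_mult inner_diff_right)
      then have "norm (?R x) = norm (cis (- (x \<bullet> ?h)) - 1 - \<i> * of_real (- (x \<bullet> ?h))) * norm (\<phi> x)"
        by (simp add: norm_mult)
      also have "\<dots> \<le> ((- (x \<bullet> ?h))\<^sup>2 / 2) * norm (\<phi> x)"
        by (intro mult_right_mono norm_cis_taylor) auto
      also have "\<dots> \<le> (norm x * norm ?h)\<^sup>2 * norm (\<phi> x)"
      proof (intro mult_right_mono)
        have "(x \<bullet> ?h)\<^sup>2 \<le> (norm x * norm ?h)\<^sup>2"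
          using power_mono[OF Cauchy_Schwarz_ineq2[of x ?h], of 2] by simp
        then show "(- (x \<bullet> ?h))\<^sup>2 / 2 \<le> (norm x * norm ?h)\<^sup>2"
          using zero_le_power2[of "norm x * norm ?h"] unfolding power2_minus by linarith
      qed simp
      finally show "norm (?R x) \<le> norm (of_real ((norm x)\<^sup>2) * \<phi> x) * (norm ?h)\<^sup>2"
        by (simp add: norm_mult power_mult_distrib norm_power mult_ac)
    qed (simp add: less_imp_le)
    finally show ?thesis by simp
  qed
  show ?thesis
  proof (rule has_derivativeI_sandwich[of 1])
    show "bounded_linear ?D"
      by (intro bounded_linear_sum bounded_linear_scaleR_const bounded_linear_vec_nth)
    show "((\<lambda>\<eta>. ?c * ?M * norm (\<eta> - \<xi>)) \<longlongrightarrow> 0) (at \<xi>)"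
      by (auto intro!: tendsto_eq_intros)
    show "norm (fourier \<phi> \<eta> - fourier \<phi> \<xi> - ?D (\<eta> - \<xi>)) / norm (\<eta> - \<xi>) \<le> ?c * ?M * norm (\<eta> - \<xi>)"
      if "\<eta> \<noteq> \<xi>" for \<eta>
      using bound[of \<eta>] that by (simp add: divide_le_eq power2_eq_square mult_ac)
  qed simp
qed

lemma fourier_rapidly_decaying:
  fixes \<phi> :: "real ^ 'n::finite \<Rightarrow> complex"
  assumes S: "\<phi> \<in> schwartz_space"
  shows "rapidly_decaying (fourier \<phi>)"
  unfolding rapidly_decaying_def
proof
  fix k
  show "\<exists>B. \<forall>\<xi>. norm \<xi> ^ k * norm (fourier \<phi> \<xi>) \<le> B"
    using S
  proof (induction k arbitrary: \<phi>)
    case 0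
    then show ?case
      using norm_fourier_le[OF schwartz_integrable[OF 0]] by auto
  next
    case (Suc k)
    have "\<forall>j. \<exists>B. \<forall>\<xi>. norm \<xi> ^ k * norm (fourier (partial_deriv j \<phi>) \<xi>) \<le> B"
      using Suc schwartz_partial_deriv by blast
    then obtain B where B: "\<And>j \<xi>. norm \<xi> ^ k * norm (fourier (partial_deriv j \<phi>) \<xi>) \<le> B j"
      by metis
    have "norm \<xi> ^ Suc k * norm (fourier \<phi> \<xi>) \<le> (\<Sum>j\<in>UNIV. B j)" for \<xi>
    proof -
      have "norm \<xi> ^ Suc k * norm (fourier \<phi> \<xi>) = norm \<xi> * (norm \<xi> ^ k * norm (fourier \<phi> \<xi>))"
        by simp
      also have "\<dots> \<le> (\<Sum>j\<in>UNIV. \<bar>\<xi> $ j\<bar>) * (norm \<xi> ^ k * norm (fourier \<phi> \<xi>))"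
        by (intro mult_right_mono norm_le_l1_cart) auto
      also have "\<dots> = (\<Sum>j\<in>UNIV. norm \<xi> ^ k * norm (fourier (partial_deriv j \<phi>) \<xi>))"
        unfolding sum_distrib_right by (simp add: fourier_partial_deriv[OF Suc.prems] norm_mult mult_ac)
      also have "\<dots> \<le> (\<Sum>j\<in>UNIV. B j)"
        by (intro sum_mono B)
      finally show ?thesis .
    qed
    then show ?case by blast
  qed
qed

theorem fourier_schwartz:
  fixes \<phi> :: "real ^ 'n::finite \<Rightarrow> complex"
  assumes "\<phi> \<in> schwartz_space"
  shows "fourier \<phi> \<in> schwartz_space"
proof (rule schwartz_coinduct[of _ "fourier ` schwartz_space"])
  show "f differentiable (at x)" if "f \<in> fourier ` schwartz_space" for f and x :: "real ^ 'n"
    using that fourier_has_derivative unfolding differentiable_def by blast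
  show "partial_deriv i f \<in> fourier ` schwartz_space" if "f \<in> fourier ` schwartz_space" for f and i :: 'n
  proof -
    obtain \<phi> where f: "f = fourier \<phi>" and S: "\<phi> \<in> schwartz_space"
      using \<open>f \<in> fourier ` schwartz_space\<close> by blast
    have "partial_deriv i f = fourier (\<lambda>x. - \<i> * (of_real (x $ i) * \<phi> x))"
      unfolding f
      by (rule ext, subst partial_deriv_eq[OF fourier_has_derivative[OF S]]) (simp only: sum_axis_scaleR)
    then show ?thesis
      using schwartz_cmult[OF schwartz_coord_mult[OF S]] by blast
  qed
qed (use assms fourier_rapidly_decaying in auto)

lemma inv_fourier_schwartz:
  fixes \<phi> :: "real ^ 'n::finite \<Rightarrow> complex"
  assumes "\<phi> \<in> schwartz_space"
  shows "inv_fourier \<phi> \<in> schwartz_space"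
  unfolding inv_fourier_conv_fourier by (intro schwartz_cnj fourier_schwartz assms)

lemma integral_kernel_swap:
  fixes a :: "'a::euclidean_space \<Rightarrow> complex" and b :: "'b::euclidean_space \<Rightarrow> complex"
  assumes a: "integrable lborel a" and b: "integrable lborel b"
    and K [measurable]: "(\<lambda>(x, y). K x y) \<in> borel_measurable (borel \<Otimes>\<^sub>M borel)"
    and K1: "\<And>x y. norm (K x y) \<le> 1"
  shows "(LINT x|lborel. (LINT y|lborel. K x y * a y) * b x) = (LINT y|lborel. a y * (LINT x|lborel. K x y * b x))"
proof -
  note [measurable] = borel_measurable_integrable[OF a] borel_measurable_integrable[OF b]
  have meas: "(\<lambda>(x, y). K x y * a y * b x) \<in> borel_measurable (lborel \<Otimes>\<^sub>M lborel)"
    by measurable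
  have bd: "norm (K x y * a y * b x) \<le> norm (a y) * norm (b x)" for x y
    using K1[of x y] mult_right_mono[OF K1, of "norm (a y) * norm (b x)"] by (simp add: norm_mult mult.assoc)
  have ay: "integrable lborel (\<lambda>y. K x y * a y * b x)" for x
  proof (rule Bochner_Integration.integrable_bound)
    show "integrable lborel (\<lambda>y. norm (a y) * norm (b x))"
      using a by (intro integrable_mult_left integrable_norm)
    show "AE y in lborel. norm (K x y * a y * b x) \<le> norm (norm (a y) * norm (b x))"
      by (intro AE_I2 order_trans[OF bd]) simp
  qed measurable
  have "integrable (lborel \<Otimes>\<^sub>M lborel) (\<lambda>(x, y). K x y * a y * b x)"
  proof (rule lborel_pair.Fubini_integrable)
    show "integrable lborel (\<lambda>x. (LINT y|lborel. norm (case (x, y) of (x, y) \<Rightarrow> K x y * a y * b x)))"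
    proof (rule Bochner_Integration.integrable_bound)
      show "integrable lborel (\<lambda>x. (LINT y|lborel. norm (a y)) * norm (b x))"
        using b by (intro integrable_mult_right integrable_norm)
      have "(LINT y|lborel. norm (K x y * a y * b x)) \<le> (LINT y|lborel. norm (a y) * norm (b x))" for x
        by (intro integral_mono integrable_norm integrable_mult_left ay a bd)
      moreover have "(LINT y|lborel. norm (K x y * a y * b x)) \<ge> 0" for x
        by simp
      ultimately show "AE x in lborel. norm (LINT y|lborel. norm (case (x, y) of (x, y) \<Rightarrow> K x y * a y * b x))
          \<le> norm ((LINT y|lborel. norm (a y)) * norm (b x))"
        by (simp add: abs_mult)
    qed measurable
    show "AE x in lborel. integrable lborel (\<lambda>y. case (x, y) of (x, y) \<Rightarrow> K x y * a y * b x)"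
      unfolding split_conv by (intro AE_I2 ay)
  qed (rule meas)
  from lborel_pair.Fubini_integral[OF this]
  have "(LINT y|lborel. (LINT x|lborel. K x y * a y * b x)) = (LINT x|lborel. (LINT y|lborel. K x y * a y * b x))"
    by simp
  moreover have "(LINT x|lborel. K x y * a y * b x) = a y * (LINT x|lborel. K x y * b x)" for y
    by (simp add: mult.assoc mult.left_commute)
  moreover have "(LINT y|lborel. K x y * a y * b x) = (LINT y|lborel. K x y * a y) * b x" for x
    by simp
  ultimately show ?thesis by simp
qed

lemma fourier_swap:
  fixes a b :: "real ^ 'n::finite \<Rightarrow> complex"
  assumes "integrable lborel a" "integrable lborel b"
  shows "(LINT x|lborel. fourier a x * b x) = (LINT x|lborel. a x * fourier b x)"
proof -
  have "(LINT x|lborel. (LINT y|lborel. cis (- (y \<bullet> x)) * a y) * b x) =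
      (LINT y|lborel. a y * (LINT x|lborel. cis (- (x \<bullet> y)) * b x))"
    by (subst integral_kernel_swap[OF assms]) (auto simp: inner_commute)
  moreover have "(LINT x|lborel. fourier a x * b x) =
      of_real (fourier_const TYPE('n)) * (LINT x|lborel. (LINT y|lborel. cis (- (y \<bullet> x)) * a y) * b x)"
    unfolding fourier_altdef mult.assoc by (rule integral_mult_right_zero)
  moreover have "(LINT y|lborel. a y * fourier b y) =
      of_real (fourier_const TYPE('n)) * (LINT y|lborel. a y * (LINT x|lborel. cis (- (x \<bullet> y)) * b x))"
    unfolding fourier_altdef mult.left_commute[of "a _" "of_real _"]
    by (rule integral_mult_right_zero)
  ultimately show ?thesis by simp
qed

lemma inv_fourier_swap:
  fixes a b :: "real ^ 'n::finite \<Rightarrow> complex"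
  assumes "integrable lborel a" "integrable lborel b"
  shows "(LINT x|lborel. inv_fourier a x * b x) = (LINT x|lborel. a x * inv_fourier b x)"
proof -
  have "(LINT x|lborel. inv_fourier a x * b x) = cnj (LINT x|lborel. fourier (\<lambda>y. cnj (a y)) x * cnj (b x))"
    by (simp add: inv_fourier_conv_fourier flip: Bochner_Integration.integral_cnj)
  also have "\<dots> = cnj (LINT x|lborel. cnj (a x) * fourier (\<lambda>y. cnj (b y)) x)"
    using assms by (subst fourier_swap) auto
  also have "\<dots> = (LINT x|lborel. a x * inv_fourier b x)"
    by (simp add: inv_fourier_conv_fourier flip: Bochner_Integration.integral_cnj)
  finally show ?thesis .
qed

section \<open>Heat kernel regularisation and Fourier inversion\<close>

text \<open>
  The centred Gaussian density with covariance \<open>\<epsilon> I\<close>.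
\<close>

definition heat :: "real \<Rightarrow> real ^ 'n::finite \<Rightarrow> real" where
  "heat \<epsilon> x = (2 * pi * \<epsilon>) powr (- (real CARD('n) / 2)) * gauss (1 / \<epsilon>) x"

lemma borel_measurable_gauss [measurable]: "gauss \<epsilon> \<in> borel_measurable borel"
  unfolding gauss_def[abs_def] by measurable

lemma borel_measurable_heat [measurable]: "heat \<epsilon> \<in> borel_measurable borel"
  unfolding heat_def[abs_def] by measurable

lemma heat_nonneg: "heat \<epsilon> x \<ge> 0"
  by (simp add: heat_def gauss_def)

lemma heat_commute: "heat \<epsilon> (x - y) = heat \<epsilon> (y - x)"
  by (simp add: heat_def gauss_def norm_minus_commute)

lemma gauss_integral:
  assumes "\<epsilon> > 0"
  shows "integrable lborel (gauss \<epsilon> :: real ^ 'n::finite \<Rightarrow> real)"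
    and "(LINT x|lborel. gauss \<epsilon> (x :: real ^ 'n)) = (2 * pi / \<epsilon>) powr (real CARD('n) / 2)"
proof -
  have "integrable lborel (\<lambda>x::real ^ 'n. complex_of_real (gauss \<epsilon> x))"
    using gauss_char(1)[OF assms, of 0] by simp
  then show "integrable lborel (gauss \<epsilon> :: real ^ 'n::finite \<Rightarrow> real)"
    by (simp add: complex_of_real_integrable_eq)
  have "complex_of_real (LINT x|lborel. gauss \<epsilon> (x :: real ^ 'n)) = complex_of_real ((2 * pi / \<epsilon>) powr (real CARD('n) / 2))"
    using gauss_char(2)[OF assms, where ?'n = 'n, of 0] by (simp add: gauss_def)
  then show "(LINT x|lborel. gauss \<epsilon> (x :: real ^ 'n)) = (2 * pi / \<epsilon>) powr (real CARD('n) / 2)"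
    by (simp only: of_real_eq_iff)
qed

lemma heat_integral:
  assumes "\<epsilon> > 0"
  shows "integrable lborel (heat \<epsilon> :: real ^ 'n::finite \<Rightarrow> real)"
    and "(LINT x|lborel. heat \<epsilon> (x :: real ^ 'n)) = 1"
  using gauss_integral[of "1 / \<epsilon>", where ?'n = 'n] assms
  by (simp_all add: heat_def[abs_def] powr_minus)

lemma heat_integral_shift:
  assumes "\<epsilon> > 0"
  shows "integrable lborel (\<lambda>y::real ^ 'n::finite. heat \<epsilon> (x - y))"
    and "(LINT y|lborel. heat \<epsilon> (x - y)) = 1"
  using lborel_integrable_translate[OF heat_integral(1)[OF assms], of "- x"]
    lborel_integral_translate[of "heat \<epsilon>" "- x"] heat_integral(2)[OF assms, where ?'n = 'n]
  by (simp_all add: heat_commute[of _ x])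

text \<open>
  A Gaussian cutoff on the Fourier side makes the double integral absolutely convergent, and Fubini
  turns the cutoff into convolution with the heat kernel. Letting \<open>\<epsilon> \<rightarrow> 0\<close> gives both the inversion
  formula and the bound of the transform in \<open>L\<^sup>2\<close>.
\<close>

lemma inv_fourier_gauss_fourier:
  fixes b :: "real ^ 'n::finite \<Rightarrow> complex"
  assumes \<epsilon>: "\<epsilon> > 0" and b: "integrable lborel b"
  shows "inv_fourier (\<lambda>\<xi>. of_real (gauss \<epsilon> \<xi>) * fourier b \<xi>) x = (LINT y|lborel. of_real (heat \<epsilon> (x - y)) * b y)"
proof -
  let ?c = "fourier_const TYPE('n)"
  let ?g = "\<lambda>\<xi>. cis (\<xi> \<bullet> x) * complex_of_real (gauss \<epsilon> \<xi>)"
  have cc: "?c * ?c * (2 * pi / \<epsilon>) powr (real CARD('n) / 2) = (2 * pi * \<epsilon>) powr (- (real CARD('n) / 2))"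
  proof -
    let ?p = "real CARD('n) / 2"
    have "(2 * pi / \<epsilon>) powr ?p = (2 * pi) powr ?p / \<epsilon> powr ?p"
      using \<epsilon> by (simp add: powr_divide)
    moreover have "(2 * pi * \<epsilon>) powr (- ?p) = (2 * pi) powr (- ?p) / \<epsilon> powr ?p"
      using \<epsilon> by (subst powr_mult) (auto simp: powr_minus_divide[of \<epsilon>])
    moreover have "?c * (2 * pi) powr ?p = 1"
      by (simp add: fourier_const_def flip: powr_add)
    ultimately show ?thesis
      by (simp add: fourier_const_def mult.assoc)
  qed
  have "inv_fourier (\<lambda>\<xi>. of_real (gauss \<epsilon> \<xi>) * fourier b \<xi>) x =
      of_real (?c * ?c) * (LINT \<xi>|lborel. (LINT y|lborel. cis (- (y \<bullet> \<xi>)) * b y) * ?g \<xi>)"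
    by (simp add: inv_fourier_altdef fourier_altdef inner_commute mult_ac)
  also have "(LINT \<xi>|lborel. (LINT y|lborel. cis (- (y \<bullet> \<xi>)) * b y) * ?g \<xi>) =
      (LINT y|lborel. b y * (LINT \<xi>|lborel. cis (- (y \<bullet> \<xi>)) * ?g \<xi>))"
    by (intro integral_kernel_swap b gauss_char(1) \<epsilon>) auto
  also have "(\<lambda>y \<xi>. cis (- (y \<bullet> \<xi>)) * ?g \<xi>) = (\<lambda>y \<xi>. cis (\<xi> \<bullet> (x - y)) * complex_of_real (gauss \<epsilon> \<xi>))"
    by (simp add: fun_eq_iff cis_mult inner_diff_right inner_commute flip: mult.assoc)
  also have "(LINT y|lborel. b y * (LINT \<xi>|lborel. cis (\<xi> \<bullet> (x - y)) * complex_of_real (gauss \<epsilon> \<xi>))) =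
      (LINT y|lborel. b y * complex_of_real ((2 * pi / \<epsilon>) powr (real CARD('n) / 2) * gauss (1 / \<epsilon>) (x - y)))"
    by (simp only: gauss_char(2)[OF \<epsilon>])
  also have "of_real (?c * ?c) * \<dots> = (LINT y|lborel. of_real (?c * ?c) *
      (b y * complex_of_real ((2 * pi / \<epsilon>) powr (real CARD('n) / 2) * gauss (1 / \<epsilon>) (x - y))))"
    by (rule integral_mult_right_zero[symmetric])
  also have "\<dots> = (LINT y|lborel. of_real (heat \<epsilon> (x - y)) * b y)"
  proof (rule arg_cong[where f = "integral\<^sup>L lborel"], rule ext)
    fix y
    have "complex_of_real (heat \<epsilon> (x - y)) =
        of_real (?c * ?c) * complex_of_real ((2 * pi / \<epsilon>) powr (real CARD('n) / 2) * gauss (1 / \<epsilon>) (x - y))"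
      unfolding heat_def cc[symmetric] of_real_mult by (simp only: mult.assoc)
    then show "of_real (?c * ?c) *
      (b y * complex_of_real ((2 * pi / \<epsilon>) powr (real CARD('n) / 2) * gauss (1 / \<epsilon>) (x - y))) =
      complex_of_real (heat \<epsilon> (x - y)) * b y"
      by (simp only: mult.assoc mult.commute mult.left_commute)
  qed
  finally show ?thesis .
qed

text \<open>
  A bound, not the exact value, for the first absolute moment of \<open>heat 1\<close>; the first moment of
  \<open>heat \<epsilon>\<close> is at most \<open>\<surd>\<epsilon>\<close> times it.
\<close>

definition heat_moment :: "'n itself \<Rightarrow> real" where
  "heat_moment _ = 1 + 4 * 2 powr (real CARD('n) / 2)"

lemma heat_smoothing:
  fixes u :: "real ^ 'n::finite \<Rightarrow> complex"
  assumes \<epsilon>: "\<epsilon> > 0" and [measurable]: "u \<in> borel_measurable borel"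
    and bdd: "\<And>x. norm (u x) \<le> B"
    and lip: "\<And>x y. norm (u x - u y) \<le> L * norm (x - y)" and L: "L \<ge> 0"
  shows "norm ((LINT y|lborel. of_real (heat \<epsilon> (x - y)) * u y) - u x) \<le> L * sqrt \<epsilon> * heat_moment TYPE('n)"
proof -
  let ?h = "heat \<epsilon> :: real ^ 'n \<Rightarrow> real"
  let ?G = "\<lambda>y. L * (sqrt \<epsilon> * (?h (x - y) + 4 * 2 powr (real CARD('n) / 2) * heat (2 * \<epsilon>) (x - y)))"
  have ih: "integrable lborel (\<lambda>y. complex_of_real (?h (x - y)))"
    using heat_integral_shift(1)[OF \<epsilon>] by (simp add: complex_of_real_integrable_eq)
  have i1: "integrable lborel (\<lambda>y. of_real (?h (x - y)) * u y)"
  proof (rule Bochner_Integration.integrable_bound)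
    show "integrable lborel (\<lambda>y. B * ?h (x - y))"
      by (simp add: heat_integral_shift(1)[OF \<epsilon>])
    have "norm (of_real (?h (x - y)) * u y) \<le> B * ?h (x - y)" for y
      using mult_right_mono[OF bdd heat_nonneg, of y \<epsilon> "x - y"] by (simp add: norm_mult heat_nonneg mult.commute)
    then show "AE y in lborel. norm (of_real (?h (x - y)) * u y) \<le> norm (B * ?h (x - y))"
      by (auto intro!: AE_I2 order_trans[OF _ abs_ge_self])
  qed measurable
  have point: "norm (of_real (?h (x - y)) * (u y - u x)) \<le> ?G y" for y
  proof -
    let ?z = "x - y"
    \<comment> \<open>A quadratic factor is absorbed by doubling the variance, because \<open>t \<le> e\<^sup>t\<close>.\<close>
    have scal: "(norm ?z)\<^sup>2 / \<epsilon> * ?h ?z \<le> 4 * 2 powr (real CARD('n) / 2) * heat (2 * \<epsilon>) ?z"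
    proof -
      let ?u = "(norm ?z)\<^sup>2 / \<epsilon>"
      have "?u / 4 \<le> exp (?u / 4)"
        using exp_ge_add_one_self[of "?u / 4"] by linarith
      then have "?u * exp (- ?u / 2) \<le> 4 * exp (?u / 4) * exp (- ?u / 2)"
        by (intro mult_right_mono) auto
      also have "\<dots> = 4 * exp (- ?u / 4)"
        by (simp flip: exp_add)
      finally have "?u * gauss (1 / \<epsilon>) ?z \<le> 4 * gauss (1 / (2 * \<epsilon>)) ?z"
        by (simp add: gauss_def mult.commute)
      then have "(2 * pi * \<epsilon>) powr (- (real CARD('n) / 2)) * (?u * gauss (1 / \<epsilon>) ?z) \<le>
         (2 * pi * \<epsilon>) powr (- (real CARD('n) / 2)) * (4 * gauss (1 / (2 * \<epsilon>)) ?z)"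
        by (intro mult_left_mono) auto
      moreover have "(2 * pi * \<epsilon>) powr (- (real CARD('n) / 2)) =
          2 powr (real CARD('n) / 2) * (2 * pi * (2 * \<epsilon>)) powr (- (real CARD('n) / 2))"
      proof -
        have "(2 * pi * (2 * \<epsilon>)) powr (- (real CARD('n) / 2)) =
          2 powr (- (real CARD('n) / 2)) * (2 * pi * \<epsilon>) powr (- (real CARD('n) / 2))"
          using \<epsilon> by (subst powr_mult[symmetric]) (auto simp: mult_ac)
        then show ?thesis by (simp add: powr_minus)
      qed
      ultimately show ?thesis
        unfolding heat_def by (simp add: mult_ac)
    qed
    \<comment> \<open>Trades the first moment for the second, at the scale \<open>\<surd>\<epsilon>\<close> of the kernel.\<close>
    have "norm ?z \<le> sqrt \<epsilon> + (norm ?z)\<^sup>2 / sqrt \<epsilon>"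
    proof (cases "norm ?z \<le> sqrt \<epsilon>")
      case False
      then have "norm ?z * sqrt \<epsilon> \<le> norm ?z * norm ?z"
        by (intro mult_left_mono) auto
      then have "norm ?z \<le> (norm ?z)\<^sup>2 / sqrt \<epsilon>"
        using \<epsilon> by (simp add: pos_le_divide_eq power2_eq_square)
      then show ?thesis using \<epsilon> by (simp add: add_increasing)
    qed (use \<epsilon> in \<open>auto intro: add_increasing2\<close>)
    also have "(norm ?z)\<^sup>2 / sqrt \<epsilon> = sqrt \<epsilon> * ((norm ?z)\<^sup>2 / \<epsilon>)"
      using \<epsilon> by (simp add: field_simps flip: power2_eq_square)
    finally have "norm ?z * ?h ?z \<le> (sqrt \<epsilon> + sqrt \<epsilon> * ((norm ?z)\<^sup>2 / \<epsilon>)) * ?h ?z"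
      by (intro mult_right_mono heat_nonneg)
    also have "\<dots> = sqrt \<epsilon> * (?h ?z + (norm ?z)\<^sup>2 / \<epsilon> * ?h ?z)"
      by (simp add: algebra_simps)
    also have "\<dots> \<le> sqrt \<epsilon> * (?h ?z + 4 * 2 powr (real CARD('n) / 2) * heat (2 * \<epsilon>) ?z)"
      using scal \<epsilon> by (intro mult_left_mono add_mono) auto
    finally have "L * (norm ?z * ?h ?z) \<le> ?G y"
      using L by (intro mult_left_mono)
    moreover have "norm (of_real (?h (x - y)) * (u y - u x)) \<le> ?h ?z * (L * norm ?z)"
      using lip[of y x] by (auto simp: norm_mult heat_nonneg norm_minus_commute intro!: mult_left_mono)
    ultimately show ?thesis by (simp add: mult_ac)
  qed
  have "(LINT y|lborel. of_real (?h (x - y)) * u y) - u x =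
      (LINT y|lborel. of_real (?h (x - y)) * u y) - (LINT y|lborel. of_real (?h (x - y))) * u x"
    using heat_integral_shift(2)[OF \<epsilon>, of x] by simp
  also have "\<dots> = (LINT y|lborel. of_real (?h (x - y)) * u y) - (LINT y|lborel. of_real (?h (x - y)) * u x)"
    by simp
  also have "\<dots> = (LINT y|lborel. of_real (?h (x - y)) * u y - of_real (?h (x - y)) * u x)"
    using i1 ih by (intro Bochner_Integration.integral_diff[symmetric] integrable_mult_left)
  also have "\<dots> = (LINT y|lborel. of_real (?h (x - y)) * (u y - u x))"
    by (simp add: algebra_simps)
  also have "norm \<dots> \<le> (LINT y|lborel. ?G y)"
  proof (rule Bochner_Integration.integral_norm_bound_integral)
    show "integrable lborel (\<lambda>y. of_real (?h (x - y)) * (u y - u x))"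
      unfolding right_diff_distrib using i1 ih by (intro Bochner_Integration.integrable_diff integrable_mult_left)
    show "integrable lborel ?G"
      using heat_integral_shift(1)[where ?'n = 'n, of _ x] \<epsilon> by simp
  qed (rule point)
  also have "(LINT y|lborel. ?G y) = L * (sqrt \<epsilon> * (1 + 4 * 2 powr (real CARD('n) / 2)))"
    using heat_integral_shift[where ?'n = 'n, of _ x] \<epsilon> by simp
  finally show ?thesis by (simp add: heat_moment_def)
qed

text \<open>
  Let \<open>\<epsilon> \<rightarrow> 0\<close> in the regularised formula: the transform of a Schwartz function is integrable, which
  allows dominated convergence on one side, and Schwartz functions are bounded and Lipschitz, which
  gives convergence of the heat convolution on the other.
\<close>

theorem inv_fourier_fourier:
  fixes \<phi> :: "real ^ 'n::finite \<Rightarrow> complex"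
  assumes S: "\<phi> \<in> schwartz_space"
  shows "inv_fourier (fourier \<phi>) = \<phi>"
proof
  fix x
  let ?e = "\<lambda>k. 1 / real (Suc k)"
  note FS = fourier_schwartz[OF S]
  note [measurable] = schwartz_measurable[OF S] schwartz_measurable[OF FS]
  obtain B where B: "\<And>x. norm (\<phi> x) \<le> B"
    using schwartz_bounded[OF S] by blast
  obtain L where L: "\<And>x y. norm (\<phi> x - \<phi> y) \<le> L * norm (x - y)" "L \<ge> 0"
    using schwartz_lipschitz[OF S] by blast
  have e0: "?e \<longlonglongrightarrow> 0"
    using LIMSEQ_inverse_real_of_nat by (simp add: inverse_eq_divide)
  have "(\<lambda>k. (LINT \<xi>|lborel. cis (x \<bullet> \<xi>) * (of_real (gauss (?e k) \<xi>) * fourier \<phi> \<xi>))) \<longlonglongrightarrow>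
      (LINT \<xi>|lborel. cis (x \<bullet> \<xi>) * fourier \<phi> \<xi>)"
  proof (rule integral_dominated_convergence[where w = "\<lambda>\<xi>. norm (fourier \<phi> \<xi>)"])
    show "integrable lborel (\<lambda>\<xi>. norm (fourier \<phi> \<xi>))"
      by (intro integrable_norm schwartz_integrable FS)
    have "(\<lambda>k. cis (x \<bullet> \<xi>) * (of_real (gauss (?e k) \<xi>) * fourier \<phi> \<xi>)) \<longlonglongrightarrow>
       cis (x \<bullet> \<xi>) * (of_real (exp (- (0 * (norm \<xi>)\<^sup>2 / 2))) * fourier \<phi> \<xi>)" for \<xi>
      unfolding gauss_def by (intro tendsto_intros e0) simp
    then show "AE \<xi> in lborel. (\<lambda>k. cis (x \<bullet> \<xi>) * (of_real (gauss (?e k) \<xi>) * fourier \<phi> \<xi>)) \<longlonglongrightarrow>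
       cis (x \<bullet> \<xi>) * fourier \<phi> \<xi>"
      by simp
    have "norm (cis (x \<bullet> \<xi>) * (of_real (gauss (?e k) \<xi>) * fourier \<phi> \<xi>)) \<le> 1 * norm (fourier \<phi> \<xi>)" for k \<xi>
      unfolding norm_mult norm_cis mult_1_left norm_of_real by (intro mult_left_le_one_le) (auto simp: gauss_def)
    then show "AE \<xi> in lborel. norm (cis (x \<bullet> \<xi>) * (of_real (gauss (?e k) \<xi>) * fourier \<phi> \<xi>)) \<le> norm (fourier \<phi> \<xi>)" for k
      by simp
  qed measurable
  then have "(\<lambda>k. inv_fourier (\<lambda>\<xi>. of_real (gauss (?e k) \<xi>) * fourier \<phi> \<xi>) x) \<longlonglongrightarrow> inv_fourier (fourier \<phi>) x"
    unfolding inv_fourier_altdef by (intro tendsto_intros)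
  moreover have "(\<lambda>k. inv_fourier (\<lambda>\<xi>. of_real (gauss (?e k) \<xi>) * fourier \<phi> \<xi>) x) \<longlonglongrightarrow> \<phi> x"
  proof (rule LIM_zero_cancel, rule Lim_null_comparison)
    have "norm (inv_fourier (\<lambda>\<xi>. of_real (gauss (?e k) \<xi>) * fourier \<phi> \<xi>) x - \<phi> x) \<le> L * sqrt (?e k) * heat_moment TYPE('n)" for k
      by (subst inv_fourier_gauss_fourier[OF _ schwartz_integrable[OF S]], simp)
         (intro heat_smoothing[where B = B] B L, simp_all)
    then show "\<forall>\<^sub>F k in sequentially. norm (inv_fourier (\<lambda>\<xi>. of_real (gauss (?e k) \<xi>) * fourier \<phi> \<xi>) x - \<phi> x)
        \<le> L * sqrt (?e k) * heat_moment TYPE('n)"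
      by simp
    have "(\<lambda>k. L * sqrt (?e k) * heat_moment TYPE('n)) \<longlonglongrightarrow> L * sqrt 0 * heat_moment TYPE('n)"
      by (intro tendsto_intros e0)
    then show "(\<lambda>k. L * sqrt (?e k) * heat_moment TYPE('n)) \<longlonglongrightarrow> 0"
      by simp
  qed
  ultimately show "inv_fourier (fourier \<phi>) x = \<phi> x"
    by (rule LIMSEQ_unique)
qed

theorem fourier_inv_fourier:
  fixes \<phi> :: "real ^ 'n::finite \<Rightarrow> complex"
  assumes S: "\<phi> \<in> schwartz_space"
  shows "fourier (inv_fourier \<phi>) = \<phi>"
proof -
  have "fourier (inv_fourier \<phi>) = (\<lambda>x. cnj (inv_fourier (fourier (\<lambda>y. cnj (\<phi> y))) x))"
    unfolding inv_fourier_conv_fourier[of \<phi>] fourier_conv_inv_fourier[of "\<lambda>x. cnj (fourier (\<lambda>y. cnj (\<phi> y)) x)"]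
    by simp
  then show ?thesis
    by (simp add: inv_fourier_fourier schwartz_cnj S)
qed

section \<open>Functions are determined by their distributions\<close>

text \<open>
  The positive and the negative part of \<open>r\<close> are densities of two finite measures that agree on boxes,
  hence everywhere, because boxes are closed under intersection and generate the Borel sets.
\<close>

lemma AE_zero_if_box_integrals_zero:
  fixes r :: "'a::euclidean_space \<Rightarrow> real"
  assumes r: "integrable lborel r"
    and zero: "\<And>a b. (LINT x|lborel. r x * indicator (box a b) x) = 0"
  shows "AE x in lborel. r x = 0"
proof -
  note [measurable] = borel_measurable_integrable[OF r]
  let ?P = "density lborel (\<lambda>x. ennreal (max 0 (r x)))"
  let ?N = "density lborel (\<lambda>x. ennreal (max 0 (- r x)))"
  have int: "integrable lborel (\<lambda>x. max 0 (c * r x) * indicator (box a b) x)" if "\<bar>c\<bar> = 1" for a b c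
    by (rule Bochner_Integration.integrable_bound[OF r])
       (use that in \<open>auto simp: indicator_def max_def abs_if split: if_splits\<close>)
  have em: "emeasure (density lborel (\<lambda>x. ennreal (max 0 (c * r x)))) (box a b) =
      ennreal (LINT x|lborel. max 0 (c * r x) * indicator (box a b) x)" if "\<bar>c\<bar> = 1" for a b c
  proof -
    have "emeasure (density lborel (\<lambda>x. ennreal (max 0 (c * r x)))) (box a b) =
        (\<integral>\<^sup>+x. ennreal (max 0 (c * r x) * indicator (box a b) x) \<partial>lborel)"
      by (subst emeasure_density) (auto intro!: nn_integral_cong simp: indicator_def)
    then show ?thesis
      by (simp add: nn_integral_eq_integral[OF int[OF that]])
  qed
  have eq: "emeasure ?P (box a b) = emeasure ?N (box a b)" for a b
  proof -
    have "(LINT x|lborel. max 0 (1 * r x) * indicator (box a b) x) - (LINT x|lborel. max 0 ((-1) * r x) * indicator (box a b) x) =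
        (LINT x|lborel. max 0 (1 * r x) * indicator (box a b) x - max 0 ((-1) * r x) * indicator (box a b) x)"
      by (rule Bochner_Integration.integral_diff[symmetric]) (rule int, simp)+
    also have "\<dots> = (LINT x|lborel. r x * indicator (box a b) x)"
      by (intro Bochner_Integration.integral_cong) (auto simp: indicator_def max_def)
    finally show ?thesis
      using em[of 1 a b] em[of "-1" a b] zero[of a b] by simp
  qed
  have "?P = ?N"
  proof (rule measure_eqI_generator_eq)
    let ?E = "range (\<lambda>(a, b). box a b :: 'a set)"
    show "Int_stable ?E"
      by (auto simp: Int_stable_def box_Int_box)
    show "?E \<subseteq> Pow UNIV" "sets ?P = sigma_sets UNIV ?E" "sets ?N = sigma_sets UNIV ?E"
      by (simp_all add: borel_eq_box)
    let ?A = "\<lambda>n::nat. box (- (real n *\<^sub>R One)) (real n *\<^sub>R One) :: 'a set"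
    show "range ?A \<subseteq> ?E" "(\<Union>i. ?A i) = UNIV"
      unfolding UN_box_eq_UNIV by auto
    show "emeasure ?P (?A i) \<noteq> \<infinity>" for i
      using em[of 1] by simp
    show "emeasure ?P X = emeasure ?N X" if "X \<in> ?E" for X
      using that eq by auto
  qed
  then have "AE x in lborel. ennreal (max 0 (r x)) = ennreal (max 0 (- r x))"
    by (intro sigma_finite_measure.density_unique[OF sigma_finite_lborel]) auto
  then show ?thesis
    by eventually_elim (auto simp: max_def ennreal_eq_0_iff split: if_splits)
qed

lemma integrable_bounded_mult:
  fixes f g :: "'a \<Rightarrow> complex"
  assumes f: "integrable M f" and "g \<in> borel_measurable M" and g: "\<And>x. norm (g x) \<le> B"
  shows "integrable M (\<lambda>x. f x * g x)"
proof (rule Bochner_Integration.integrable_bound)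
  show "integrable M (\<lambda>x. norm (f x) * B)"
    using f by (intro integrable_mult_left integrable_norm)
  show "AE x in M. norm (f x * g x) \<le> norm (norm (f x) * B)"
    by (intro AE_I2) (auto simp: norm_mult intro!: order_trans[OF _ abs_ge_self] mult_left_mono g)
qed (use assms(2) borel_measurable_integrable[OF f] in simp)

text \<open>
  Fubini moves the heat kernel from \<open>g\<close> to \<open>u\<close>, so \<open>g\<close> is orthogonal to every smoothed copy of \<open>u\<close>, and
  the smoothing changes a Lipschitz function by \<open>O(\<surd>\<epsilon>)\<close> only.
\<close>

lemma integral_lipschitz_eq_zero_if_heat_zero:
  fixes g u :: "real ^ 'n::finite \<Rightarrow> complex"
  assumes g: "integrable lborel g" and u: "integrable lborel u"
    and heat0: "\<And>\<epsilon> x. \<epsilon> > 0 \<Longrightarrow> (LINT y|lborel. of_real (heat \<epsilon> (x - y)) * g y) = 0"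
    and bdd: "\<And>x. norm (u x) \<le> B"
    and lip: "\<And>x y. norm (u x - u y) \<le> L * norm (x - y)" and L: "L \<ge> 0"
  shows "(LINT x|lborel. g x * u x) = 0"
proof -
  note [measurable] = borel_measurable_integrable[OF g] borel_measurable_integrable[OF u]
  let ?M = "LINT x|lborel. norm (g x)"
  have bound: "norm (LINT x|lborel. g x * u x) \<le> ?M * (L * sqrt \<epsilon> * heat_moment TYPE('n))" if \<epsilon>: "\<epsilon> > 0" for \<epsilon>
  proof -
    let ?k = "(2 * pi * \<epsilon>) powr (- (real CARD('n) / 2))"
    let ?G = "\<lambda>x::real ^ 'n. complex_of_real (gauss (1 / \<epsilon>) x)"
    let ?H = "\<lambda>y. (LINT x|lborel. of_real (heat \<epsilon> (y - x)) * u x)"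
    have "(LINT x|lborel. (LINT y|lborel. ?G (x - y) * g y) * u x) = (LINT y|lborel. g y * (LINT x|lborel. ?G (x - y) * u x))"
      using \<epsilon> by (intro integral_kernel_swap g u) (auto simp: gauss_def)
    moreover have "(LINT y|lborel. ?G (x - y) * g y) = 0" for x
    proof -
      have "0 = (LINT y|lborel. of_real ?k * (?G (x - y) * g y))"
        using heat0[OF \<epsilon>, of x] by (simp add: heat_def mult.assoc)
      also have "\<dots> = of_real ?k * (LINT y|lborel. ?G (x - y) * g y)"
        by (rule integral_mult_right_zero)
      finally show ?thesis using \<epsilon> by simp
    qed
    ultimately have "0 = of_real ?k * (LINT y|lborel. g y * (LINT x|lborel. ?G (x - y) * u x))"
      by simp
    also have "\<dots> = (LINT y|lborel. g y * ?H y)"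
    proof -
      have H: "?H y = of_real ?k * (LINT x|lborel. ?G (x - y) * u x)" for y
        by (simp only: heat_commute[of \<epsilon> y]) (simp add: heat_def mult.assoc)
      show ?thesis unfolding H by (simp add: mult.left_commute[of "g _"])
    qed
    finally have zero: "(LINT y|lborel. g y * ?H y) = 0" by simp
    have close: "norm (?H y - u y) \<le> L * sqrt \<epsilon> * heat_moment TYPE('n)" for y
      by (rule heat_smoothing[OF \<epsilon> _ bdd lip L]) measurable
    have Hb: "norm (?H y) \<le> B + L * sqrt \<epsilon> * heat_moment TYPE('n)" for y
      using close[of y] bdd[of y] norm_triangle_sub[of "?H y" "u y"] by linarith
    have Hm: "?H \<in> borel_measurable borel"
      by (rule sigma_finite_measure.borel_measurable_lebesgue_integral[OF sigma_finite_lborel]) measurable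
    have iH: "integrable lborel (\<lambda>y. g y * ?H y)"
      by (rule integrable_bounded_mult[OF g _ Hb]) (use Hm in simp)
    have iu: "integrable lborel (\<lambda>y. g y * u y)"
      by (rule integrable_bounded_mult[OF g _ bdd]) measurable
    have "(LINT x|lborel. g x * u x) = (LINT x|lborel. g x * u x) - (LINT y|lborel. g y * ?H y)"
      using zero by simp
    also have "\<dots> = (LINT x|lborel. g x * u x - g x * ?H x)"
      using iu iH by (rule Bochner_Integration.integral_diff[symmetric])
    also have "norm \<dots> \<le> (LINT x|lborel. norm (g x) * (L * sqrt \<epsilon> * heat_moment TYPE('n)))"
    proof (rule Bochner_Integration.integral_norm_bound_integral)
      show "integrable lborel (\<lambda>x. g x * u x - g x * ?H x)"
        using iu iH by (rule Bochner_Integration.integrable_diff)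
      show "integrable lborel (\<lambda>x. norm (g x) * (L * sqrt \<epsilon> * heat_moment TYPE('n)))"
        using g by (intro integrable_mult_left integrable_norm)
      have "norm (g x * (u x - ?H x)) \<le> norm (g x) * (L * sqrt \<epsilon> * heat_moment TYPE('n))" for x
        using close[of x] unfolding norm_mult by (intro mult_left_mono) (auto simp: norm_minus_commute)
      then show "norm (g x * u x - g x * ?H x) \<le> norm (g x) * (L * sqrt \<epsilon> * heat_moment TYPE('n))" for x
        by (simp add: right_diff_distrib)
    qed
    also have "\<dots> = ?M * (L * sqrt \<epsilon> * heat_moment TYPE('n))"
      by (rule integral_mult_left_zero)
    finally show ?thesis .
  qed
  have "((\<lambda>\<epsilon>. ?M * (L * sqrt \<epsilon> * heat_moment TYPE('n))) \<longlongrightarrow> ?M * (L * sqrt 0 * heat_moment TYPE('n))) (at_right 0)"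
    by (intro tendsto_intros)
  then have "norm (LINT x|lborel. g x * u x) \<le> ?M * (L * sqrt 0 * heat_moment TYPE('n))"
    by (rule tendsto_lowerbound) (use bound in \<open>auto simp: eventually_at_right_less intro!: eventually_at_rightI[of 0 1]\<close>)
  then show ?thesis by simp
qed

text \<open>
  The fundamental lemma of the calculus of variations for Schwartz test functions. The function \<open>g = f\<close>
  times a Gaussian is integrable, and a translated heat kernel times that Gaussian is an admissible
  test function, so all heat convolutions of \<open>g\<close> vanish. Indicators of boxes are limits of Lipschitz
  functions, hence \<open>g\<close> has integral zero over every box.
\<close>

lemma tempered_function_eq_zero:
  fixes f :: "real ^ 'n::finite \<Rightarrow> complex"
  assumes f: "f \<in> tempered_functions"
    and zero: "\<And>\<phi>. \<phi> \<in> schwartz_space \<Longrightarrow> (LINT x|lborel. f x * \<phi> x) = 0"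
  shows "AE x in lborel. f x = 0"
proof -
  have [measurable]: "f \<in> borel_measurable borel"
    using f by (simp add: tempered_functions_def)
  define g where "g = (\<lambda>x. f x * of_real (gauss 1 x))"
  have g: "integrable lborel g"
    using f schwartz_gauss[of 1, where ?'n = 'n] by (simp add: g_def tempered_functions_def)
  note [measurable] = borel_measurable_integrable[OF g]
  have heat0: "(LINT y|lborel. of_real (heat \<epsilon> (x - y)) * g y) = 0" if \<epsilon>: "\<epsilon> > 0" for \<epsilon> x
  proof -
    define \<psi> where "\<psi> = (\<lambda>y. complex_of_real ((2 * pi * \<epsilon>) powr (- (real CARD('n) / 2))) * complex_of_real (gauss (1 / \<epsilon>) (y - x)))"
    have "\<psi> \<in> schwartz_space"
      unfolding \<psi>_def using \<epsilon> by (intro schwartz_cmult schwartz_translate schwartz_gauss) simp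
    then have "(\<lambda>y. of_real (gauss 1 y) * \<psi> y) \<in> schwartz_space"
      by (intro schwartz_gauss_mult) simp_all
    from zero[OF this] have "(LINT y|lborel. f y * (of_real (gauss 1 y) * \<psi> y)) = 0" .
    moreover have "f y * (of_real (gauss 1 y) * \<psi> y) = of_real (heat \<epsilon> (x - y)) * g y" for y
      unfolding heat_commute[of \<epsilon> x y] by (simp add: \<psi>_def g_def heat_def)
    ultimately show ?thesis by simp
  qed
  have box0: "(LINT x|lborel. g x * of_real (indicator (box a b) x)) = 0" for a b :: "real ^ 'n"
  proof -
    let ?U = "box a b"
    have ne: "- ?U \<noteq> {}"
      using bounded_box[of a b] not_bounded_UNIV by (metis Compl_UNIV_eq double_compl)
    have cl: "closed (- ?U)" by (simp add: open_box closed_Compl)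
    \<comment> \<open>Lipschitz functions that increase to the indicator of the open box.\<close>
    define u where "u = (\<lambda>k x. min 1 (real k * infdist x (- ?U)))"
    have u01: "0 \<le> u k x" "u k x \<le> 1" for k x
      by (auto simp: u_def infdist_nonneg)
    have um [measurable]: "u k \<in> borel_measurable borel" for k
      unfolding u_def by (intro borel_measurable_continuous_onI continuous_intros)
    have out: "u k x = 0" if "x \<notin> ?U" for k x
      using that by (simp add: u_def)
    have u_le: "u k x \<le> indicator ?U x" for k x
      using u01(2)[of k x] out[of x k] by (auto simp: indicator_def)
    have iu: "integrable lborel (u k)" for k
    proof (rule Bochner_Integration.integrable_bound)
      show "integrable lborel (indicator ?U :: _ \<Rightarrow> real)"
        by (rule integrable_real_indicator[OF _ emeasure_lborel_box_finite]) simp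
      show "AE x in lborel. norm (u k x) \<le> norm (indicator ?U x :: real)"
        using u_le u01 by (auto intro!: AE_I2)
    qed measurable
    have zero_k: "(LINT x|lborel. g x * of_real (u k x)) = 0" for k
    proof (rule integral_lipschitz_eq_zero_if_heat_zero[OF g _ heat0])
      show "integrable lborel (\<lambda>x. complex_of_real (u k x))"
        using iu by (simp add: complex_of_real_integrable_eq)
      show "norm (complex_of_real (u k x)) \<le> 1" for x
        using u01 by simp
      show "norm (complex_of_real (u k x) - complex_of_real (u k y)) \<le> real k * norm (x - y)" for x y
      proof -
        have "\<bar>u k x - u k y\<bar> \<le> \<bar>real k * infdist x (- ?U) - real k * infdist y (- ?U)\<bar>"
          by (auto simp: u_def min_def)
        also have "\<dots> = real k * \<bar>infdist x (- ?U) - infdist y (- ?U)\<bar>"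
          by (simp add: abs_mult flip: right_diff_distrib)
        also have "\<dots> \<le> real k * dist x y"
          by (intro mult_left_mono infdist_triangle_abs) simp
        finally show ?thesis
          by (simp add: dist_norm flip: of_real_diff)
      qed
    qed simp_all
    have "(\<lambda>k. (LINT x|lborel. g x * of_real (u k x))) \<longlonglongrightarrow> (LINT x|lborel. g x * of_real (indicator ?U x))"
    proof (rule integral_dominated_convergence[where w = "\<lambda>x. norm (g x)"])
      show "integrable lborel (\<lambda>x. norm (g x))" using g by (rule integrable_norm)
      have lim: "(\<lambda>k. u k x) \<longlonglongrightarrow> indicator ?U x" for x
      proof (cases "x \<in> ?U")
        case True
        then have pos: "infdist x (- ?U) > 0"
          using infdist_pos_not_in_closed[OF cl ne] by simp
        obtain K :: nat where K: "real K * infdist x (- ?U) > 1"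
          using reals_Archimedean3[OF pos] by blast
        have "u k x = 1" if "k \<ge> K" for k
        proof -
          have "real K * infdist x (- ?U) \<le> real k * infdist x (- ?U)"
            using that pos by (intro mult_right_mono) auto
          then show ?thesis using K by (simp add: u_def)
        qed
        then have "\<forall>\<^sub>F k in sequentially. u k x = 1"
          unfolding eventually_sequentially by blast
        then show ?thesis using True by (simp add: tendsto_eventually)
      qed (simp add: out)
      show "AE x in lborel. (\<lambda>k. g x * of_real (u k x)) \<longlonglongrightarrow> g x * of_real (indicator ?U x)"
        by (intro AE_I2 tendsto_intros lim)
      show "AE x in lborel. norm (g x * of_real (u k x)) \<le> norm (g x)" for k
        using u01 by (auto intro!: AE_I2 simp: norm_mult mult_left_le)
    qed measurable
    then show ?thesis
      unfolding zero_k by (simp add: LIMSEQ_const_iff)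
  qed
  have "AE x in lborel. Re (g x) = 0"
  proof (rule AE_zero_if_box_integrals_zero)
    show "integrable lborel (\<lambda>x. Re (g x))" using g by (rule integrable_Re)
    fix a b :: "real ^ 'n"
    have "(LINT x|lborel. Re (g x) * indicator (box a b) x) = (LINT x|lborel. Re (g x * of_real (indicator (box a b) x)))"
      by (intro Bochner_Integration.integral_cong) (auto simp: indicator_def)
    also have "\<dots> = 0"
    proof (subst integral_Re)
      show "integrable lborel (\<lambda>x. g x * complex_of_real (indicator (box a b) x))"
        by (rule integrable_bounded_mult[OF g, of _ 1]) (auto simp: indicator_def)
    qed (simp add: box0)
    finally show "(LINT x|lborel. Re (g x) * indicator (box a b) x) = 0" .
  qed
  moreover have "AE x in lborel. Im (g x) = 0"
  proof (rule AE_zero_if_box_integrals_zero)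
    show "integrable lborel (\<lambda>x. Im (g x))" using g by (rule integrable_Im)
    fix a b :: "real ^ 'n"
    have "(LINT x|lborel. Im (g x) * indicator (box a b) x) = (LINT x|lborel. Im (g x * of_real (indicator (box a b) x)))"
      by (intro Bochner_Integration.integral_cong) (auto simp: indicator_def)
    also have "\<dots> = 0"
    proof (subst integral_Im)
      show "integrable lborel (\<lambda>x. g x * complex_of_real (indicator (box a b) x))"
        by (rule integrable_bounded_mult[OF g, of _ 1]) (auto simp: indicator_def)
    qed (simp add: box0)
    finally show "(LINT x|lborel. Im (g x) * indicator (box a b) x) = 0" .
  qed
  ultimately show ?thesis
  proof eventually_elim
    case (elim x)
    then have "g x = 0" by (simp add: complex_eq_iff)
    then show ?case by (simp add: g_def gauss_def)
  qed
qed

lemma tempered_functions_diff: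
  assumes "f \<in> tempered_functions" "g \<in> tempered_functions"
  shows "(\<lambda>x. f x - g x) \<in> tempered_functions"
  using assms by (auto simp: tempered_functions_def left_diff_distrib)

lemma dist_of_eq_imp_AE_eq:
  fixes f g :: "real ^ 'n::finite \<Rightarrow> complex"
  assumes f: "f \<in> tempered_functions" and g: "g \<in> tempered_functions"
    and eq: "dist_of f = dist_of g"
  shows "AE x in lborel. f x = g x"
proof -
  have "AE x in lborel. f x - g x = 0"
  proof (rule tempered_function_eq_zero[OF tempered_functions_diff[OF f g]])
    fix \<phi> :: "real ^ 'n \<Rightarrow> complex" assume S: "\<phi> \<in> schwartz_space"
    have "(LINT x|lborel. f x * \<phi> x) = (LINT x|lborel. g x * \<phi> x)"
      using fun_cong[OF eq, of \<phi>] S by (simp add: dist_of_def)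
    then show "(LINT x|lborel. (f x - g x) * \<phi> x) = 0"
      using f g S by (simp add: left_diff_distrib tempered_functions_def)
  qed
  then show ?thesis by eventually_elim simp
qed

section \<open>Boundedness of the Fourier transform in the square norm\<close>

lemma ennreal_norm_integral_le:
  fixes f :: "'a \<Rightarrow> 'b::{banach, second_countable_topology}"
  shows "ennreal (norm (integral\<^sup>L M f)) \<le> (\<integral>\<^sup>+x. ennreal (norm (f x)) \<partial>M)"
  by (cases "integrable M f") (auto simp: integral_norm_bound_ennreal not_integrable_integral_eq)

text \<open>
  Half of the Plancherel theorem. Weighting \<open>|F\<^sup>-\<^sup>1 a|\<^sup>2\<close> with a Gaussian turns its integral into
  \<open>\<integral>\<integral> a(\<xi>) cnj(a(\<eta>)) heat \<epsilon> (\<xi> - \<eta>) d\<eta> d\<xi>\<close>. As the heat kernel has mass one in each variable,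
  \<open>|a(\<xi>) a(\<eta>)| \<le> |a(\<xi>)|\<^sup>2/2 + |a(\<eta>)|\<^sup>2/2\<close> bounds this by \<open>\<integral> |a|\<^sup>2\<close>, uniformly in \<open>\<epsilon>\<close>.
\<close>

theorem inv_fourier_L2_le:
  fixes a :: "real ^ 'n::finite \<Rightarrow> complex"
  assumes a: "integrable lborel a"
  shows "(\<integral>\<^sup>+x. ennreal ((norm (inv_fourier a x))\<^sup>2) \<partial>lborel) \<le> (\<integral>\<^sup>+x. ennreal ((norm (a x))\<^sup>2) \<partial>lborel)"
proof -
  note ma [measurable] = borel_measurable_integrable[OF a]
  have ma' [measurable]: "a \<in> borel_measurable borel" using ma by simp
  note mF [measurable] = borel_measurable_inv_fourier[OF ma']
  let ?F = "inv_fourier a"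
  let ?g = "\<lambda>\<epsilon> x. (norm (?F x))\<^sup>2 * gauss \<epsilon> x"
  let ?Q = "\<integral>\<^sup>+x. ennreal ((norm (a x))\<^sup>2) \<partial>lborel"
  define B where "B = fourier_const TYPE('n) * (LINT x|lborel. norm (a x))"
  have B: "norm (?F x) \<le> B" for x
    unfolding B_def by (rule norm_inv_fourier_le[OF a])
  have reg: "(\<integral>\<^sup>+x. ennreal (?g \<epsilon> x) \<partial>lborel) \<le> ?Q" if \<epsilon>: "\<epsilon> > 0" for \<epsilon>
  proof -
    let ?T = "\<lambda>\<xi> \<eta> \<zeta>. ennreal (heat \<epsilon> (\<xi> - \<eta>) * ((norm (a \<zeta>))\<^sup>2 / 2))"
    let ?b = "\<lambda>x. of_real (gauss \<epsilon> x) * cnj (?F x)"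
    have ib: "integrable lborel ?b"
    proof (rule integrable_bounded_mult)
      show "integrable lborel (\<lambda>x::real ^ 'n. complex_of_real (gauss \<epsilon> x))"
        using \<epsilon> by (simp add: complex_of_real_integrable_eq gauss_integral(1))
      show "norm (cnj (?F x)) \<le> B" for x using B by simp
    qed measurable
    let ?K = "\<lambda>\<xi>. (LINT \<eta>|lborel. of_real (heat \<epsilon> (\<xi> - \<eta>)) * cnj (a \<eta>))"
    \<comment> \<open>The conjugate of \<open>F\<^sup>-\<^sup>1 a\<close> is the Fourier transform of the conjugate of \<open>a\<close>.\<close>
    have inv_b: "inv_fourier ?b \<xi> = ?K \<xi>" for \<xi>
    proof -
      have "(\<lambda>x. cnj (?F x)) = fourier (\<lambda>y. cnj (a y))"
        by (simp add: inv_fourier_conv_fourier)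
      then show ?thesis
        using inv_fourier_gauss_fourier[OF \<epsilon>, of "\<lambda>y. cnj (a y)" \<xi>] a by (simp add: fun_eq_iff)
    qed
    have int: "integrable lborel (\<lambda>x. ?g \<epsilon> x)"
    proof (rule Bochner_Integration.integrable_bound)
      show "integrable lborel (\<lambda>x::real ^ 'n. B\<^sup>2 * gauss \<epsilon> x)"
        by (intro integrable_mult_right gauss_integral \<epsilon>)
      have "(norm (?F x))\<^sup>2 \<le> B\<^sup>2" for x
        by (intro power_mono B) simp
      then show "AE x in lborel. norm (?g \<epsilon> x) \<le> norm (B\<^sup>2 * gauss \<epsilon> x)"
        by (auto intro!: AE_I2 mult_right_mono simp: abs_mult)
    qed measurable
    have "complex_of_real (LINT x|lborel. ?g \<epsilon> x) = (LINT x|lborel. ?F x * ?b x)"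
      unfolding integral_complex_of_real[symmetric]
      by (intro Bochner_Integration.integral_cong) (auto simp: complex_norm_square mult_ac simp del: of_real_power)
    also have "\<dots> = (LINT \<xi>|lborel. a \<xi> * inv_fourier ?b \<xi>)"
      by (rule inv_fourier_swap[OF a ib])
    also have "\<dots> = (LINT \<xi>|lborel. a \<xi> * ?K \<xi>)"
      by (simp only: inv_b)
    finally have eq: "complex_of_real (LINT x|lborel. ?g \<epsilon> x) = (LINT \<xi>|lborel. a \<xi> * ?K \<xi>)" .
    have nn: "0 \<le> (LINT x|lborel. ?g \<epsilon> x)"
      by (intro Bochner_Integration.integral_nonneg) (auto simp: gauss_def)
    have "(\<integral>\<^sup>+x. ennreal (?g \<epsilon> x) \<partial>lborel) = ennreal (LINT x|lborel. ?g \<epsilon> x)"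
      by (rule nn_integral_eq_integral[OF int]) (auto simp: gauss_def)
    also have "\<dots> = ennreal (norm (LINT \<xi>|lborel. a \<xi> * ?K \<xi>))"
      unfolding eq[symmetric] norm_of_real using nn by simp
    also have "\<dots> \<le> (\<integral>\<^sup>+\<xi>. ennreal (norm (a \<xi> * ?K \<xi>)) \<partial>lborel)"
      by (rule ennreal_norm_integral_le)
    also have "\<dots> \<le> (\<integral>\<^sup>+\<xi>. (\<integral>\<^sup>+\<eta>. ?T \<xi> \<eta> \<xi> + ?T \<xi> \<eta> \<eta> \<partial>lborel) \<partial>lborel)"
    proof (rule nn_integral_mono)
      fix \<xi> :: "real ^ 'n"
      have "ennreal (norm (a \<xi> * ?K \<xi>)) = ennreal (norm (LINT \<eta>|lborel. a \<xi> * (of_real (heat \<epsilon> (\<xi> - \<eta>)) * cnj (a \<eta>))))"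
        by simp
      also have "\<dots> \<le> (\<integral>\<^sup>+\<eta>. ennreal (norm (a \<xi> * (of_real (heat \<epsilon> (\<xi> - \<eta>)) * cnj (a \<eta>)))) \<partial>lborel)"
        by (rule ennreal_norm_integral_le)
      also have "\<dots> \<le> (\<integral>\<^sup>+\<eta>. ?T \<xi> \<eta> \<xi> + ?T \<xi> \<eta> \<eta> \<partial>lborel)"
      proof (rule nn_integral_mono)
        fix \<eta> :: "real ^ 'n"
        have "norm (a \<xi>) * norm (a \<eta>) \<le> (norm (a \<xi>))\<^sup>2 / 2 + (norm (a \<eta>))\<^sup>2 / 2"
          using sum_squares_bound[of "norm (a \<xi>)" "norm (a \<eta>)"] by simp
        from mult_left_mono[OF this heat_nonneg[of \<epsilon> "\<xi> - \<eta>"]]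
        have "norm (a \<xi> * (of_real (heat \<epsilon> (\<xi> - \<eta>)) * cnj (a \<eta>))) \<le>
            heat \<epsilon> (\<xi> - \<eta>) * ((norm (a \<xi>))\<^sup>2 / 2) + heat \<epsilon> (\<xi> - \<eta>) * ((norm (a \<eta>))\<^sup>2 / 2)"
          by (simp add: norm_mult heat_nonneg algebra_simps)
        then show "ennreal (norm (a \<xi> * (of_real (heat \<epsilon> (\<xi> - \<eta>)) * cnj (a \<eta>)))) \<le>
            ?T \<xi> \<eta> \<xi> + ?T \<xi> \<eta> \<eta>"
          by (subst ennreal_plus[symmetric]) (simp_all add: heat_nonneg ennreal_leI del: ennreal_plus)
      qed
      finally show "ennreal (norm (a \<xi> * ?K \<xi>)) \<le> (\<integral>\<^sup>+\<eta>. ?T \<xi> \<eta> \<xi> + ?T \<xi> \<eta> \<eta> \<partial>lborel)" .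
    qed
    also have "\<dots> = (\<integral>\<^sup>+\<xi>. (\<integral>\<^sup>+\<eta>. ?T \<xi> \<eta> \<xi> \<partial>lborel) \<partial>lborel) +
        (\<integral>\<^sup>+\<xi>. (\<integral>\<^sup>+\<eta>. ?T \<xi> \<eta> \<eta> \<partial>lborel) \<partial>lborel)"
      by (subst nn_integral_add, measurable)+
    also have "(\<integral>\<^sup>+\<xi>. (\<integral>\<^sup>+\<eta>. ?T \<xi> \<eta> \<eta> \<partial>lborel) \<partial>lborel) =
       (\<integral>\<^sup>+\<eta>. (\<integral>\<^sup>+\<xi>. ?T \<eta> \<xi> \<eta> \<partial>lborel) \<partial>lborel)"
      by (subst lborel_pair.Fubini') (measurable, simp only: heat_commute)
    also have "(\<integral>\<^sup>+\<xi>. (\<integral>\<^sup>+\<eta>. ?T \<xi> \<eta> \<xi> \<partial>lborel) \<partial>lborel) +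
       (\<integral>\<^sup>+\<eta>. (\<integral>\<^sup>+\<xi>. ?T \<eta> \<xi> \<eta> \<partial>lborel) \<partial>lborel) = ?Q"
    proof -
      have h1: "(\<integral>\<^sup>+\<eta>. ennreal (heat \<epsilon> (\<xi> - \<eta>)) \<partial>lborel) = 1" for \<xi> :: "real ^ 'n"
        using nn_integral_eq_integral[OF heat_integral_shift(1)[OF \<epsilon>], of \<xi>] heat_integral_shift(2)[OF \<epsilon>, of \<xi>]
        by (simp add: heat_nonneg)
      have "(\<integral>\<^sup>+\<xi>. (\<integral>\<^sup>+\<eta>. ?T \<xi> \<eta> \<xi> \<partial>lborel) \<partial>lborel) =
          (\<integral>\<^sup>+\<xi>. ennreal ((norm (a \<xi>))\<^sup>2 / 2) \<partial>lborel)"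
        unfolding ennreal_mult[OF heat_nonneg divide_nonneg_nonneg[OF zero_le_power2 zero_le_numeral]]
        by (simp add: nn_integral_multc h1)
      also have "\<dots> + \<dots> = (\<integral>\<^sup>+\<xi>. ennreal ((norm (a \<xi>))\<^sup>2 / 2) + ennreal ((norm (a \<xi>))\<^sup>2 / 2) \<partial>lborel)"
        by (rule nn_integral_add[symmetric]) measurable
      also have "\<dots> = ?Q"
        by (intro nn_integral_cong) (subst ennreal_plus[symmetric], auto)
      finally show ?thesis by simp
    qed
    finally show ?thesis .
  qed
  let ?e = "\<lambda>k. 1 / real (Suc k)"
  have e0: "?e \<longlonglongrightarrow> 0"
    using LIMSEQ_inverse_real_of_nat by (simp add: inverse_eq_divide)
  have "(\<integral>\<^sup>+x. ennreal ((norm (?F x))\<^sup>2) \<partial>lborel) =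
      (\<integral>\<^sup>+x. liminf (\<lambda>k. ennreal (?g (?e k) x)) \<partial>lborel)"
  proof (rule nn_integral_cong)
    fix x
    have "(\<lambda>k. ?g (?e k) x) \<longlonglongrightarrow> (norm (?F x))\<^sup>2 * exp (- (0 * (norm x)\<^sup>2 / 2))"
      unfolding gauss_def by (intro tendsto_intros e0) simp
    then have "(\<lambda>k. ennreal (?g (?e k) x)) \<longlonglongrightarrow> ennreal ((norm (?F x))\<^sup>2)"
      by (intro tendsto_ennrealI) simp
    then show "ennreal ((norm (?F x))\<^sup>2) = liminf (\<lambda>k. ennreal (?g (?e k) x))"
      by (simp add: lim_imp_Liminf)
  qed
  also have "\<dots> \<le> liminf (\<lambda>k. (\<integral>\<^sup>+x. ennreal (?g (?e k) x) \<partial>lborel))"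
    by (rule nn_integral_liminf) measurable
  also have "\<dots> \<le> ?Q"
    by (rule Liminf_le) (simp_all add: reg)
  finally show ?thesis .
qed

section \<open>Summation in Lebesgue spaces\<close>

text \<open>
  The constant in the summation lemma for terms of size \<open>q\<^sup>j\<close>: the first factor comes from the weights,
  the second from the geometric series that they leave.
\<close>

definition series_const :: "real \<Rightarrow> real \<Rightarrow> real" where
  "series_const p q = (1 - q powr (1 / (2 * p))) powr (- p) / (1 - sqrt q)"

lemma series_const_nonneg: "0 < q \<Longrightarrow> q < 1 \<Longrightarrow> series_const p q \<ge> 0"
  unfolding series_const_def by (intro divide_nonneg_nonneg) auto

text \<open>
  Geometrically decaying terms can be summed in \<open>L\<^sup>p\<close>. For weights \<open>l\<^sub>j\<close> with sum 1 put \<open>S = \<Sum>\<^sub>j (|w\<^sub>j| / l\<^sub>j)\<^sup>p\<close>. Then \<open>|w\<^sub>j| \<le> l\<^sub>j S\<^sup>1\<^sup>/\<^sup>p\<close>, so the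
  series converges absolutely wherever \<open>S\<close> is finite, and its partial sums are bounded by \<open>S\<^sup>1\<^sup>/\<^sup>p\<close>. The
  function \<open>G\<close> in the conclusion is \<open>S\<close>; it dominates the partial sums in later limits.
\<close>

lemma Lp_series:
  fixes w :: "nat \<Rightarrow> 'a::euclidean_space \<Rightarrow> complex"
  assumes p: "p \<ge> 1" and q: "0 < q" "q < 1" and D: "D \<ge> 0"
    and w: "\<And>j. w j \<in> borel_measurable borel"
    and bound: "\<And>j. (\<integral>\<^sup>+x. ennreal (norm (w j x) powr p) \<partial>lborel) \<le> ennreal (D * q ^ j)"
  obtains W and G :: "'a \<Rightarrow> real"
  where "W \<in> borel_measurable borel"
    and "(\<integral>\<^sup>+x. ennreal (norm (W x) powr p) \<partial>lborel) \<le>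
           ennreal (D * series_const p q)"
    and "integrable lborel G"
    and "AE x in lborel. \<forall>J. norm (\<Sum>j<J. w j x) powr p \<le> G x"
    and "AE x in lborel. (\<lambda>J. \<Sum>j<J. w j x) \<longlonglongrightarrow> W x"
proof -
  note w [measurable]
  \<comment> \<open>The weights decay so slowly that dividing by \<open>l\<^sub>j\<^sup>p\<close> uses up only half of the decay \<open>q\<^sup>j\<close>.\<close>
  define r where "r = q powr (1 / (2 * p))"
  have r: "0 < r" "r < 1"
    using q p powr_less_mono2[of "1 / (2 * p)" q 1] by (auto simp: r_def)
  have rp: "r powr p = sqrt q"
    using p q by (simp add: r_def powr_powr powr_half_sqrt)
  have sq: "0 < sqrt q" "sqrt q < 1" using q by auto
  define l where "l j = (1 - r) * r ^ j" for j
  have l_pos: "l j > 0" for j using r by (simp add: l_def)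
  have l_sums: "l sums 1"
    using sums_mult[OF geometric_sums[of r], of "1 - r"] r by (simp add: l_def[abs_def])
  define c where "c j x = (norm (w j x) / l j) powr p" for j x
  have [measurable]: "c j \<in> borel_measurable borel" for j
    unfolding c_def by measurable
  define S where "S x = (\<Sum>j. ennreal (c j x))" for x
  have [measurable]: "S \<in> borel_measurable borel"
    unfolding S_def by measurable
  define A where "A = (1 - r) powr (- p)"
  have A: "A \<ge> 0" by (simp add: A_def)
  have int_c: "(\<integral>\<^sup>+x. ennreal (c j x) \<partial>lborel) \<le> ennreal (D * A * sqrt q ^ j)" for j
  proof -
    have "c j x = l j powr (- p) * norm (w j x) powr p" for x
      using l_pos[of j] by (simp add: c_def powr_divide powr_minus_divide)
    then have "(\<integral>\<^sup>+x. ennreal (c j x) \<partial>lborel) = ennreal (l j powr (- p)) * (\<integral>\<^sup>+x. ennreal (norm (w j x) powr p) \<partial>lborel)"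
      by (simp add: ennreal_mult nn_integral_cmult)
    also have "\<dots> \<le> ennreal (l j powr (- p)) * ennreal (D * q ^ j)"
      by (intro mult_left_mono bound) simp
    also have "\<dots> = ennreal (l j powr (- p) * (D * q ^ j))"
      using D q by (simp add: ennreal_mult)
    also have "l j powr (- p) = A * inverse (sqrt q ^ j)"
    proof -
      have "(r ^ j) powr (- p) = inverse ((r powr p) ^ j)"
        using r by (simp add: powr_minus powr_powr mult.commute flip: powr_realpow)
      then show ?thesis
        using r by (simp add: l_def A_def powr_mult rp)
    qed
    also have "A * inverse (sqrt q ^ j) * (D * q ^ j) = D * A * sqrt q ^ j"
    proof -
      have "q ^ j = sqrt q ^ j * sqrt q ^ j"
        using q by (simp flip: power_mult_distrib)
      then show ?thesis using sq by simp
    qed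
    finally show ?thesis .
  qed
  define K where "K = A / (1 - sqrt q)"
  have int_S: "(\<integral>\<^sup>+x. S x \<partial>lborel) \<le> ennreal (D * K)"
  proof -
    have "(\<integral>\<^sup>+x. S x \<partial>lborel) = (\<Sum>j. (\<integral>\<^sup>+x. ennreal (c j x) \<partial>lborel))"
      unfolding S_def by (rule nn_integral_suminf) measurable
    also have "\<dots> \<le> (\<Sum>j. ennreal (D * A * sqrt q ^ j))"
      by (intro suminf_le int_c) auto
    also have "\<dots> = ennreal (D * A * (1 / (1 - sqrt q)))"
      using sq D A by (intro suminf_ennreal_eq sums_mult geometric_sums) auto
    finally show ?thesis by (simp add: K_def)
  qed
  have S_fin: "AE x in lborel. S x \<noteq> \<infinity>"
    using int_S by (intro nn_integral_PInf_AE) (auto simp: top_unique)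
  define G where "G x = enn2real (S x)" for x
  have [measurable]: "G \<in> borel_measurable borel"
    unfolding G_def by measurable
  have GS: "ennreal (G x) = S x" if "S x \<noteq> \<infinity>" for x
    using that by (simp add: G_def less_top)
  have G0: "G x \<ge> 0" for x by (simp add: G_def)
  have iG: "integrable lborel G"
  proof (rule integrableI_nonneg)
    have "(\<integral>\<^sup>+x. ennreal (G x) \<partial>lborel) = (\<integral>\<^sup>+x. S x \<partial>lborel)"
      by (rule nn_integral_cong_AE) (use S_fin in \<open>eventually_elim, simp add: GS\<close>)
    then show "(\<integral>\<^sup>+x. ennreal (G x) \<partial>lborel) < \<infinity>"
      using int_S by (simp add: le_less_trans)
  qed (use G0 in auto)
  define g where "g x = G x powr (1 / p)" for x
  have gp: "t powr p \<le> G x" if "0 \<le> t" "t \<le> g x" for t x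
    using powr_mono2[of p t "g x"] that p G0[of x] by (simp add: g_def powr_powr)
  have wg: "norm (w j x) \<le> l j * g x" if "S x \<noteq> \<infinity>" for j x
  proof -
    have "ennreal (c j x) \<le> S x"
      unfolding S_def using sum_le_suminf[of "\<lambda>j. ennreal (c j x)" "{j}"] by simp
    then have "c j x \<le> G x"
      using GS[OF that] G0[of x] by (metis ennreal_le_iff)
    then have "c j x powr (1 / p) \<le> g x"
      unfolding g_def using p by (intro powr_mono2) (auto simp: c_def)
    then have "norm (w j x) / l j \<le> g x"
      using p l_pos[of j] by (simp add: c_def powr_powr)
    then show ?thesis using l_pos[of j] by (simp add: divide_le_eq mult.commute)
  qed
  have partial: "norm (\<Sum>j<J. w j x) \<le> g x" if "S x \<noteq> \<infinity>" for J x
  proof -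
    have "norm (\<Sum>j<J. w j x) \<le> (\<Sum>j<J. l j * g x)"
      by (intro sum_norm_le wg that)
    also have "\<dots> = (\<Sum>j<J. l j) * g x" by (simp add: sum_distrib_right)
    also have "\<dots> \<le> 1 * g x"
      using sum_le_suminf[of l "{..<J}"] l_sums l_pos
      by (intro mult_right_mono) (auto simp: g_def sums_iff less_imp_le)
    finally show ?thesis by simp
  qed
  define W where "W x = (\<Sum>j. w j x)" for x
  have W [measurable]: "W \<in> borel_measurable borel"
    unfolding W_def by measurable
  have lim: "(\<lambda>J. \<Sum>j<J. w j x) \<longlonglongrightarrow> W x" if "S x \<noteq> \<infinity>" for x
  proof -
    have "summable (\<lambda>j. l j * g x)"
      using l_sums by (intro summable_mult2) (simp add: sums_iff)
    then have "summable (\<lambda>j. w j x)"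
      by (rule summable_comparison_test') (use wg[OF that] in simp)
    then show ?thesis unfolding W_def by (rule summable_LIMSEQ)
  qed
  have Wg: "norm (W x) \<le> g x" if "S x \<noteq> \<infinity>" for x
    by (rule LIMSEQ_le_const2[OF tendsto_norm[OF lim[OF that]]]) (use partial[OF that] in blast)
  have int_W: "(\<integral>\<^sup>+x. ennreal (norm (W x) powr p) \<partial>lborel) \<le> ennreal (D * K)"
  proof -
    have "AE x in lborel. ennreal (norm (W x) powr p) \<le> S x"
      using S_fin
    proof eventually_elim
      case (elim x)
      then show ?case
        using ennreal_leI[OF gp[OF norm_ge_zero Wg[OF elim]]] GS[OF elim] by simp
    qed
    then have "(\<integral>\<^sup>+x. ennreal (norm (W x) powr p) \<partial>lborel) \<le> (\<integral>\<^sup>+x. S x \<partial>lborel)"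
      by (rule nn_integral_mono_AE)
    then show ?thesis using int_S by simp
  qed
  show ?thesis
  proof (rule that[OF W _ iG])
    show "(\<integral>\<^sup>+x. ennreal (norm (W x) powr p) \<partial>lborel) \<le>
        ennreal (D * series_const p q)"
      using int_W by (simp add: K_def A_def r_def series_const_def)
    show "AE x in lborel. \<forall>J. norm (\<Sum>j<J. w j x) powr p \<le> G x"
      using S_fin by eventually_elim (use gp partial in simp)
    show "AE x in lborel. (\<lambda>J. \<Sum>j<J. w j x) \<longlonglongrightarrow> W x"
      using S_fin by eventually_elim (rule lim)
  qed
qed

section \<open>Lebesgue functions as tempered distributions\<close>

lemma le_one_plus_powr: "t \<le> 1 + t powr p" if "t \<ge> 0" "p \<ge> 1" for t p :: real
proof (cases "t \<le> 1")
  case False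
  then have "t powr 1 \<le> t powr p" using that by (intro powr_mono) auto
  then show ?thesis using False by simp
qed (simp add: add_increasing2)

text \<open>
  By \<open>|f \<phi>| \<le> |\<phi>| + |f|\<^sup>p |\<phi>|\<close>, where \<open>\<phi>\<close> is both integrable and bounded.
\<close>

lemma Lp_functions_tempered:
  fixes f :: "real ^ 'n::finite \<Rightarrow> complex"
  assumes p: "p \<ge> 1" and f: "f \<in> Lp_functions p"
  shows "f \<in> tempered_functions"
proof -
  have m [measurable]: "f \<in> borel_measurable borel" and i: "integrable lborel (\<lambda>x. norm (f x) powr p)"
    using f by (auto simp: Lp_functions_def)
  have "integrable lborel (\<lambda>x. f x * \<phi> x)" if S: "\<phi> \<in> schwartz_space" for \<phi>
  proof -
    note [measurable] = schwartz_measurable[OF S]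
    obtain B where B: "\<And>x. norm (\<phi> x) \<le> B" using schwartz_bounded[OF S] by blast
    show ?thesis
    proof (rule Bochner_Integration.integrable_bound)
      show "integrable lborel (\<lambda>x. norm (\<phi> x) + norm (f x) powr p * B)"
        using schwartz_integrable[OF S] i by (intro Bochner_Integration.integrable_add integrable_norm integrable_mult_left)
      have "norm (f x * \<phi> x) \<le> norm (\<phi> x) + norm (f x) powr p * B" for x
      proof -
        have "norm (f x * \<phi> x) \<le> (1 + norm (f x) powr p) * norm (\<phi> x)"
          unfolding norm_mult by (intro mult_right_mono le_one_plus_powr p) auto
        also have "\<dots> \<le> norm (\<phi> x) + norm (f x) powr p * B"
          using mult_left_mono[OF B[of x], of "norm (f x) powr p"] by (simp add: algebra_simps)
        finally show ?thesis .
      qed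
      then show "AE x in lborel. norm (f x * \<phi> x) \<le> norm (norm (\<phi> x) + norm (f x) powr p * B)"
        by (auto intro!: AE_I2 order_trans[OF _ abs_ge_self])
    qed measurable
  qed
  then show ?thesis by (simp add: tempered_functions_def)
qed

lemma norm_le_schwartz_seminorm:
  assumes "\<phi> \<in> schwartz_space"
  shows "norm x ^ k * norm (\<phi> x) \<le> schwartz_seminorm k [] \<phi>"
proof -
  have "bounded (range (\<lambda>x. norm x ^ k * norm (partial_derivs [] \<phi> x)))"
    using assms unfolding schwartz_space_def by blast
  then have "bdd_above (range (\<lambda>x. norm x ^ k * norm (partial_derivs [] \<phi> x)))"
    by (rule bounded_imp_bdd_above)
  from cSUP_upper[OF UNIV_I this, of x] show ?thesis
    by (simp add: schwartz_seminorm_def partial_derivs_def)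
qed

lemma schwartz_seminorm_nonneg:
  assumes "\<phi> \<in> schwartz_space"
  shows "schwartz_seminorm k \<alpha> \<phi> \<ge> 0"
proof -
  have "bounded (range (\<lambda>x. norm x ^ k * norm (partial_derivs \<alpha> \<phi> x)))"
    using assms unfolding schwartz_space_def by blast
  then have "bdd_above (range (\<lambda>x. norm x ^ k * norm (partial_derivs \<alpha> \<phi> x)))"
    by (rule bounded_imp_bdd_above)
  from cSUP_upper[OF UNIV_I this, of 0]
  have "norm (0 :: real ^ 'a) ^ k * norm (partial_derivs \<alpha> \<phi> 0) \<le> schwartz_seminorm k \<alpha> \<phi>"
    by (simp add: schwartz_seminorm_def)
  then show ?thesis
    by (rule order_trans[rotated]) simp
qed

text \<open>
  Only the seminorms without derivatives occur: by \<open>le_weight\<close> two of them bound \<open>\<integral> |\<phi>|\<close>, and the sup norm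
  of \<open>\<phi>\<close> controls its pairing with the integrable function \<open>|f|\<^sup>p\<close>.
\<close>

lemma Lp_dist_tempered:
  fixes f :: "real ^ 'n::finite \<Rightarrow> complex"
  assumes p: "p \<ge> 1" and f: "f \<in> Lp_functions p"
  shows "dist_of f \<in> tempered_distributions"
proof -
  have tf: "f \<in> tempered_functions" by (rule Lp_functions_tempered[OF p f])
  then have i: "integrable lborel (\<lambda>x. f x * \<phi> x)" if "\<phi> \<in> schwartz_space" for \<phi>
    using that by (simp add: tempered_functions_def)
  have ip: "integrable lborel (\<lambda>x. norm (f x) powr p)"
    using f by (auto simp: Lp_functions_def)
  let ?n = "CARD('n)"
  let ?N = "2 * CARD('n)"
  define A where "A = (LINT x|lborel. norm (f x) powr p)"
  define V where "V = (LINT x|lborel. weight (x :: real ^ 'n))"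
  have AV: "A \<ge> 0" "V \<ge> 0"
    by (auto simp: A_def V_def weight_pos less_imp_le intro!: Bochner_Integration.integral_nonneg)
  let ?\<Sigma> = "\<lambda>\<phi>. \<Sum>k\<le>?N. \<Sum>\<alpha> | length \<alpha> \<le> ?N. schwartz_seminorm k (\<alpha> :: 'n list) \<phi>"
  have lin: "dist_of f (\<lambda>x. a * \<phi> x + b * \<psi> x) = a * dist_of f \<phi> + b * dist_of f \<psi>"
    if S: "\<phi> \<in> schwartz_space" "\<psi> \<in> schwartz_space" for a b \<phi> \<psi>
  proof -
    have "(LINT x|lborel. f x * (a * \<phi> x + b * \<psi> x)) = (LINT x|lborel. a * (f x * \<phi> x) + b * (f x * \<psi> x))"
      by (simp add: algebra_simps)
    also have "\<dots> = a * (LINT x|lborel. f x * \<phi> x) + b * (LINT x|lborel. f x * \<psi> x)"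
      using i[OF S(1)] i[OF S(2)] by simp
    finally show ?thesis using S by (simp add: dist_of_def schwartz_lincomb)
  qed
  have bd: "norm (dist_of f \<phi>) \<le> (A + 2 ^ ?n * 2 * V) * ?\<Sigma> \<phi>" if S: "\<phi> \<in> schwartz_space" for \<phi>
  proof -
    have fin: "finite {\<alpha> :: 'n list. length \<alpha> \<le> ?N}"
      using finite_lists_length_le[of "UNIV :: 'n set" ?N] by simp
    have semi: "schwartz_seminorm k [] \<phi> \<le> ?\<Sigma> \<phi>" if "k \<le> ?N" for k
    proof -
      have "schwartz_seminorm k [] \<phi> \<le> (\<Sum>\<alpha> | length \<alpha> \<le> ?N. schwartz_seminorm k (\<alpha> :: 'n list) \<phi>)"
        by (rule member_le_sum[of "[]"]) (use fin schwartz_seminorm_nonneg[OF S] in auto)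
      also have "\<dots> \<le> ?\<Sigma> \<phi>"
        by (rule member_le_sum[of k]) (use that schwartz_seminorm_nonneg[OF S] in \<open>auto intro!: sum_nonneg\<close>)
      finally show ?thesis .
    qed
    have b0: "norm (\<phi> x) \<le> ?\<Sigma> \<phi>" for x
      using norm_le_schwartz_seminorm[OF S, of x 0] semi[of 0] by simp
    have bN: "norm x ^ ?N * norm (\<phi> x) \<le> ?\<Sigma> \<phi>" for x
      using norm_le_schwartz_seminorm[OF S, of x ?N] semi[of ?N] by simp
    have pw: "norm (f x * \<phi> x) \<le> norm (f x) powr p * ?\<Sigma> \<phi> + weight x * (2 ^ ?n * 2 * ?\<Sigma> \<phi>)" for x
    proof -
      have "norm (f x * \<phi> x) \<le> (1 + norm (f x) powr p) * norm (\<phi> x)"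
        unfolding norm_mult by (intro mult_right_mono le_one_plus_powr p) auto
      also have "\<dots> = norm (f x) powr p * norm (\<phi> x) + norm (\<phi> x)" by (simp add: algebra_simps)
      also have "norm (f x) powr p * norm (\<phi> x) \<le> norm (f x) powr p * ?\<Sigma> \<phi>"
        by (intro mult_left_mono b0) simp
      also have "norm (\<phi> x) \<le> 2 ^ ?n * (norm (\<phi> x) + norm x ^ ?N * norm (\<phi> x)) * weight x"
        using le_weight[of "norm (\<phi> x)" x] by simp
      also have "\<dots> \<le> 2 ^ ?n * (?\<Sigma> \<phi> + ?\<Sigma> \<phi>) * weight x"
        using weight_pos[of x] by (intro mult_right_mono mult_left_mono add_mono b0 bN) auto
      finally show ?thesis by (simp add: algebra_simps)
    qed
    have "norm (LINT x|lborel. f x * \<phi> x) \<le> (LINT x|lborel. norm (f x) powr p * ?\<Sigma> \<phi> + weight x * (2 ^ ?n * 2 * ?\<Sigma> \<phi>))"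
      by (rule Bochner_Integration.integral_norm_bound_integral[OF i[OF S] _ pw])
         (intro Bochner_Integration.integrable_add integrable_mult_left ip integrable_weight)
    also have "\<dots> = A * ?\<Sigma> \<phi> + V * (2 ^ ?n * 2 * ?\<Sigma> \<phi>)"
      unfolding A_def V_def
      by (subst Bochner_Integration.integral_add)
         (intro integrable_mult_left ip integrable_weight, intro integrable_mult_left ip integrable_weight,
          simp only: integral_mult_left_zero)
    finally show ?thesis using S by (simp add: dist_of_def algebra_simps)
  qed
  show ?thesis
    unfolding tempered_distributions_def
  proof (intro CollectI conjI)
    show "\<exists>C N. \<forall>\<phi>\<in>schwartz_space. norm (dist_of f \<phi>) \<le>
        C * (\<Sum>k\<le>N. \<Sum>\<alpha> | length \<alpha> \<le> N. schwartz_seminorm k \<alpha> \<phi>)"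
      using bd by (intro exI ballI)
  qed (use lin in \<open>auto simp: dist_of_def\<close>)
qed

section \<open>Decomposition into frequency bands\<close>

definition freq_band :: "real \<Rightarrow> real \<Rightarrow> (real ^ 'n::finite \<Rightarrow> complex) \<Rightarrow> real ^ 'n \<Rightarrow> complex" where
  "freq_band r R a = (\<lambda>\<xi>. if r \<le> norm \<xi> \<and> norm \<xi> < R then a \<xi> else 0)"

lemma borel_measurable_freq_band [measurable]:
  assumes [measurable]: "a \<in> borel_measurable borel"
  shows "freq_band r R a \<in> borel_measurable borel"
  unfolding freq_band_def by measurable

lemma sum_freq_band:
  assumes "mono R" "R 0 = (0::real)"
  shows "(\<Sum>j<J. freq_band (R j) (R (Suc j)) a \<xi>) = (if norm \<xi> < R J then a \<xi> else 0)"
proof (induction J)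
  case (Suc J)
  have "R J \<le> R (Suc J)" using assms(1) by (simp add: mono_def)
  then show ?case using Suc by (auto simp: freq_band_def)
qed (use assms in simp)

text \<open>
  If the inverse transforms of the parts of \<open>a\<close> in successive annuli decay geometrically in \<open>L\<^sup>p\<close>, then
  the inverse transform of \<open>a\<close>, in the sense of distributions, is an \<open>L\<^sup>p\<close> function. The lemma serves
  twice: for \<open>p = 2\<close> it extends the transform to \<open>L\<^sup>2\<close>, and with dyadic annuli it gives the Sobolev
  embedding.
\<close>

lemma inv_fourier_of_bands:
  fixes a :: "real ^ 'n::finite \<Rightarrow> complex"
  assumes a: "a \<in> tempered_functions"
    and R: "mono R" "R 0 = 0" "filterlim R at_top sequentially"
    and p: "p \<ge> 1" and q: "0 < q" "q < 1" and D: "D \<ge> 0"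
    and int: "\<And>j. integrable lborel (freq_band (R j) (R (Suc j)) a)"
    and bound: "\<And>j. (\<integral>\<^sup>+x. ennreal (norm (inv_fourier (freq_band (R j) (R (Suc j)) a) x) powr p) \<partial>lborel)
                  \<le> ennreal (D * q ^ j)"
  obtains W where "W \<in> Lp_functions p" and "dist_of W = inv_fourier_dist (dist_of a)"
    and "(LINT x|lborel. norm (W x) powr p) \<le> D * series_const p q"
proof -
  have ma [measurable]: "a \<in> borel_measurable borel"
    using a by (simp add: tempered_functions_def)
  define b where "b j = freq_band (R j) (R (Suc j)) a" for j
  have mb [measurable]: "b j \<in> borel_measurable borel" for j
    unfolding b_def by measurable
  have ib: "integrable lborel (b j)" for j
    unfolding b_def by (rule int)
  define w where "w j = inv_fourier (b j)" for j
  have mw [measurable]: "w j \<in> borel_measurable borel" for j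
    unfolding w_def by (rule borel_measurable_inv_fourier[OF mb])
  have bw: "(\<integral>\<^sup>+x. ennreal (norm (w j x) powr p) \<partial>lborel) \<le> ennreal (D * q ^ j)" for j
    using bound[of j] by (simp add: w_def b_def)
  let ?K = "D * series_const p q"
  have K: "?K \<ge> 0" using D q by (simp add: series_const_nonneg)
  obtain W and G :: "real ^ 'n \<Rightarrow> real" where W [measurable]: "W \<in> borel_measurable borel"
    and int_W: "(\<integral>\<^sup>+x. ennreal (norm (W x) powr p) \<partial>lborel) \<le> ennreal ?K"
    and G: "integrable lborel G"
    and dom: "AE x in lborel. \<forall>J. norm (\<Sum>j<J. w j x) powr p \<le> G x"
    and lim: "AE x in lborel. (\<lambda>J. \<Sum>j<J. w j x) \<longlonglongrightarrow> W x"
    by (rule Lp_series[OF p q D mw bw])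
  have iW: "integrable lborel (\<lambda>x. norm (W x) powr p)"
    by (rule integrableI_nonneg) (use int_W in \<open>auto simp: le_less_trans\<close>)
  have WL: "W \<in> Lp_functions p"
    using W iW by (simp add: Lp_functions_def)
  have "ennreal (LINT x|lborel. norm (W x) powr p) \<le> ennreal ?K"
    using int_W by (simp add: nn_integral_eq_integral[OF iW])
  then have bound_W: "(LINT x|lborel. norm (W x) powr p) \<le> ?K"
    using K by (simp add: ennreal_le_iff)
  have pair: "(LINT x|lborel. W x * \<phi> x) = (LINT \<xi>|lborel. a \<xi> * inv_fourier \<phi> \<xi>)" if S: "\<phi> \<in> schwartz_space" for \<phi>
  proof -
    note IS = inv_fourier_schwartz[OF S]
    note mS [measurable] = schwartz_measurable[OF S] schwartz_measurable[OF IS]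
    obtain B where B: "\<And>x. norm (\<phi> x) \<le> B" using schwartz_bounded[OF S] by blast
    obtain B' where B': "\<And>x. norm (inv_fourier \<phi> x) \<le> B'" using schwartz_bounded[OF IS] by blast
    have iw: "integrable lborel (\<lambda>x. w j x * \<phi> x)" for j
    proof -
      have "norm (w j x) \<le> fourier_const TYPE('n) * (LINT x|lborel. norm (b j x))" for x
        unfolding w_def by (rule norm_inv_fourier_le[OF ib])
      then have "integrable lborel (\<lambda>x. \<phi> x * w j x)"
        by (intro integrable_bounded_mult[OF schwartz_integrable[OF S]]) (simp_all add: mw)
      then show ?thesis by (simp only: mult.commute)
    qed
    have ibI: "integrable lborel (\<lambda>\<xi>. b j \<xi> * inv_fourier \<phi> \<xi>)" for j
      by (rule integrable_bounded_mult[OF ib _ B']) measurable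
    have "(\<lambda>J. (LINT x|lborel. (\<Sum>j<J. w j x) * \<phi> x)) \<longlonglongrightarrow> (LINT x|lborel. W x * \<phi> x)"
    proof (rule integral_dominated_convergence[where w = "\<lambda>x. norm (\<phi> x) + G x * B"])
      show "integrable lborel (\<lambda>x. norm (\<phi> x) + G x * B)"
        using schwartz_integrable[OF S] G by (intro Bochner_Integration.integrable_add integrable_norm integrable_mult_left)
      show "AE x in lborel. (\<lambda>J. (\<Sum>j<J. w j x) * \<phi> x) \<longlonglongrightarrow> W x * \<phi> x"
        using lim by eventually_elim (intro tendsto_intros)
      show "AE x in lborel. norm ((\<Sum>j<J. w j x) * \<phi> x) \<le> norm (\<phi> x) + G x * B" for J
        using dom
      proof eventually_elim
        case (elim x)
        have G0: "0 \<le> G x" using elim[rule_format, of J] by (rule order_trans[rotated]) simp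
        have "norm ((\<Sum>j<J. w j x) * \<phi> x) \<le> (1 + norm (\<Sum>j<J. w j x) powr p) * norm (\<phi> x)"
          unfolding norm_mult by (intro mult_right_mono le_one_plus_powr p) auto
        also have "\<dots> \<le> (1 + G x) * norm (\<phi> x)"
          using elim by (intro mult_right_mono add_left_mono) auto
        also have "\<dots> \<le> norm (\<phi> x) + G x * B"
          using mult_left_mono[OF B[of x] G0] by (simp add: algebra_simps)
        finally show ?case .
      qed
    qed measurable
    moreover have "(\<lambda>J. (LINT \<xi>|lborel. (\<Sum>j<J. b j \<xi>) * inv_fourier \<phi> \<xi>)) \<longlonglongrightarrow> (LINT \<xi>|lborel. a \<xi> * inv_fourier \<phi> \<xi>)"
    proof (rule integral_dominated_convergence[where w = "\<lambda>\<xi>. norm (a \<xi> * inv_fourier \<phi> \<xi>)"])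
      have sb: "(\<Sum>j<J. b j \<xi>) = (if norm \<xi> < R J then a \<xi> else 0)" for J \<xi>
        unfolding b_def by (rule sum_freq_band[OF R(1,2)])
      show "integrable lborel (\<lambda>\<xi>. norm (a \<xi> * inv_fourier \<phi> \<xi>))"
        using a IS by (intro integrable_norm) (simp add: tempered_functions_def)
      show "AE \<xi> in lborel. norm ((\<Sum>j<J. b j \<xi>) * inv_fourier \<phi> \<xi>) \<le> norm (a \<xi> * inv_fourier \<phi> \<xi>)" for J
        unfolding sb by (intro AE_I2) auto
      show "AE \<xi> in lborel. (\<lambda>J. (\<Sum>j<J. b j \<xi>) * inv_fourier \<phi> \<xi>) \<longlonglongrightarrow> a \<xi> * inv_fourier \<phi> \<xi>"
      proof (rule AE_I2)
        fix \<xi> :: "real ^ 'n"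
        have "\<forall>\<^sub>F J in sequentially. norm \<xi> < R J"
          using R(3) by (simp add: filterlim_at_top_dense)
        then have "\<forall>\<^sub>F J in sequentially. (\<Sum>j<J. b j \<xi>) * inv_fourier \<phi> \<xi> = a \<xi> * inv_fourier \<phi> \<xi>"
          by eventually_elim (simp add: sb)
        then show "(\<lambda>J. (\<Sum>j<J. b j \<xi>) * inv_fourier \<phi> \<xi>) \<longlonglongrightarrow> a \<xi> * inv_fourier \<phi> \<xi>"
          by (rule tendsto_eventually)
      qed
    qed measurable
    moreover have "(LINT x|lborel. (\<Sum>j<J. w j x) * \<phi> x) = (LINT \<xi>|lborel. (\<Sum>j<J. b j \<xi>) * inv_fourier \<phi> \<xi>)" for J
    proof -
      have "(LINT x|lborel. (\<Sum>j<J. w j x) * \<phi> x) = (\<Sum>j<J. (LINT x|lborel. w j x * \<phi> x))"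
        unfolding sum_distrib_right by (rule Bochner_Integration.integral_sum) (rule iw)
      also have "\<dots> = (\<Sum>j<J. (LINT \<xi>|lborel. b j \<xi> * inv_fourier \<phi> \<xi>))"
        unfolding w_def by (intro sum.cong refl inv_fourier_swap ib schwartz_integrable[OF S])
      also have "\<dots> = (LINT \<xi>|lborel. (\<Sum>j<J. b j \<xi>) * inv_fourier \<phi> \<xi>)"
        unfolding sum_distrib_right by (rule Bochner_Integration.integral_sum[symmetric]) (rule ibI)
      finally show ?thesis .
    qed
    ultimately show ?thesis
      by (simp add: LIMSEQ_unique)
  qed
  have "dist_of W = inv_fourier_dist (dist_of a)"
    by (rule ext) (simp add: dist_of_def inv_fourier_dist_def pair inv_fourier_schwartz)
  then show ?thesis by (rule that[OF WL _ bound_W])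
qed

text \<open>
  Cauchy--Schwarz; the volume of the ball is estimated by that of the circumscribed cube.
\<close>

lemma ball_supported_integrable:
  fixes a :: "real ^ 'n::finite \<Rightarrow> complex"
  assumes ma: "a \<in> borel_measurable borel"
    and supp: "\<And>\<xi>. norm \<xi> \<ge> R \<Longrightarrow> a \<xi> = 0" and R: "R \<ge> 0"
    and sq: "integrable lborel (\<lambda>\<xi>. (norm (a \<xi>))\<^sup>2)"
  shows "integrable lborel a"
    and "(LINT \<xi>|lborel. norm (a \<xi>)) \<le> sqrt ((LINT \<xi>|lborel. (norm (a \<xi>))\<^sup>2) * (2 * R) ^ CARD('n))"
proof -
  note ma [measurable]
  let ?B = "ball (0 :: real ^ 'n) R"
  let ?Q = "LINT \<xi>|lborel. (norm (a \<xi>))\<^sup>2"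
  let ?I = "\<integral>\<^sup>+\<xi>. ennreal (norm (a \<xi>)) \<partial>lborel"
  have Q: "?Q \<ge> 0" by simp
  have vol: "emeasure lborel ?B \<le> ennreal ((2 * R) ^ CARD('n))"
  proof -
    have "?B \<subseteq> cbox (- (R *\<^sub>R One)) (R *\<^sub>R One)"
    proof
      fix x :: "real ^ 'n" assume "x \<in> ?B"
      then have "\<bar>x \<bullet> b\<bar> \<le> R" if "b \<in> Basis" for b
        using Basis_le_norm[OF that, of x] by simp
      then show "x \<in> cbox (- (R *\<^sub>R One)) (R *\<^sub>R One)"
        by (auto simp: mem_box abs_le_iff) (metis minus_le_iff)
    qed
    then have "emeasure lborel ?B \<le> emeasure lborel (cbox (- (R *\<^sub>R One)) (R *\<^sub>R One :: real ^ 'n))"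
      by (intro emeasure_mono) auto
    also have "\<dots> = ennreal ((2 * R) ^ CARD('n))"
    proof -
      have "(R *\<^sub>R One - - (R *\<^sub>R One)) \<bullet> b = 2 * R" if "b \<in> Basis" for b :: "real ^ 'n"
        using that by (simp only: inner_diff_left inner_minus_left inner_scaleR_left inner_sum_left_Basis) simp
      then have "(\<Prod>b\<in>(Basis :: (real ^ 'n) set). (R *\<^sub>R One - - (R *\<^sub>R One)) \<bullet> b) = (\<Prod>b\<in>(Basis :: (real ^ 'n) set). 2 * R)"
        by (intro prod.cong refl)
      moreover have "(- (R *\<^sub>R One)) \<bullet> b \<le> (R *\<^sub>R One) \<bullet> b" if "b \<in> Basis" for b :: "real ^ 'n"
        using that R by simp
      ultimately show ?thesis
        by (simp only: emeasure_lborel_cbox prod_constant DIM_cart DIM_real mult_1_right)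
    qed
    finally show ?thesis .
  qed
  have "?I = (\<integral>\<^sup>+\<xi>. ennreal (norm (a \<xi>)) * indicator ?B \<xi> \<partial>lborel)"
    by (intro nn_integral_cong) (auto simp: indicator_def supp)
  then have "?I\<^sup>2 \<le> (\<integral>\<^sup>+\<xi>. (ennreal (norm (a \<xi>)))\<^sup>2 \<partial>lborel) * (\<integral>\<^sup>+\<xi>. (indicator ?B \<xi>)\<^sup>2 \<partial>lborel)"
    using Cauchy_Schwarz_nn_integral[of "\<lambda>\<xi>. ennreal (norm (a \<xi>))" lborel "indicator ?B"]
    by (simp add: borel_measurable_indicator)
  also have "(\<integral>\<^sup>+\<xi>. (ennreal (norm (a \<xi>)))\<^sup>2 \<partial>lborel) = ennreal ?Q"
    by (simp add: ennreal_power nn_integral_eq_integral[OF sq])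
  also have "(\<integral>\<^sup>+\<xi>. (indicator ?B \<xi>)\<^sup>2 \<partial>lborel) = (\<integral>\<^sup>+\<xi>. indicator ?B \<xi> \<partial>lborel)"
    by (intro nn_integral_cong) (auto simp: indicator_def)
  also have "\<dots> = emeasure lborel ?B" by simp
  also have "ennreal ?Q * emeasure lborel ?B \<le> ennreal ?Q * ennreal ((2 * R) ^ CARD('n))"
    by (intro mult_left_mono vol) simp
  also have "\<dots> = ennreal (?Q * (2 * R) ^ CARD('n))"
    using R by (simp add: ennreal_mult)
  finally have I2: "?I\<^sup>2 \<le> ennreal (?Q * (2 * R) ^ CARD('n))" .
  then have "?I\<^sup>2 < \<infinity>" by (rule le_less_trans) simp
  then have "?I < \<infinity>" by (simp add: power_less_top_ennreal)
  then show ia: "integrable lborel a"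
    by (intro integrableI_bounded) auto
  have "?I = ennreal (LINT \<xi>|lborel. norm (a \<xi>))"
    by (rule nn_integral_eq_integral[OF integrable_norm[OF ia]]) simp
  then have "ennreal ((LINT \<xi>|lborel. norm (a \<xi>))\<^sup>2) \<le> ennreal (?Q * (2 * R) ^ CARD('n))"
    using I2 by (simp add: ennreal_power)
  then have "(LINT \<xi>|lborel. norm (a \<xi>))\<^sup>2 \<le> ?Q * (2 * R) ^ CARD('n)"
    using Q R by (subst (asm) ennreal_le_iff) auto
  then show "(LINT \<xi>|lborel. norm (a \<xi>)) \<le> sqrt (?Q * (2 * R) ^ CARD('n))"
    by (rule real_le_rsqrt)
qed

text \<open>
  Interpolation between the sup norm, which is bounded by the \<open>L\<^sup>1\<close> norm of \<open>a\<close>, and the \<open>L\<^sup>2\<close> norm: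
  \<open>|w|\<^sup>p \<le> (sup |w|)\<^sup>p\<^sup>-\<^sup>2 |w|\<^sup>2\<close>.
\<close>

lemma ball_supported_inv_fourier_Lp:
  fixes a :: "real ^ 'n::finite \<Rightarrow> complex"
  assumes ma: "a \<in> borel_measurable borel" and p: "p \<ge> 2"
    and supp: "\<And>\<xi>. norm \<xi> \<ge> R \<Longrightarrow> a \<xi> = 0" and R: "R \<ge> 0"
    and sq: "integrable lborel (\<lambda>\<xi>. (norm (a \<xi>))\<^sup>2)"
  shows "(\<integral>\<^sup>+x. ennreal (norm (inv_fourier a x) powr p) \<partial>lborel) \<le>
    ennreal ((fourier_const TYPE('n) * sqrt ((LINT \<xi>|lborel. (norm (a \<xi>))\<^sup>2) * (2 * R) ^ CARD('n))) powr (p - 2)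
      * (LINT \<xi>|lborel. (norm (a \<xi>))\<^sup>2))"
proof -
  let ?Q = "LINT \<xi>|lborel. (norm (a \<xi>))\<^sup>2"
  let ?M = "fourier_const TYPE('n) * sqrt (?Q * (2 * R) ^ CARD('n))"
  have b: "integrable lborel a" "(LINT \<xi>|lborel. norm (a \<xi>)) \<le> sqrt (?Q * (2 * R) ^ CARD('n))"
    by (rule ball_supported_integrable[OF ma supp R sq], assumption)+
  note [measurable] = borel_measurable_inv_fourier[OF ma]
  have M: "norm (inv_fourier a x) \<le> ?M" for x
    by (rule order_trans[OF norm_inv_fourier_le[OF b(1)]]) (intro mult_left_mono b(2), simp add: less_imp_le)
  have "(\<integral>\<^sup>+x. ennreal (norm (inv_fourier a x) powr p) \<partial>lborel) \<le>
      (\<integral>\<^sup>+x. ennreal (?M powr (p - 2)) * ennreal ((norm (inv_fourier a x))\<^sup>2) \<partial>lborel)"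
  proof (rule nn_integral_mono)
    fix x
    have "norm (inv_fourier a x) powr p = norm (inv_fourier a x) powr (p - 2) * (norm (inv_fourier a x))\<^sup>2"
    proof (cases "inv_fourier a x = 0")
      case False
      then have "norm (inv_fourier a x) powr p = norm (inv_fourier a x) powr (p - 2 + 2)" by simp
      also have "\<dots> = norm (inv_fourier a x) powr (p - 2) * norm (inv_fourier a x) powr 2"
        by (rule powr_add)
      finally show ?thesis using False by simp
    qed simp
    also have "\<dots> \<le> ?M powr (p - 2) * (norm (inv_fourier a x))\<^sup>2"
      using p by (intro mult_right_mono powr_mono2 M) auto
    finally show "ennreal (norm (inv_fourier a x) powr p) \<le> ennreal (?M powr (p - 2)) * ennreal ((norm (inv_fourier a x))\<^sup>2)"
      by (simp add: ennreal_leI flip: ennreal_mult)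
  qed
  also have "\<dots> = ennreal (?M powr (p - 2)) * (\<integral>\<^sup>+x. ennreal ((norm (inv_fourier a x))\<^sup>2) \<partial>lborel)"
    by (rule nn_integral_cmult) measurable
  also have "\<dots> \<le> ennreal (?M powr (p - 2)) * (\<integral>\<^sup>+x. ennreal ((norm (a x))\<^sup>2) \<partial>lborel)"
    by (intro mult_left_mono inv_fourier_L2_le b(1)) simp
  also have "\<dots> = ennreal (?M powr (p - 2) * ?Q)"
    by (simp add: nn_integral_eq_integral[OF sq] ennreal_mult)
  finally show ?thesis .
qed

section \<open>The Fourier transform of square integrable functions\<close>

lemma Lp_functions_2_iff:
  "f \<in> Lp_functions 2 \<longleftrightarrow> f \<in> borel_measurable borel \<and> integrable lborel (\<lambda>x. (norm (f x))\<^sup>2)"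
  by (simp add: Lp_functions_def)

lemma Lp_fun_norm_2: "Lp_fun_norm 2 f = sqrt (LINT x|lborel. (norm (f x))\<^sup>2)"
  by (simp add: Lp_fun_norm_def powr_half_sqrt)

definition L2_const :: real where
  "L2_const = sqrt (series_const 2 (1/4))"

lemma L2_const_nonneg: "L2_const \<ge> 0"
  by (simp add: L2_const_def series_const_nonneg)

text \<open>
  The annuli are adapted to \<open>a\<close>: the radii are taken so large that the mass of \<open>|a|\<^sup>2\<close> outside the \<open>j\<close>-th
  ball is at most \<open>4\<^sup>-\<^sup>j\<close> times the total mass.
\<close>

lemma inv_fourier_L2_exists:
  fixes a :: "real ^ 'n::finite \<Rightarrow> complex"
  assumes aL: "a \<in> Lp_functions 2"
  obtains b where "b \<in> Lp_functions 2" and "dist_of b = inv_fourier_dist (dist_of a)"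
    and "Lp_fun_norm 2 b \<le> L2_const * Lp_fun_norm 2 a"
proof -
  have ma [measurable]: "a \<in> borel_measurable borel" and ia: "integrable lborel (\<lambda>x. (norm (a x))\<^sup>2)"
    using aL by (auto simp: Lp_functions_2_iff)
  define A where "A = (LINT x|lborel. (norm (a x))\<^sup>2)"
  have A: "A \<ge> 0" by (simp add: A_def)
  define T where "T r = (LINT x|lborel. (if r \<le> norm x then (norm (a x))\<^sup>2 else 0))" for r
  have iT: "integrable lborel (\<lambda>x. if r \<le> norm x then (norm (a x))\<^sup>2 else 0)" for r
    by (rule Bochner_Integration.integrable_bound[OF ia]) auto
  have TA: "T r \<le> A" for r
    unfolding T_def A_def by (intro integral_mono iT ia) auto
  have T0: "(\<lambda>n::nat. T (real n)) \<longlonglongrightarrow> 0"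
  proof -
    have "(\<lambda>n::nat. T (real n)) \<longlonglongrightarrow> (LINT x|(lborel :: (real ^ 'n) measure). 0 :: real)"
      unfolding T_def
    proof (rule integral_dominated_convergence[where w = "\<lambda>x. (norm (a x))\<^sup>2"])
      show "integrable lborel (\<lambda>x. (norm (a x))\<^sup>2)" by (rule ia)
      show "AE x in lborel. (\<lambda>n. if real n \<le> norm x then (norm (a x))\<^sup>2 else 0) \<longlonglongrightarrow> 0"
      proof (rule AE_I2)
        fix x :: "real ^ 'n"
        obtain N :: nat where "norm x < real N" using reals_Archimedean2 by blast
        then have "\<forall>n\<ge>N. (if real n \<le> norm x then (norm (a x))\<^sup>2 else 0) = 0" by auto
        then have "\<forall>\<^sub>F n in sequentially. (if real n \<le> norm x then (norm (a x))\<^sup>2 else 0) = 0"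
          unfolding eventually_sequentially by blast
        then show "(\<lambda>n. if real n \<le> norm x then (norm (a x))\<^sup>2 else 0) \<longlonglongrightarrow> 0"
          by (rule tendsto_eventually)
      qed
    qed auto
    then show ?thesis by simp
  qed
  have "\<exists>N::nat. \<forall>n\<ge>N. T (real n) \<le> A * (1/4) ^ j" for j
  proof (cases "A = 0")
    case True
    then show ?thesis using TA by auto
  next
    case False
    then have "A * (1/4) ^ j > 0" using A by simp
    from order_tendstoD(2)[OF T0 this] show ?thesis
      unfolding eventually_sequentially by (meson less_imp_le)
  qed
  then obtain N :: "nat \<Rightarrow> nat" where N: "\<And>j n. n \<ge> N j \<Longrightarrow> T (real n) \<le> A * (1/4) ^ j"
    by metis
  \<comment> \<open>Summing the thresholds makes the radii monotone; the summand \<open>j\<close> makes them unbounded.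
    The value 0 at \<open>j = 0\<close> makes the annuli cover the whole space.\<close>
  define R where "R j = (if j = 0 then 0 else real (j + (\<Sum>i\<le>j. N i)))" for j
  have R0: "R 0 = 0" by (simp add: R_def)
  have R_nonneg: "R j \<ge> 0" for j
    unfolding R_def using of_nat_0_le_iff[of "j + (\<Sum>i\<le>j. N i)", where 'a = real] by (simp only: split: if_split) blast
  have monoR: "mono R"
  proof (rule monoI)
    fix i j :: nat assume ij: "i \<le> j"
    then have "(\<Sum>k\<le>i. N k) \<le> (\<Sum>k\<le>j. N k)" by (intro sum_mono2) auto
    then have "real (i + (\<Sum>k\<le>i. N k)) \<le> real (j + (\<Sum>k\<le>j. N k))"
      using ij by (simp only: of_nat_le_iff)
    then show "R i \<le> R j"
      using ij R_nonneg[of j] by (cases "i = 0") (simp_all add: R_def)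
  qed
  have R_top: "filterlim R at_top sequentially"
    by (rule filterlim_at_top_mono[OF filterlim_real_sequentially])
       (auto simp: R_def sum_nonneg intro!: always_eventually)
  let ?b = "\<lambda>j. freq_band (R j) (R (Suc j)) a"
  have Q: "(LINT x|lborel. (norm (?b j x))\<^sup>2) \<le> A * (1/4) ^ j"
    and iQ: "integrable lborel (\<lambda>x. (norm (?b j x))\<^sup>2)" for j
  proof -
    show i: "integrable lborel (\<lambda>x. (norm (?b j x))\<^sup>2)"
      by (rule Bochner_Integration.integrable_bound[OF ia]) (auto simp: freq_band_def)
    have "(LINT x|lborel. (norm (?b j x))\<^sup>2) \<le> T (R j)"
      unfolding T_def by (intro integral_mono i iT) (auto simp: freq_band_def)
    also have "T (R j) \<le> A * (1/4) ^ j"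
    proof (cases "j = 0")
      case False
      have "N j \<le> (\<Sum>i\<le>j. N i)" by (intro member_le_sum) auto
      then show ?thesis using False N[of j "j + (\<Sum>i\<le>j. N i)"] by (simp add: R_def)
    qed (use TA in simp)
    finally show "(LINT x|lborel. (norm (?b j x))\<^sup>2) \<le> A * (1/4) ^ j" .
  qed
  have mb: "?b j \<in> borel_measurable borel" for j
    by measurable
  have supp: "?b j \<xi> = 0" if "R (Suc j) \<le> norm \<xi>" for j \<xi>
    using that by (simp add: freq_band_def)
  obtain W where W: "W \<in> Lp_functions 2" "dist_of W = inv_fourier_dist (dist_of a)"
    "(LINT x|lborel. norm (W x) powr 2) \<le> A * series_const 2 (1/4)"
  proof (rule inv_fourier_of_bands[of a R 2 "1/4" A])
    show "a \<in> tempered_functions" using aL by (intro Lp_functions_tempered[of 2]) auto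
    show "integrable lborel (?b j)" for j
      by (rule ball_supported_integrable(1)[OF mb supp R_nonneg iQ])
    show "(\<integral>\<^sup>+x. ennreal (norm (inv_fourier (?b j) x) powr 2) \<partial>lborel)
        \<le> ennreal (A * (1 / 4) ^ j)" for j
    proof -
      have one: "M powr (2 - 2) \<le> 1" for M :: real by simp
      have "(\<integral>\<^sup>+x. ennreal (norm (inv_fourier (?b j) x) powr 2) \<partial>lborel) \<le>
        ennreal ((fourier_const TYPE('n) * sqrt ((LINT \<xi>|lborel. (norm (?b j \<xi>))\<^sup>2) * (2 * R (Suc j)) ^ CARD('n))) powr (2 - 2)
          * (LINT \<xi>|lborel. (norm (?b j \<xi>))\<^sup>2))"
        by (rule ball_supported_inv_fourier_Lp[OF mb order_refl supp R_nonneg iQ])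
      also have "\<dots> \<le> ennreal (1 * (A * (1/4) ^ j))"
        by (intro ennreal_leI mult_mono one Q) auto
      finally show ?thesis by simp
    qed
  qed (use R0 monoR R_top A in auto)
  have "Lp_fun_norm 2 W \<le> sqrt (A * series_const 2 (1/4))"
    using W(3) by (simp add: Lp_fun_norm_2)
  also have "\<dots> = L2_const * Lp_fun_norm 2 a"
    by (simp add: Lp_fun_norm_2 A_def real_sqrt_mult L2_const_def)
  finally show ?thesis by (rule that[OF W(1,2)])
qed

section \<open>The subcritical Sobolev embedding\<close>

text \<open>
  The subcritical embedding of \<open>H\<^sup>s\<close> in \<open>L\<^sup>p\<close>, with \<open>a\<close> in the role of the Fourier transform. On the
  dyadic annulus \<open>|\<xi>| \<sim> 2\<^sup>j\<close> the \<open>L\<^sup>2\<close> norm of \<open>a\<close> gains \<open>2\<^sup>-\<^sup>s\<^sup>j\<close> from the Sobolev weight, and passing to \<open>L\<^sup>p\<close>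
  costs \<open>2\<close> to the power \<open>j n (1/2 - 1/p)\<close>. The terms decay geometrically exactly if
  \<open>n (1/2 - 1/p) < s\<close>, which is the upper bound on \<open>p\<close>.
\<close>

lemma sobolev_embedding:
  fixes s p :: real
  assumes s: "0 < s" "2 * s < real CARD('n::finite)" and p: "2 < p" "p < 2 * real CARD('n) / (real CARD('n) - 2 * s)"
  shows "\<exists>C\<ge>0. \<forall>a. a \<in> borel_measurable borel \<longrightarrow>
     integrable lborel (\<lambda>\<xi>. (1 + norm \<xi> powr (2 * s)) * (norm (a \<xi>))\<^sup>2) \<longrightarrow>
     (\<exists>w::real ^ 'n \<Rightarrow> complex. w \<in> Lp_functions p \<and> dist_of w = inv_fourier_dist (dist_of a) \<and>
       Lp_fun_norm p w \<le> C * sqrt (LINT \<xi>|lborel. (1 + norm \<xi> powr (2 * s)) * (norm (a \<xi>))\<^sup>2))"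
proof -
  let ?n = "CARD('n)"
  let ?c = "fourier_const TYPE('n)"
  define u where "u = (2::real) powr (- 2 * s)"
  \<comment> \<open>\<open>u\<^sup>j\<close> is the gain in \<open>\<integral> |a|\<^sup>2\<close> on the \<open>j\<close>-th annulus and \<open>2\<^sup>n\<^sup>j\<close> is the growth of its volume.\<close>
  define q where "q = (u * 2 ^ ?n) powr ((p - 2) / 2) * u"
  have u: "u > 0" by (simp add: u_def)
  have q0: "q > 0" using u by (simp add: q_def)
  have q1: "q < 1"
  proof -
    have "u * 2 ^ ?n = 2 powr (real ?n - 2 * s)"
      by (simp add: u_def powr_diff powr_minus powr_realpow divide_inverse mult.commute)
    then have "q = 2 powr ((real ?n - 2 * s) * ((p - 2) / 2) + (- 2 * s))"
      by (simp only: q_def u_def powr_powr powr_add)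
    moreover have "(real ?n - 2 * s) * ((p - 2) / 2) + (- 2 * s) < 0"
    proof -
      have "p * (real ?n - 2 * s) < 2 * real ?n"
        using p(2) s(2) by (simp add: pos_less_divide_eq)
      then show ?thesis by (simp add: field_simps)
    qed
    ultimately show ?thesis by (simp add: powr_less_one)
  qed
  define K where "K = series_const p q"
  have K: "K \<ge> 0" unfolding K_def using q0 q1 by (rule series_const_nonneg)
  define c1 where "c1 = (?c * sqrt (4 powr s * 2 ^ ?n)) powr (p - 2) * 4 powr s"
  have c1: "c1 \<ge> 0" by (simp add: c1_def)
  define C where "C = (c1 * K) powr (1 / p)"
  define R :: "nat \<Rightarrow> real" where "R j = (if j = 0 then 0 else 2 ^ (j - 1))" for j
  have R0: "R 0 = 0" by (simp add: R_def)
  have RS: "R (Suc j) = 2 ^ j" for j by (simp add: R_def)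
  have monoR: "mono R"
    by (rule mono_iff_le_Suc[THEN iffD2]) (auto simp: R_def power_increasing)
  have R_nonneg: "R j \<ge> 0" for j by (simp add: R_def)
  have R_top: "filterlim R at_top sequentially"
  proof -
    have "filterlim (\<lambda>j. 2 ^ j :: real) at_top sequentially"
      by (rule filterlim_at_top_mono[OF filterlim_real_sequentially])
         (auto intro!: less_imp_le of_nat_less_two_power)
    then have "filterlim (\<lambda>j. R (Suc j)) at_top sequentially" by (simp add: RS)
    then show ?thesis by (rule filterlim_sequentially_Suc[THEN iffD1])
  qed
  have low: "1 \<le> 4 powr s * u ^ j * (1 + t powr (2 * s))" if "R j \<le> t" for j t
  proof (cases j)
    case 0
    have "1 \<le> (4::real) powr s" using s by (simp add: ge_one_powr_ge_zero)
    then have "1 * 1 \<le> 4 powr s * (1 + t powr (2 * s))" by (intro mult_mono) auto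
    then show ?thesis using 0 by simp
  next
    case (Suc i)
    have uj: "u ^ j = 2 powr (- 2 * s * real j)"
      by (simp add: u_def powr_power mult.commute)
    have four: "(4::real) powr s = 2 powr (2 * s)"
      by (simp flip: powr_powr)
    have "2 powr (real i * (2 * s)) = (2 ^ i) powr (2 * s)"
      by (simp add: powr_powr flip: powr_realpow)
    also have "\<dots> \<le> t powr (2 * s)"
      using that s Suc by (intro powr_mono2) (auto simp: R_def)
    finally have "2 powr (2 * s) * 2 powr (- 2 * s * real j) * 2 powr (real i * (2 * s)) \<le>
        4 powr s * u ^ j * (1 + t powr (2 * s))"
      unfolding four uj by (intro mult_left_mono) auto
    moreover have "2 powr (2 * s) * 2 powr (- 2 * s * real j) * 2 powr (real i * (2 * s)) = (1::real)"
      by (simp add: Suc algebra_simps flip: powr_add)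
    ultimately show ?thesis by simp
  qed
  have "\<exists>w. w \<in> Lp_functions p \<and> dist_of w = inv_fourier_dist (dist_of a) \<and>
       Lp_fun_norm p w \<le> C * sqrt (LINT \<xi>|lborel. (1 + norm \<xi> powr (2 * s)) * (norm (a \<xi>))\<^sup>2)"
    if ma [measurable]: "a \<in> borel_measurable borel"
      and iA: "integrable lborel (\<lambda>\<xi>. (1 + norm \<xi> powr (2 * s)) * (norm (a \<xi>))\<^sup>2)" for a :: "real ^ 'n \<Rightarrow> complex"
  proof -
    define A where "A = (LINT \<xi>|lborel. (1 + norm \<xi> powr (2 * s)) * (norm (a \<xi>))\<^sup>2)"
    have A: "A \<ge> 0" unfolding A_def by (intro Bochner_Integration.integral_nonneg) simp
    have ia: "integrable lborel (\<lambda>x. (norm (a x))\<^sup>2)"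
      by (rule Bochner_Integration.integrable_bound[OF iA]) (auto simp: distrib_right)
    have at: "a \<in> tempered_functions"
      using ia ma by (intro Lp_functions_tempered[of 2]) (auto simp: Lp_functions_2_iff)
    define E where "E = 4 powr s * A"
    have E: "E \<ge> 0" using A by (simp add: E_def)
    let ?b = "\<lambda>j. freq_band (R j) (R (Suc j)) a"
    have Q: "(LINT x|lborel. (norm (?b j x))\<^sup>2) \<le> E * u ^ j"
      and iQ: "integrable lborel (\<lambda>x. (norm (?b j x))\<^sup>2)" for j
    proof -
      show i: "integrable lborel (\<lambda>x. (norm (?b j x))\<^sup>2)"
        by (rule Bochner_Integration.integrable_bound[OF ia]) (auto simp: freq_band_def)
      have "(LINT x|lborel. (norm (?b j x))\<^sup>2) \<le>
          (LINT x|lborel. 4 powr s * u ^ j * ((1 + norm x powr (2 * s)) * (norm (a x))\<^sup>2))"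
      proof (intro integral_mono i integrable_mult_right iA)
        fix x :: "real ^ 'n"
        show "(norm (?b j x))\<^sup>2 \<le> 4 powr s * u ^ j * ((1 + norm x powr (2 * s)) * (norm (a x))\<^sup>2)"
        proof (cases "R j \<le> norm x \<and> norm x < R (Suc j)")
          case True
          then have "1 * (norm (a x))\<^sup>2 \<le> 4 powr s * u ^ j * (1 + norm x powr (2 * s)) * (norm (a x))\<^sup>2"
            by (intro mult_right_mono low) auto
          then show ?thesis using True by (simp add: freq_band_def mult.assoc)
        next
          case False
          then show ?thesis using u by (auto simp: freq_band_def)
        qed
      qed
      also have "\<dots> = E * u ^ j"
        unfolding E_def A_def by simp
      finally show "(LINT x|lborel. (norm (?b j x))\<^sup>2) \<le> E * u ^ j" .
    qed
    have mb: "?b j \<in> borel_measurable borel" for j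
      by measurable
    have supp: "?b j \<xi> = 0" if "R (Suc j) \<le> norm \<xi>" for j \<xi>
      using that by (simp add: freq_band_def)
    define D where "D = (?c * sqrt (E * 2 ^ ?n)) powr (p - 2) * E"
    have D0: "D \<ge> 0" using E by (simp add: D_def)
    obtain w where w: "w \<in> Lp_functions p" "dist_of w = inv_fourier_dist (dist_of a)"
      "(LINT x|lborel. norm (w x) powr p) \<le> D * K"
      unfolding K_def
    proof (rule inv_fourier_of_bands[of a R p q D])
      show "integrable lborel (?b j)" for j
        by (rule ball_supported_integrable(1)[OF mb supp R_nonneg iQ])
      show "(\<integral>\<^sup>+x. ennreal (norm (inv_fourier (?b j) x) powr p) \<partial>lborel)
          \<le> ennreal (D * q ^ j)" for j
      proof -
        let ?Q = "LINT \<xi>|lborel. (norm (?b j \<xi>))\<^sup>2"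
        have Q0: "?Q \<ge> 0" by simp
        have "(\<integral>\<^sup>+x. ennreal (norm (inv_fourier (?b j) x) powr p) \<partial>lborel) \<le>
          ennreal ((?c * sqrt (?Q * (2 * R (Suc j)) ^ ?n)) powr (p - 2) * ?Q)"
          using p by (intro ball_supported_inv_fourier_Lp[OF mb _ supp R_nonneg iQ]) simp_all
        also have "\<dots> \<le> ennreal ((?c * sqrt ((E * u ^ j) * (2 * R (Suc j)) ^ ?n)) powr (p - 2) * (E * u ^ j))"
        proof (intro ennreal_leI mult_mono powr_mono2 mult_left_mono real_sqrt_le_mono mult_right_mono Q)
          show "0 \<le> (2 * R (Suc j)) ^ ?n" using R_nonneg[of "Suc j"] by simp
          show "0 \<le> ?c * sqrt (?Q * (2 * R (Suc j)) ^ ?n)"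
            using Q0 R_nonneg[of "Suc j"] by (intro mult_nonneg_nonneg real_sqrt_ge_zero) (auto simp: less_imp_le)
          show "0 \<le> E * u ^ j" using E u by simp
        qed (use p Q0 R_nonneg[of "Suc j"] in \<open>auto simp: less_imp_le\<close>)
        also have "(?c * sqrt ((E * u ^ j) * (2 * R (Suc j)) ^ ?n)) powr (p - 2) * (E * u ^ j) = D * q ^ j"
        proof -
          let ?v = "u * 2 ^ ?n"
          have v: "?v > 0" using u by simp
          have "(E * u ^ j) * (2 * R (Suc j)) ^ ?n = (E * 2 ^ ?n) * ?v ^ j"
            by (simp add: RS power_mult_distrib mult_ac flip: power_mult)
          moreover have "sqrt (?v ^ j) = (?v powr (1/2)) ^ j"
            using v by (simp add: real_sqrt_power powr_half_sqrt)
          ultimately have e1: "?c * sqrt ((E * u ^ j) * (2 * R (Suc j)) ^ ?n) = (?c * sqrt (E * 2 ^ ?n)) * (?v powr (1/2)) ^ j"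
            by (simp only: real_sqrt_mult mult.assoc)
          have e2: "((x powr (1/2)) ^ j) powr (p - 2) = (x powr ((p - 2) / 2)) ^ j" if "x > 0" for x :: real
            using that by (simp add: powr_powr mult.commute flip: powr_realpow)
          have "(?c * sqrt ((E * u ^ j) * (2 * R (Suc j)) ^ ?n)) powr (p - 2) =
              (?c * sqrt (E * 2 ^ ?n)) powr (p - 2) * (?v powr ((p - 2) / 2)) ^ j"
            unfolding e1 using e2[OF v] by (simp only: powr_mult)
          then show ?thesis by (simp add: D_def q_def power_mult_distrib mult_ac)
        qed
        finally show ?thesis .
      qed
    qed (use at R0 monoR R_top p q0 q1 D0 in auto)
    have "Lp_fun_norm p w \<le> (D * K) powr (1 / p)"
      unfolding Lp_fun_norm_def using w(3) p by (intro powr_mono2) auto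
    also have "D = c1 * sqrt A powr p"
    proof (cases "A = 0")
      case False
      then have "sqrt A > 0" using A by simp
      have "D = (?c * sqrt (4 powr s * 2 ^ ?n) * sqrt A) powr (p - 2) * (4 powr s * A)"
        by (simp add: D_def E_def real_sqrt_mult mult_ac)
      also have "\<dots> = c1 * (sqrt A powr (p - 2) * A)"
        using A by (simp add: c1_def powr_mult)
      also have "sqrt A powr (p - 2) * A = sqrt A powr (p - 2) * sqrt A powr 2"
        using A by simp
      also have "\<dots> = sqrt A powr p"
        by (simp only: powr_add[symmetric] diff_add_cancel)
      finally show ?thesis .
    qed (simp add: D_def E_def)
    also have "(c1 * sqrt A powr p * K) powr (1 / p) = ((c1 * K) * sqrt A powr p) powr (1 / p)"
      by (simp add: mult_ac)
    also have "\<dots> = C * sqrt A"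
      using c1 K A p by (simp add: powr_mult C_def powr_powr)
    finally show ?thesis using w unfolding A_def by blast
  qed
  moreover have "C \<ge> 0" by (simp add: C_def)
  ultimately show ?thesis by (intro exI[of _ C]) blast
qed

section \<open>Representatives in the homogeneous Sobolev and Lebesgue spaces\<close>

lemma integral_fourier:
  fixes \<psi> :: "real ^ 'n::finite \<Rightarrow> complex"
  assumes "\<psi> \<in> schwartz_space"
  shows "of_real (fourier_const TYPE('n)) * (LINT \<xi>|lborel. fourier \<psi> \<xi>) = \<psi> 0"
  using fun_cong[OF inv_fourier_fourier[OF assms], of 0] by (simp add: inv_fourier_altdef)

lemma fourier_L2_exists:
  fixes g :: "real ^ 'n::finite \<Rightarrow> complex"
  assumes g: "g \<in> Lp_functions 2"
  obtains b where "b \<in> Lp_functions 2" and "dist_of b = fourier_dist (dist_of g)"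
    and "Lp_fun_norm 2 b \<le> L2_const * Lp_fun_norm 2 g"
proof -
  have [measurable]: "g \<in> borel_measurable borel" using g by (simp add: Lp_functions_2_iff)
  have "(\<lambda>x. cnj (g x)) \<in> Lp_functions 2"
    using g by (simp add: Lp_functions_2_iff)
  from inv_fourier_L2_exists[OF this] obtain b where b: "b \<in> Lp_functions 2"
    and db: "dist_of b = inv_fourier_dist (dist_of (\<lambda>x. cnj (g x)))"
    and nb: "Lp_fun_norm 2 b \<le> L2_const * Lp_fun_norm 2 (\<lambda>x. cnj (g x))"
    .
  have [measurable]: "b \<in> borel_measurable borel" using b by (simp add: Lp_functions_2_iff)
  have "(LINT x|lborel. cnj (b x) * \<phi> x) = (LINT x|lborel. g x * fourier \<phi> x)"
    if S: "\<phi> \<in> schwartz_space" for \<phi>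
  proof -
    note cS = schwartz_cnj[OF S]
    have "(LINT x|lborel. b x * cnj (\<phi> x)) = (LINT x|lborel. cnj (g x) * inv_fourier (\<lambda>x. cnj (\<phi> x)) x)"
      using fun_cong[OF db, of "\<lambda>x. cnj (\<phi> x)"] cS inv_fourier_schwartz[OF cS]
      by (simp add: dist_of_def inv_fourier_dist_def)
    also have "\<dots> = cnj (LINT x|lborel. g x * fourier \<phi> x)"
      by (simp add: inv_fourier_conv_fourier flip: Bochner_Integration.integral_cnj)
    finally have "cnj (LINT x|lborel. b x * cnj (\<phi> x)) = (LINT x|lborel. g x * fourier \<phi> x)"
      by simp
    then show ?thesis by (simp flip: Bochner_Integration.integral_cnj)
  qed
  then have "dist_of (\<lambda>x. cnj (b x)) = fourier_dist (dist_of g)"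
    by (intro ext) (simp add: dist_of_def fourier_dist_def fourier_schwartz)
  moreover have "(\<lambda>x. cnj (b x)) \<in> Lp_functions 2"
    using b by (simp add: Lp_functions_2_iff)
  moreover have "Lp_fun_norm 2 (\<lambda>x. cnj (b x)) \<le> L2_const * Lp_fun_norm 2 g"
    using nb by (simp add: Lp_fun_norm_2)
  ultimately show ?thesis using that by blast
qed

lemma tempered_functions_integrable:
  "h \<in> tempered_functions \<Longrightarrow> \<phi> \<in> schwartz_space \<Longrightarrow> integrable lborel (\<lambda>x. h x * \<phi> x)"
  by (simp add: tempered_functions_def)

lemma tempered_functions_mult:
  fixes h :: "real ^ 'n::finite \<Rightarrow> complex"
  assumes h: "h \<in> tempered_functions" and m [measurable]: "m \<in> borel_measurable borel"
    and bd: "\<And>\<xi>. norm (m \<xi>) \<le> B * (1 + (norm \<xi>)\<^sup>2)"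
  shows "(\<lambda>\<xi>. m \<xi> * h \<xi>) \<in> tempered_functions"
proof -
  have [measurable]: "h \<in> borel_measurable borel" using h by (simp add: tempered_functions_def)
  have "integrable lborel (\<lambda>\<xi>. m \<xi> * h \<xi> * \<phi> \<xi>)" if S: "\<phi> \<in> schwartz_space" for \<phi>
  proof (rule Bochner_Integration.integrable_bound)
    note [measurable] = schwartz_measurable[OF S]
    show "integrable lborel (\<lambda>\<xi>. B * (norm (h \<xi> * \<phi> \<xi>) + norm (h \<xi> * (of_real ((norm \<xi>)\<^sup>2) * \<phi> \<xi>))))"
    proof (intro integrable_mult_right Bochner_Integration.integrable_add integrable_norm)
      show "integrable lborel (\<lambda>\<xi>. h \<xi> * \<phi> \<xi>)"
        by (rule tempered_functions_integrable[OF h S])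
      show "integrable lborel (\<lambda>\<xi>. h \<xi> * (of_real ((norm \<xi>)\<^sup>2) * \<phi> \<xi>))"
        by (rule tempered_functions_integrable[OF h schwartz_norm_square_mult[OF S]])
    qed
    have "norm (m \<xi> * h \<xi> * \<phi> \<xi>) \<le> B * (norm (h \<xi> * \<phi> \<xi>) + norm (h \<xi> * (of_real ((norm \<xi>)\<^sup>2) * \<phi> \<xi>)))" for \<xi>
    proof -
      have "norm (m \<xi> * h \<xi> * \<phi> \<xi>) \<le> B * (1 + (norm \<xi>)\<^sup>2) * norm (h \<xi> * \<phi> \<xi>)"
        unfolding mult.assoc[of "m \<xi>"] norm_mult[of "m \<xi>"] by (intro mult_right_mono bd) simp
      then show ?thesis by (simp add: norm_mult norm_power algebra_simps)
    qed
    then show "AE \<xi> in lborel. norm (m \<xi> * h \<xi> * \<phi> \<xi>) \<le> norm (B * (norm (h \<xi> * \<phi> \<xi>) + norm (h \<xi> * (of_real ((norm \<xi>)\<^sup>2) * \<phi> \<xi>))))"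
      by (intro AE_I2) (simp add: order_trans[OF _ abs_ge_self])
    show "(\<lambda>\<xi>. m \<xi> * h \<xi> * \<phi> \<xi>) \<in> borel_measurable lborel" by measurable
  qed
  then show ?thesis by (simp add: tempered_functions_def)
qed

lemma norm_powr_le: "norm \<xi> powr s \<le> 1 + (norm \<xi>)\<^sup>2" if "0 < s" "s < 1" for \<xi> :: "real ^ 'n::finite"
proof (cases "norm \<xi> \<le> 1")
  case True
  then have "norm \<xi> powr s \<le> 1" using that by (intro powr_le1) auto
  then show ?thesis by (simp add: add_increasing2)
next
  case False
  then have "norm \<xi> powr s \<le> norm \<xi> powr 2" using that by (intro powr_mono) auto
  then show ?thesis using False by simp
qed

lemma frac_symbol_tempered:
  fixes h :: "real ^ 'n::finite \<Rightarrow> complex"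
  assumes "h \<in> tempered_functions" "0 < s" "s < 1"
  shows "(\<lambda>\<xi>. of_real (norm \<xi> powr s) * h \<xi>) \<in> tempered_functions"
  by (rule tempered_functions_mult[where B = 1]) (use assms norm_powr_le in auto)

text \<open>
  The constant \<open>c\<close> contributes a multiple of the Dirac mass at the origin to the transform of \<open>T\<close>.
\<close>

lemma fourier_dist_minus_const_eq:
  fixes T :: "'n::finite functional"
  assumes eq: "fourier_dist (\<lambda>\<phi>. T \<phi> - dist_of (\<lambda>_. c) \<phi>) = dist_of h" and S: "\<psi> \<in> schwartz_space"
  shows "T (fourier \<psi>) = (LINT \<xi>|lborel. h \<xi> * \<psi> \<xi>) + c / of_real (fourier_const TYPE('n)) * \<psi> 0"
proof -
  have "T (fourier \<psi>) - (LINT \<xi>|lborel. c * fourier \<psi> \<xi>) = (LINT \<xi>|lborel. h \<xi> * \<psi> \<xi>)"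
    using fun_cong[OF eq, of \<psi>] S fourier_schwartz[OF S] by (simp add: fourier_dist_def dist_of_def)
  moreover have "(LINT \<xi>|lborel. c * fourier \<psi> \<xi>) = c * (LINT \<xi>|lborel. fourier \<psi> \<xi>)"
    by (rule integral_mult_right_zero)
  moreover have "of_real (fourier_const TYPE('n)) \<noteq> (0::complex)"
    using fourier_const_pos[where ?'n = 'n] by (simp only: of_real_eq_0_iff)
  then have "(LINT \<xi>|lborel. fourier \<psi> \<xi>) = \<psi> 0 / of_real (fourier_const TYPE('n))"
    using integral_fourier[OF S] by (simp add: field_simps)
  ultimately show ?thesis by (simp add: algebra_simps)
qed

lemma Lp_fun_norm_cong_AE:
  assumes "f \<in> borel_measurable borel" "g \<in> borel_measurable borel" "AE x in lborel. f x = g x"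
  shows "Lp_fun_norm p f = Lp_fun_norm p g"
proof -
  note [measurable] = assms(1,2)
  have "(LINT x|lborel. norm (f x) powr p) = (LINT x|lborel. norm (g x) powr p)"
    by (rule Bochner_Integration.integral_cong_AE) (use assms in auto)
  then show ?thesis by (simp add: Lp_fun_norm_def)
qed

text \<open>
  Two pairs \<open>(c, h)\<close> for the same \<open>T\<close> can differ only by Dirac masses. Test functions of the form \<open>|\<xi>|\<^sup>2 \<phi>\<close>
  do not see these, so the functions \<open>h\<close> agree almost everywhere.
\<close>

lemma frac_deriv_unique:
  fixes T :: "'n::finite functional"
  assumes s: "0 < s" "s < 1"
    and g1: "g1 \<in> Lp_functions 2" "is_frac_deriv s T g1" and g2: "g2 \<in> Lp_functions 2" "is_frac_deriv s T g2"
  shows "Lp_fun_norm 2 g1 = Lp_fun_norm 2 g2"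
proof -
  obtain c1 h1 where h1: "h1 \<in> tempered_functions"
      "fourier_dist (\<lambda>\<phi>. T \<phi> - dist_of (\<lambda>_. c1) \<phi>) = dist_of h1"
      "dist_of g1 = inv_fourier_dist (dist_of (\<lambda>\<xi>. complex_of_real (norm \<xi> powr s) * h1 \<xi>))"
    using g1(2) unfolding is_frac_deriv_def by blast
  obtain c2 h2 where h2: "h2 \<in> tempered_functions"
      "fourier_dist (\<lambda>\<phi>. T \<phi> - dist_of (\<lambda>_. c2) \<phi>) = dist_of h2"
      "dist_of g2 = inv_fourier_dist (dist_of (\<lambda>\<xi>. complex_of_real (norm \<xi> powr s) * h2 \<xi>))"
    using g2(2) unfolding is_frac_deriv_def by blast
  let ?sq = "\<lambda>\<xi>::real ^ 'n. complex_of_real ((norm \<xi>)\<^sup>2)"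
  have sqt: "(\<lambda>\<xi>. ?sq \<xi> * h \<xi>) \<in> tempered_functions" if "h \<in> tempered_functions" for h
    by (rule tempered_functions_mult[OF that, where B = 1]) (auto simp: norm_power)
  have "dist_of (\<lambda>\<xi>. ?sq \<xi> * h1 \<xi>) = dist_of (\<lambda>\<xi>. ?sq \<xi> * h2 \<xi>)"
  proof
    fix \<phi> :: "real ^ 'n \<Rightarrow> complex"
    show "dist_of (\<lambda>\<xi>. ?sq \<xi> * h1 \<xi>) \<phi> = dist_of (\<lambda>\<xi>. ?sq \<xi> * h2 \<xi>) \<phi>"
    proof (cases "\<phi> \<in> schwartz_space")
      case True
      from schwartz_norm_square_mult[OF True] have S: "(\<lambda>\<xi>. ?sq \<xi> * \<phi> \<xi>) \<in> schwartz_space" .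
      show ?thesis
        using fourier_dist_minus_const_eq[OF h1(2) S] fourier_dist_minus_const_eq[OF h2(2) S] True
        by (simp add: dist_of_def mult_ac)
    qed (simp add: dist_of_def)
  qed
  from dist_of_eq_imp_AE_eq[OF sqt[OF h1(1)] sqt[OF h2(1)] this]
  have "AE \<xi> in lborel. ?sq \<xi> * h1 \<xi> = ?sq \<xi> * h2 \<xi>" .
  then have AEh: "AE \<xi> in lborel. h1 \<xi> = h2 \<xi>"
    using AE_lborel_singleton[of "0 :: real ^ 'n"] by eventually_elim simp
  have [measurable]: "h1 \<in> borel_measurable borel" "h2 \<in> borel_measurable borel"
    using h1(1) h2(1) by (auto simp: tempered_functions_def)
  have "dist_of (\<lambda>\<xi>. complex_of_real (norm \<xi> powr s) * h1 \<xi>) = dist_of (\<lambda>\<xi>. complex_of_real (norm \<xi> powr s) * h2 \<xi>)"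
  proof
    fix \<phi> :: "real ^ 'n \<Rightarrow> complex"
    show "dist_of (\<lambda>\<xi>. complex_of_real (norm \<xi> powr s) * h1 \<xi>) \<phi> = dist_of (\<lambda>\<xi>. complex_of_real (norm \<xi> powr s) * h2 \<xi>) \<phi>"
    proof (cases "\<phi> \<in> schwartz_space")
      case True
      note [measurable] = schwartz_measurable[OF True]
      have "(LINT \<xi>|lborel. complex_of_real (norm \<xi> powr s) * h1 \<xi> * \<phi> \<xi>) = (LINT \<xi>|lborel. complex_of_real (norm \<xi> powr s) * h2 \<xi> * \<phi> \<xi>)"
        by (rule Bochner_Integration.integral_cong_AE) (use AEh in auto)
      then show ?thesis using True by (simp add: dist_of_def)
    qed (simp add: dist_of_def)
  qed
  then have "dist_of g1 = dist_of g2" using h1(3) h2(3) by simp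
  then have "AE x in lborel. g1 x = g2 x"
    using g1(1) g2(1) by (intro dist_of_eq_imp_AE_eq Lp_functions_tempered[of 2]) auto
  then show ?thesis
    using g1(1) g2(1) by (intro Lp_fun_norm_cong_AE) (auto simp: Lp_functions_2_iff)
qed

text \<open>
  The function \<open>|\<xi>|\<^sup>s h\<close> is known only through the distribution that it defines. It is
  square integrable because it represents the Fourier transform of \<open>g\<close>, and the \<open>L\<^sup>2\<close> function that
  represents this transform is unique.
\<close>

lemma frac_deriv_symbol_L2:
  fixes T :: "'n::finite functional"
  assumes s: "0 < s" "s < 1" and g: "g \<in> Lp_functions 2" "is_frac_deriv s T g"
  obtains c h where "h \<in> tempered_functions" and "fourier_dist (\<lambda>\<phi>. T \<phi> - dist_of (\<lambda>_. c) \<phi>) = dist_of h"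
    and "(\<lambda>\<xi>. of_real (norm \<xi> powr s) * h \<xi>) \<in> Lp_functions 2"
    and "Lp_fun_norm 2 (\<lambda>\<xi>. of_real (norm \<xi> powr s) * h \<xi>) \<le> L2_const * Lp_fun_norm 2 g"
proof -
  obtain c h where h: "h \<in> tempered_functions"
    and fT: "fourier_dist (\<lambda>\<phi>. T \<phi> - dist_of (\<lambda>_. c) \<phi>) = dist_of h"
    and dg: "dist_of g = inv_fourier_dist (dist_of (\<lambda>\<xi>. complex_of_real (norm \<xi> powr s) * h \<xi>))"
    using g(2) unfolding is_frac_deriv_def by blast
  have mh [measurable]: "h \<in> borel_measurable borel"
    using h by (simp add: tempered_functions_def)
  define a where "a = (\<lambda>\<xi>. complex_of_real (norm \<xi> powr s) * h \<xi>)"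
  have ma [measurable]: "a \<in> borel_measurable borel" unfolding a_def by measurable
  have ta: "a \<in> tempered_functions" unfolding a_def by (rule frac_symbol_tempered[OF h s])
  obtain b where b: "b \<in> Lp_functions 2" "dist_of b = fourier_dist (dist_of g)"
    "Lp_fun_norm 2 b \<le> L2_const * Lp_fun_norm 2 g"
    by (rule fourier_L2_exists[OF g(1)])
  have mb [measurable]: "b \<in> borel_measurable borel" using b by (simp add: Lp_functions_2_iff)
  have "dist_of b = dist_of a"
  proof
    fix \<phi> :: "real ^ 'n \<Rightarrow> complex"
    show "dist_of b \<phi> = dist_of a \<phi>"
    proof (cases "\<phi> \<in> schwartz_space")
      case True
      then show ?thesis
        unfolding b(2) dg a_def[symmetric]
        by (simp add: fourier_dist_def inv_fourier_dist_def fourier_schwartz inv_fourier_fourier)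
    qed (simp add: dist_of_def)
  qed
  then have ba: "AE x in lborel. b x = a x"
    by (intro dist_of_eq_imp_AE_eq Lp_functions_tempered[of 2] b ta) auto
  have aL: "a \<in> Lp_functions 2"
  proof -
    have "integrable lborel (\<lambda>x. (norm (a x))\<^sup>2) \<longleftrightarrow> integrable lborel (\<lambda>x. (norm (b x))\<^sup>2)"
      by (rule integrable_cong_AE) (use ba in auto)
    then show ?thesis using b(1) by (simp add: Lp_functions_2_iff)
  qed
  have na: "Lp_fun_norm 2 a \<le> L2_const * Lp_fun_norm 2 g"
    using Lp_fun_norm_cong_AE[OF mb ma ba, of 2] b(3) by simp
  show ?thesis by (rule that[OF h fT aL[unfolded a_def] na[unfolded a_def]])
qed

lemma hom_sobolev_norm_eq:
  assumes s: "0 < s" "s < 1" and g: "g \<in> Lp_functions 2" "is_frac_deriv s T g"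
  shows "hom_sobolev_norm s T = Lp_fun_norm 2 g"
proof -
  let ?g = "SOME g. g \<in> Lp_functions 2 \<and> is_frac_deriv s T g"
  have "?g \<in> Lp_functions 2 \<and> is_frac_deriv s T ?g"
    by (rule someI[of _ g]) (use g in blast)
  then show ?thesis
    unfolding hom_sobolev_norm_def by (intro frac_deriv_unique[OF s, of _ T] g) auto
qed

lemma Lp_norm_eq:
  fixes f :: "real ^ 'n::finite \<Rightarrow> complex"
  assumes p: "p \<ge> 1" and f: "f \<in> Lp_functions p"
  shows "Lp_norm p (dist_of f) = Lp_fun_norm p f"
proof -
  let ?f = "SOME f'. f' \<in> Lp_functions p \<and> dist_of f = dist_of f'"
  have *: "?f \<in> Lp_functions p \<and> dist_of f = dist_of ?f"
    by (rule someI[of _ f]) (use f in blast)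
  then have "AE x in lborel. ?f x = f x"
    by (intro dist_of_eq_imp_AE_eq Lp_functions_tempered[OF p] f) auto
  then show ?thesis
    unfolding Lp_norm_def using * f by (intro Lp_fun_norm_cong_AE) (auto simp: Lp_functions_def)
qed

text \<open>
  A crude form of Minkowski's inequality; constants are irrelevant in what follows.
\<close>

lemma Lp_add:
  fixes f g :: "real ^ 'n::finite \<Rightarrow> complex"
  assumes p: "p \<ge> 1" and f: "f \<in> Lp_functions p" and g: "g \<in> Lp_functions p"
  shows "(\<lambda>x. f x + g x) \<in> Lp_functions p"
    and "Lp_fun_norm p (\<lambda>x. f x + g x) \<le> 4 * (Lp_fun_norm p f + Lp_fun_norm p g)"
proof -
  have [measurable]: "f \<in> borel_measurable borel" "g \<in> borel_measurable borel"
    and i: "integrable lborel (\<lambda>x. norm (f x) powr p)" "integrable lborel (\<lambda>x. norm (g x) powr p)"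
    using f g by (auto simp: Lp_functions_def)
  let ?X = "LINT x|lborel. norm (f x) powr p" and ?Y = "LINT x|lborel. norm (g x) powr p"
  have pw: "norm (f x + g x) powr p \<le> 2 powr p * (norm (f x) powr p + norm (g x) powr p)" for x
  proof -
    have "norm (f x + g x) \<le> 2 * max (norm (f x)) (norm (g x))"
      using norm_triangle_ineq[of "f x" "g x"] by linarith
    then have "norm (f x + g x) powr p \<le> (2 * max (norm (f x)) (norm (g x))) powr p"
      using p by (intro powr_mono2) auto
    also have "\<dots> = 2 powr p * (max (norm (f x)) (norm (g x))) powr p" by (rule powr_mult)
    also have "\<dots> \<le> 2 powr p * (norm (f x) powr p + norm (g x) powr p)"
      by (intro mult_left_mono) (auto simp: max_def)
    finally show ?thesis .
  qed
  have i2: "integrable lborel (\<lambda>x. 2 powr p * (norm (f x) powr p + norm (g x) powr p))"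
    using i by (intro integrable_mult_right Bochner_Integration.integrable_add)
  have i3: "integrable lborel (\<lambda>x. norm (f x + g x) powr p)"
    by (rule Bochner_Integration.integrable_bound[OF i2])
       (auto intro!: AE_I2 order_trans[OF pw] abs_ge_self)
  show "(\<lambda>x. f x + g x) \<in> Lp_functions p"
    using i3 by (simp add: Lp_functions_def)
  have XY: "?X \<ge> 0" "?Y \<ge> 0" by (auto intro!: Bochner_Integration.integral_nonneg)
  have "(LINT x|lborel. norm (f x + g x) powr p) \<le> (LINT x|lborel. 2 powr p * (norm (f x) powr p + norm (g x) powr p))"
    by (intro integral_mono i2 i3 pw)
  also have "\<dots> = 2 powr p * (?X + ?Y)" using i by simp
  also have "\<dots> \<le> 2 powr p * (2 powr p * max ?X ?Y)"
  proof (intro mult_left_mono)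
    have "2 * max ?X ?Y \<le> 2 powr p * max ?X ?Y"
      using powr_mono[of 1 p 2] p XY by (intro mult_right_mono) (auto simp: le_max_iff_disj)
    then show "?X + ?Y \<le> 2 powr p * max ?X ?Y" by linarith
  qed simp
  finally have "(LINT x|lborel. norm (f x + g x) powr p) \<le> 2 powr p * (2 powr p * max ?X ?Y)" .
  then have "Lp_fun_norm p (\<lambda>x. f x + g x) \<le> (2 powr p * (2 powr p * max ?X ?Y)) powr (1 / p)"
    unfolding Lp_fun_norm_def using p by (intro powr_mono2) auto
  also have "\<dots> = 4 * max ?X ?Y powr (1 / p)"
    using p by (simp add: powr_mult powr_powr)
  also have "\<dots> \<le> 4 * (?X powr (1 / p) + ?Y powr (1 / p))"
    by (intro mult_left_mono) (auto simp: max_def)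
  finally show "Lp_fun_norm p (\<lambda>x. f x + g x) \<le> 4 * (Lp_fun_norm p f + Lp_fun_norm p g)"
    by (simp only: Lp_fun_norm_def)
qed

section \<open>The Schroedinger group on distributions\<close>

abbreviation (input) schroedinger_symbol :: "real \<Rightarrow> real ^ 'n::finite \<Rightarrow> complex" where
  "schroedinger_symbol t \<xi> \<equiv> cis (- (t * (norm \<xi>)\<^sup>2))"

lemma schroedinger_apply:
  "schroedinger t T \<phi> =
    (if \<phi> \<in> schwartz_space then T (fourier (\<lambda>\<xi>. schroedinger_symbol t \<xi> * inv_fourier \<phi> \<xi>)) else 0)"
  by (simp add: schroedinger_def inv_fourier_dist_def mult_dist_def fourier_dist_def
      inv_fourier_schwartz schwartz_schroedinger_mult)

lemma schroedinger_test_schwartz: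
  "\<phi> \<in> schwartz_space \<Longrightarrow> fourier (\<lambda>\<xi>. schroedinger_symbol t \<xi> * inv_fourier \<phi> \<xi>) \<in> schwartz_space"
  by (intro fourier_schwartz schwartz_schroedinger_mult inv_fourier_schwartz)

lemma schroedinger_lincomb:
  "schroedinger t (\<lambda>\<phi>. a * u \<phi> + b * v \<phi>) = (\<lambda>\<phi>. a * schroedinger t u \<phi> + b * schroedinger t v \<phi>)"
  by (rule ext) (simp add: schroedinger_apply)

lemma schroedinger_0:
  assumes "u \<in> tempered_distributions"
  shows "schroedinger 0 u = u"
  using assms by (intro ext) (auto simp: schroedinger_apply fourier_inv_fourier tempered_distributions_def)

lemma schroedinger_add: "schroedinger (t + r) u = schroedinger t (schroedinger r u)"
proof
  fix \<phi> :: "real ^ 'a \<Rightarrow> complex"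
  show "schroedinger (t + r) u \<phi> = schroedinger t (schroedinger r u) \<phi>"
  proof (cases "\<phi> \<in> schwartz_space")
    case True
    let ?\<psi> = "\<lambda>\<xi>. schroedinger_symbol t \<xi> * inv_fourier \<phi> \<xi>"
    have S: "?\<psi> \<in> schwartz_space"
      by (intro schwartz_schroedinger_mult inv_fourier_schwartz True)
    have "schroedinger t (schroedinger r u) \<phi> = u (fourier (\<lambda>\<xi>. schroedinger_symbol r \<xi> * inv_fourier (fourier ?\<psi>) \<xi>))"
      using True schroedinger_test_schwartz[OF True, of t] by (simp add: schroedinger_apply)
    also have "\<dots> = u (fourier (\<lambda>\<xi>. schroedinger_symbol r \<xi> * ?\<psi> \<xi>))"
      by (simp only: inv_fourier_fourier[OF S])
    also have "(\<lambda>\<xi>::real ^ 'a. schroedinger_symbol r \<xi> * ?\<psi> \<xi>) = (\<lambda>\<xi>. schroedinger_symbol (t + r) \<xi> * inv_fourier \<phi> \<xi>)"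
      by (simp add: cis_mult algebra_simps flip: mult.assoc)
    finally show ?thesis using True by (simp add: schroedinger_apply)
  qed (simp add: schroedinger_apply)
qed

text \<open>
  The symbol equals 1 at the origin. Hence the Dirac mass carried by the transform of \<open>T\<close> is the same
  before and after the evolution, and the difference has a function as its transform.
\<close>

lemma schroedinger_minus_id:
  fixes T :: "'n::finite functional"
  assumes h: "h \<in> tempered_functions" and T: "fourier_dist (\<lambda>\<phi>. T \<phi> - dist_of (\<lambda>_. c) \<phi>) = dist_of h"
    and S: "\<phi> \<in> schwartz_space"
  shows "schroedinger t T \<phi> - T \<phi> = (LINT \<xi>|lborel. (schroedinger_symbol t \<xi> - 1) * h \<xi> * inv_fourier \<phi> \<xi>)"
proof -
  note IS = inv_fourier_schwartz[OF S]
  note MS = schwartz_schroedinger_mult[OF IS, of t]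
  have "integrable lborel (\<lambda>\<xi>. h \<xi> * (schroedinger_symbol t \<xi> * inv_fourier \<phi> \<xi>))" "integrable lborel (\<lambda>\<xi>. h \<xi> * inv_fourier \<phi> \<xi>)"
    using h IS MS by (auto simp: tempered_functions_def)
  moreover have "T \<phi> = T (fourier (inv_fourier \<phi>))" by (simp add: fourier_inv_fourier[OF S])
  ultimately have "schroedinger t T \<phi> - T \<phi> =
      (LINT \<xi>|lborel. h \<xi> * (schroedinger_symbol t \<xi> * inv_fourier \<phi> \<xi>) - h \<xi> * inv_fourier \<phi> \<xi>)"
    using fourier_dist_minus_const_eq[OF T IS] fourier_dist_minus_const_eq[OF T MS] S
    by (simp add: schroedinger_apply)
  then show ?thesis by (simp add: algebra_simps)
qed

lemma schroedinger_fourier_dist: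
  fixes T :: "'n::finite functional"
  assumes T: "fourier_dist (\<lambda>\<phi>. T \<phi> - dist_of (\<lambda>_. c) \<phi>) = dist_of h"
  shows "fourier_dist (\<lambda>\<phi>. schroedinger t T \<phi> - dist_of (\<lambda>_. c) \<phi>) = dist_of (\<lambda>\<xi>. schroedinger_symbol t \<xi> * h \<xi>)"
proof
  fix \<phi> :: "real ^ 'n \<Rightarrow> complex"
  show "fourier_dist (\<lambda>\<phi>. schroedinger t T \<phi> - dist_of (\<lambda>_. c) \<phi>) \<phi> = dist_of (\<lambda>\<xi>. schroedinger_symbol t \<xi> * h \<xi>) \<phi>"
  proof (cases "\<phi> \<in> schwartz_space")
    case True
    note MS = schwartz_schroedinger_mult[OF True, of t]
    have "T (fourier \<phi>) - dist_of (\<lambda>_. c) (fourier \<phi>) = (LINT \<xi>|lborel. h \<xi> * \<phi> \<xi>)"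
      using fun_cong[OF T, of \<phi>] True by (simp add: fourier_dist_def dist_of_def)
    then show ?thesis
      using fourier_dist_minus_const_eq[OF T MS] fourier_dist_minus_const_eq[OF T True] True
      by (simp add: fourier_dist_def schroedinger_apply fourier_schwartz inv_fourier_fourier)
         (simp add: dist_of_def mult_ac)
  qed (simp add: fourier_dist_def dist_of_def)
qed

text \<open>
  An interpolation between the bounds \<open>2\<close> and \<open>|t| |\<xi>|\<^sup>2\<close>. The exponent is chosen such that exactly the
  weight \<open>|\<xi>|\<^sup>2\<^sup>s\<close> of the homogeneous Sobolev norm appears: this makes \<open>e\<^sup>i\<^sup>t\<^sup>\<Delta>u - u\<close> an
  \<open>L\<^sup>2\<close> function, although \<open>u\<close> itself need not be square integrable.
\<close>

lemma norm_schroedinger_symbol_minus_1: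
  assumes s: "0 < s" "s < 1"
  shows "(norm (schroedinger_symbol t \<xi> - 1))\<^sup>2 \<le> 4 * (\<bar>t\<bar> powr s * norm \<xi> powr (2 * s))"
proof -
  let ?\<theta> = "\<bar>t\<bar> * (norm \<xi>)\<^sup>2"
  have a: "norm (schroedinger_symbol t \<xi> - 1) \<le> ?\<theta>"
    using iexp_approx1[of "- (t * (norm \<xi>)\<^sup>2)" 0] by (simp add: cis_conv_exp abs_mult)
  have b: "norm (schroedinger_symbol t \<xi> - 1) \<le> 2"
    using norm_triangle_ineq4[of "schroedinger_symbol t \<xi>" 1] by simp
  have "(norm (schroedinger_symbol t \<xi> - 1))\<^sup>2 \<le> 4 * ?\<theta> powr s"
  proof (cases "?\<theta> \<le> 1")
    case True
    have "(norm (schroedinger_symbol t \<xi> - 1))\<^sup>2 \<le> ?\<theta>\<^sup>2" by (intro power_mono a) auto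
    also have "\<dots> = ?\<theta> powr 2" by simp
    also have "\<dots> \<le> ?\<theta> powr s" using True s by (intro powr_mono') auto
    finally show ?thesis by (rule order_trans) simp
  next
    case False
    have "(norm (schroedinger_symbol t \<xi> - 1))\<^sup>2 \<le> 2\<^sup>2" by (intro power_mono b) auto
    moreover have "1 \<le> ?\<theta> powr s" using False s by (intro ge_one_powr_ge_zero) auto
    ultimately show ?thesis by simp
  qed
  also have "?\<theta> powr s = \<bar>t\<bar> powr s * norm \<xi> powr (2 * s)"
  proof -
    have "((norm \<xi>)\<^sup>2) powr s = (norm \<xi> powr 2) powr s" by simp
    then show ?thesis by (simp only: powr_mult powr_powr)
  qed
  finally show ?thesis .
qed

section \<open>The group on the intersection space\<close>

text \<open>
  The inhomogeneous Sobolev norm of \<open>e\<^sup>i\<^sup>t\<^sup>\<Delta>u - u\<close>, computed on the Fourier side; \<open>h\<close> is the transform of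
  \<open>u\<close> away from the origin.
\<close>

definition defect_norm :: "real \<Rightarrow> (real ^ 'n::finite \<Rightarrow> complex) \<Rightarrow> real \<Rightarrow> real" where
  "defect_norm s h t =
    sqrt (LINT \<xi>|lborel. (1 + norm \<xi> powr (2 * s)) * (norm ((schroedinger_symbol t \<xi> - 1) * h \<xi>))\<^sup>2)"

lemma defect_le:
  fixes h :: "real ^ 'n::finite \<Rightarrow> complex"
  assumes s: "0 < s" "s < 1"
  shows "(1 + norm \<xi> powr (2 * s)) * (norm ((schroedinger_symbol t \<xi> - 1) * h \<xi>))\<^sup>2 \<le>
    4 * (2 + \<bar>t\<bar>) * (norm (of_real (norm \<xi> powr s) * h \<xi>))\<^sup>2"
proof -
  let ?m = "(norm (schroedinger_symbol t \<xi> - 1))\<^sup>2"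
  let ?x = "norm \<xi> powr (2 * s)"
  have x: "(norm \<xi> powr s)\<^sup>2 = ?x" unfolding power2_eq_square mult_2 by (rule powr_add[symmetric])
  have "norm (schroedinger_symbol t \<xi> - 1) \<le> 2"
    using norm_triangle_ineq4[of "schroedinger_symbol t \<xi>" 1] by simp
  then have "?m \<le> 2\<^sup>2" by (intro power_mono) auto
  then have "?x * ?m \<le> ?x * 4" by (intro mult_left_mono) auto
  moreover have "?m \<le> 4 * ((1 + \<bar>t\<bar>) * ?x)"
  proof -
    have "\<bar>t\<bar> powr s \<le> 1 + \<bar>t\<bar>"
    proof (cases "\<bar>t\<bar> \<le> 1")
      case True
      then have "\<bar>t\<bar> powr s \<le> 1" using s by (intro powr_le1) auto
      then show ?thesis by simp
    next
      case False
      then have "\<bar>t\<bar> powr s \<le> \<bar>t\<bar> powr 1" using s by (intro powr_mono) auto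
      then show ?thesis by simp
    qed
    then have "4 * (\<bar>t\<bar> powr s * ?x) \<le> 4 * ((1 + \<bar>t\<bar>) * ?x)"
      by (intro mult_left_mono mult_right_mono) auto
    then show ?thesis using norm_schroedinger_symbol_minus_1[OF s, of t \<xi>] by linarith
  qed
  ultimately have "(1 + ?x) * ?m \<le> 4 * (2 + \<bar>t\<bar>) * ?x"
    by (simp add: algebra_simps)
  then have "(1 + ?x) * ?m * (norm (h \<xi>))\<^sup>2 \<le> 4 * (2 + \<bar>t\<bar>) * ?x * (norm (h \<xi>))\<^sup>2"
    by (intro mult_right_mono) auto
  then show ?thesis
    by (simp add: norm_mult power_mult_distrib x mult.assoc)
qed

text \<open>
  For \<open>u\<close> represented by \<open>f\<close> in \<open>L\<^sup>p\<close> and with fractional derivative \<open>g\<close>, the difference \<open>e\<^sup>i\<^sup>t\<^sup>\<Delta>u - u\<close> is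
  represented by a function \<open>w\<close> in \<open>L\<^sup>p\<close>, by the Sobolev embedding, so that \<open>e\<^sup>i\<^sup>t\<^sup>\<Delta>u\<close> is represented by
  \<open>f + w\<close>. The homogeneous Sobolev part is multiplied by a symbol of modulus one on the Fourier side.
  Both the growth bound and the strong continuity are read off from the size of the defect.
\<close>

lemma schroedinger_perturbation:
  fixes s p :: real
  assumes s: "0 < s" "s < min (real CARD('n::finite) / 2) 1"
    and p: "2 < p" "p < 2 * real CARD('n) / (real CARD('n) - 2 * s)"
  shows "\<exists>C>0. \<forall>u\<in>(Z_space s p :: 'n functional set). \<exists>h::real ^ 'n \<Rightarrow> complex. h \<in> borel_measurable borel \<and>
      (\<lambda>\<xi>. of_real (norm \<xi> powr s) * h \<xi>) \<in> Lp_functions 2 \<and>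
      (\<forall>t. schroedinger t u \<in> Z_space s p \<and>
           Z_norm s p (schroedinger t u) \<le> C * (1 + \<bar>t\<bar>) * Z_norm s p u \<and>
           Z_norm s p (\<lambda>\<phi>. schroedinger t u \<phi> - u \<phi>) \<le> C * defect_norm s h t)"
proof -
  have s1: "s < 1" and sn: "2 * s < real CARD('n)" using s by auto
  have p1: "p \<ge> 1" using p by simp
  note L2 = L2_const_nonneg
  obtain CE where CE: "CE \<ge> 0" "\<And>a. a \<in> borel_measurable borel \<Longrightarrow>
     integrable lborel (\<lambda>\<xi>. (1 + norm \<xi> powr (2 * s)) * (norm (a \<xi>))\<^sup>2) \<Longrightarrow>
     \<exists>w::real ^ 'n \<Rightarrow> complex. w \<in> Lp_functions p \<and> dist_of w = inv_fourier_dist (dist_of a) \<and>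
       Lp_fun_norm p w \<le> CE * sqrt (LINT \<xi>|lborel. (1 + norm \<xi> powr (2 * s)) * (norm (a \<xi>))\<^sup>2)"
    using sobolev_embedding[OF s(1) sn p] by blast
  define C where "C = 4 + 16 * (CE * L2_const) + L2_const * L2_const + CE + L2_const"
  have C: "C > 0" using L2 CE(1) unfolding C_def by (simp add: add_pos_nonneg)
  have "\<exists>h::real ^ 'n \<Rightarrow> complex. h \<in> borel_measurable borel \<and>
      (\<lambda>\<xi>. of_real (norm \<xi> powr s) * h \<xi>) \<in> Lp_functions 2 \<and>
      (\<forall>t. schroedinger t u \<in> Z_space s p \<and>
           Z_norm s p (schroedinger t u) \<le> C * (1 + \<bar>t\<bar>) * Z_norm s p u \<and>
           Z_norm s p (\<lambda>\<phi>. schroedinger t u \<phi> - u \<phi>) \<le> C * defect_norm s h t)"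
    if uZ: "u \<in> Z_space s p" for u :: "'n functional"
  proof -
    obtain f where f: "f \<in> Lp_functions p" and u: "u = dist_of f"
      using uZ by (auto simp: Z_space_def Lp_space_def)
    obtain g where g: "g \<in> Lp_functions 2" "is_frac_deriv s u g"
      using uZ by (auto simp: Z_space_def hom_sobolev_space_def)
    have normu: "Z_norm s p u = Lp_fun_norm p f + Lp_fun_norm 2 g"
      by (simp add: Z_norm_def hom_sobolev_norm_eq[OF s(1) s1 g]) (simp add: u Lp_norm_eq[OF p1 f])
    obtain c h where h: "h \<in> tempered_functions"
      and fu: "fourier_dist (\<lambda>\<phi>. u \<phi> - dist_of (\<lambda>_. c) \<phi>) = dist_of h"
      and hL: "(\<lambda>\<xi>. of_real (norm \<xi> powr s) * h \<xi>) \<in> Lp_functions 2"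
      and hn: "Lp_fun_norm 2 (\<lambda>\<xi>. of_real (norm \<xi> powr s) * h \<xi>) \<le> L2_const * Lp_fun_norm 2 g"
      by (rule frac_deriv_symbol_L2[OF s(1) s1 g])
    have mh [measurable]: "h \<in> borel_measurable borel"
      using h by (simp add: tempered_functions_def)
    define a where "a = (\<lambda>\<xi>. complex_of_real (norm \<xi> powr s) * h \<xi>)"
    have aL: "a \<in> Lp_functions 2" and na: "Lp_fun_norm 2 a \<le> L2_const * Lp_fun_norm 2 g"
      using hL hn by (simp_all add: a_def)
    have ma [measurable]: "a \<in> borel_measurable borel" unfolding a_def by measurable
    have ia: "integrable lborel (\<lambda>x. (norm (a x))\<^sup>2)" using aL by (simp add: Lp_functions_2_iff)
    have "schroedinger t u \<in> Z_space s p \<and>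
           Z_norm s p (schroedinger t u) \<le> C * (1 + \<bar>t\<bar>) * Z_norm s p u \<and>
           Z_norm s p (\<lambda>\<phi>. schroedinger t u \<phi> - u \<phi>) \<le> C * defect_norm s h t" for t
    proof -
      define k where "k = (\<lambda>\<xi>::real ^ 'n. (schroedinger_symbol t \<xi> - 1) * h \<xi>)"
      have mk [measurable]: "k \<in> borel_measurable borel" unfolding k_def by measurable
      have tk: "k \<in> tempered_functions"
        unfolding k_def
      proof (rule tempered_functions_mult[OF h, where B = 2])
        show "norm (schroedinger_symbol t \<xi> - 1) \<le> 2 * (1 + (norm \<xi>)\<^sup>2)" for \<xi> :: "real ^ 'n"
          using norm_triangle_ineq4[of "schroedinger_symbol t \<xi>" 1] by (simp add: add_increasing2)
      qed measurable
      define V where "V = (\<lambda>\<phi>. schroedinger t u \<phi> - u \<phi>)"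
      have V_S: "V \<phi> = (LINT \<xi>|lborel. k \<xi> * inv_fourier \<phi> \<xi>)" if "\<phi> \<in> schwartz_space" for \<phi>
        unfolding V_def k_def by (rule schroedinger_minus_id[OF h fu that])
      have V_off: "V \<phi> = 0" if "\<phi> \<notin> schwartz_space" for \<phi>
        using that by (simp add: V_def schroedinger_apply u dist_of_def)
      have V_dist: "V = inv_fourier_dist (dist_of k)"
        by (rule ext) (simp add: V_S V_off inv_fourier_dist_def dist_of_def inv_fourier_schwartz)
      let ?A = "\<lambda>\<xi>. (1 + norm \<xi> powr (2 * s)) * (norm (k \<xi>))\<^sup>2"
      have A_le: "?A \<xi> \<le> 4 * (2 + \<bar>t\<bar>) * (norm (a \<xi>))\<^sup>2" for \<xi>
        unfolding k_def a_def by (rule defect_le[OF s(1) s1])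
      have iA: "integrable lborel ?A"
      proof (rule Bochner_Integration.integrable_bound)
        show "integrable lborel (\<lambda>\<xi>. 4 * (2 + \<bar>t\<bar>) * (norm (a \<xi>))\<^sup>2)"
          using ia by (rule integrable_mult_right)
        show "AE \<xi> in lborel. norm (?A \<xi>) \<le> norm (4 * (2 + \<bar>t\<bar>) * (norm (a \<xi>))\<^sup>2)"
          using A_le by (auto intro!: AE_I2 simp: abs_mult)
      qed measurable
      have dn: "defect_norm s h t = sqrt (LINT \<xi>|lborel. ?A \<xi>)"
        by (simp add: defect_norm_def k_def)
      have dn0: "defect_norm s h t \<ge> 0"
        unfolding dn by (intro real_sqrt_ge_zero Bochner_Integration.integral_nonneg) auto
      have dn_le: "defect_norm s h t \<le> 4 * (1 + \<bar>t\<bar>) * Lp_fun_norm 2 a"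
      proof -
        have "(LINT \<xi>|lborel. ?A \<xi>) \<le> (LINT \<xi>|lborel. 4 * (2 + \<bar>t\<bar>) * (norm (a \<xi>))\<^sup>2)"
          by (intro integral_mono iA integrable_mult_right ia A_le)
        also have "\<dots> = 4 * (2 + \<bar>t\<bar>) * (LINT \<xi>|lborel. (norm (a \<xi>))\<^sup>2)"
          by (rule integral_mult_right_zero)
        also have "\<dots> \<le> (4 * (1 + \<bar>t\<bar>))\<^sup>2 * (LINT \<xi>|lborel. (norm (a \<xi>))\<^sup>2)"
        proof (rule mult_right_mono)
          show "4 * (2 + \<bar>t\<bar>) \<le> (4 * (1 + \<bar>t\<bar>))\<^sup>2"
            by (simp add: power2_eq_square algebra_simps)
        qed simp
        finally have "defect_norm s h t \<le> sqrt ((4 * (1 + \<bar>t\<bar>))\<^sup>2 * (LINT \<xi>|lborel. (norm (a \<xi>))\<^sup>2))"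
          unfolding dn by (rule real_sqrt_le_mono)
        then show ?thesis by (simp add: real_sqrt_mult Lp_fun_norm_2)
      qed
      obtain w where w: "w \<in> Lp_functions p" "dist_of w = inv_fourier_dist (dist_of k)"
        "Lp_fun_norm p w \<le> CE * defect_norm s h t"
        using CE(2)[OF mk iA] unfolding dn by blast
      have Vw: "V = dist_of w" by (simp add: V_dist w(2))
      \<comment> \<open>The symbol of the fractional derivative of the difference.\<close>
      define a' where "a' = (\<lambda>\<xi>. complex_of_real (norm \<xi> powr s) * k \<xi>)"
      have ma' [measurable]: "a' \<in> borel_measurable borel" unfolding a'_def by measurable
      have a'_le: "(norm (a' \<xi>))\<^sup>2 \<le> ?A \<xi>" for \<xi>
      proof -
        have "(norm \<xi> powr s)\<^sup>2 = norm \<xi> powr (2 * s)" unfolding power2_eq_square mult_2 by (rule powr_add[symmetric])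
        then show ?thesis by (simp add: a'_def norm_mult power_mult_distrib algebra_simps)
      qed
      have ia': "integrable lborel (\<lambda>\<xi>. (norm (a' \<xi>))\<^sup>2)"
        by (rule Bochner_Integration.integrable_bound[OF iA])
           (auto intro!: AE_I2 order_trans[OF a'_le] abs_ge_self)
      have a'L: "a' \<in> Lp_functions 2" using ia' by (simp add: Lp_functions_2_iff)
      have na': "Lp_fun_norm 2 a' \<le> defect_norm s h t"
        unfolding Lp_fun_norm_2 dn by (intro real_sqrt_le_mono integral_mono ia' iA a'_le)
      obtain g' where g': "g' \<in> Lp_functions 2" "dist_of g' = inv_fourier_dist (dist_of a')"
        "Lp_fun_norm 2 g' \<le> L2_const * Lp_fun_norm 2 a'"
        by (rule inv_fourier_L2_exists[OF a'L])
      have fracV: "is_frac_deriv s V g'"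
        unfolding is_frac_deriv_def
      proof (intro exI[of _ 0] bexI[of _ k] conjI tk)
        show "fourier_dist (\<lambda>\<phi>. V \<phi> - dist_of (\<lambda>_. 0) \<phi>) = dist_of k"
          by (rule ext) (simp add: fourier_dist_def dist_of_def V_S fourier_schwartz inv_fourier_fourier)
        show "dist_of g' = inv_fourier_dist (dist_of (\<lambda>\<xi>. complex_of_real (norm \<xi> powr s) * k \<xi>))"
          using g'(2) by (simp add: a'_def)
      qed
      have "Z_norm s p V = Lp_fun_norm p w + Lp_fun_norm 2 g'"
        by (simp add: Z_norm_def hom_sobolev_norm_eq[OF s(1) s1 g'(1) fracV]) (simp add: Vw Lp_norm_eq[OF p1 w(1)])
      also have "\<dots> \<le> CE * defect_norm s h t + L2_const * defect_norm s h t"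
        using w(3) g'(3) mult_left_mono[OF na' L2] by linarith
      also have "\<dots> \<le> C * defect_norm s h t"
        unfolding distrib_right[symmetric]
        using L2 CE(1) by (intro mult_right_mono dn0) (simp add: C_def)
      finally have conclV: "Z_norm s p V \<le> C * defect_norm s h t" .
      \<comment> \<open>The transform of the evolved distribution; the constant \<open>c\<close> is left unchanged by the evolution.\<close>
      define m where "m = (\<lambda>\<xi>. schroedinger_symbol t \<xi> * h \<xi>)"
      have tm: "m \<in> tempered_functions"
        unfolding m_def by (rule tempered_functions_mult[OF h, where B = 1]) auto
      define a1 where "a1 = (\<lambda>\<xi>. complex_of_real (norm \<xi> powr s) * m \<xi>)"
      have na1: "norm (a1 \<xi>) = norm (a \<xi>)" for \<xi>
        by (simp add: a1_def m_def a_def norm_mult)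
      have ma1 [measurable]: "a1 \<in> borel_measurable borel"
        unfolding a1_def m_def by measurable
      have a1L: "a1 \<in> Lp_functions 2" using ia by (simp add: Lp_functions_2_iff na1)
      obtain g1 where g1: "g1 \<in> Lp_functions 2" "dist_of g1 = inv_fourier_dist (dist_of a1)"
        "Lp_fun_norm 2 g1 \<le> L2_const * Lp_fun_norm 2 a"
        using inv_fourier_L2_exists[OF a1L] by (auto simp: Lp_fun_norm_2 na1)
      have fracU: "is_frac_deriv s (schroedinger t u) g1"
        unfolding is_frac_deriv_def
      proof (intro exI[of _ c] bexI[of _ m] conjI tm)
        show "fourier_dist (\<lambda>\<phi>. schroedinger t u \<phi> - dist_of (\<lambda>_. c) \<phi>) = dist_of m"
          unfolding m_def by (rule schroedinger_fourier_dist[OF fu])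
        show "dist_of g1 = inv_fourier_dist (dist_of (\<lambda>\<xi>. complex_of_real (norm \<xi> powr s) * m \<xi>))"
          using g1(2) by (simp add: a1_def)
      qed
      note fw = Lp_add[OF p1 f w(1)]
      have Ufw: "schroedinger t u = dist_of (\<lambda>x. f x + w x)"
      proof
        fix \<phi> :: "real ^ 'n \<Rightarrow> complex"
        have "schroedinger t u \<phi> = u \<phi> + V \<phi>" by (simp add: V_def)
        also have "\<dots> = dist_of f \<phi> + dist_of w \<phi>" by (simp add: Vw u)
        also have "\<dots> = dist_of (\<lambda>x. f x + w x) \<phi>"
          using Lp_functions_tempered[OF p1 f] Lp_functions_tempered[OF p1 w(1)]
          by (simp add: dist_of_def tempered_functions_def distrib_right)
        finally show "schroedinger t u \<phi> = dist_of (\<lambda>x. f x + w x) \<phi>" .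
      qed
      have temp: "schroedinger t u \<in> tempered_distributions"
        unfolding Ufw by (rule Lp_dist_tempered[OF p1 fw(1)])
      have inZ: "schroedinger t u \<in> Z_space s p"
        unfolding Z_space_def Lp_space_def hom_sobolev_space_def
        using temp g1(1) fracU fw(1) Ufw by blast
      have "Z_norm s p (schroedinger t u) = Lp_fun_norm p (\<lambda>x. f x + w x) + Lp_fun_norm 2 g1"
        by (simp add: Z_norm_def hom_sobolev_norm_eq[OF s(1) s1 g1(1) fracU]) (simp add: Ufw Lp_norm_eq[OF p1 fw(1)])
      also have "\<dots> \<le> C * (1 + \<bar>t\<bar>) * (Lp_fun_norm p f + Lp_fun_norm 2 g)"
      proof -
        let ?F = "Lp_fun_norm p f" and ?G = "Lp_fun_norm 2 g" and ?\<tau> = "1 + \<bar>t\<bar>"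
        have F0: "?F \<ge> 0" by (simp add: Lp_fun_norm_def)
        have G0: "?G \<ge> 0" by (simp add: Lp_fun_norm_def)
        have "Lp_fun_norm p w \<le> CE * (4 * ?\<tau> * (L2_const * ?G))"
          by (intro order_trans[OF w(3)] mult_left_mono CE(1) order_trans[OF dn_le] na) auto
        moreover have "Lp_fun_norm 2 g1 \<le> L2_const * (L2_const * ?G)"
          by (intro order_trans[OF g1(3)] mult_left_mono L2 na)
        ultimately have "Lp_fun_norm p (\<lambda>x. f x + w x) + Lp_fun_norm 2 g1 \<le>
            4 * ?F + 16 * (CE * L2_const) * (?\<tau> * ?G) + L2_const * L2_const * ?G"
          using fw(2) by (simp add: algebra_simps)
        also have "\<dots> \<le> 4 * (?\<tau> * (?F + ?G)) + 16 * (CE * L2_const) * (?\<tau> * (?F + ?G)) + L2_const * L2_const * (?\<tau> * (?F + ?G))"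
        proof (intro add_mono mult_left_mono)
          show "?F \<le> ?\<tau> * (?F + ?G)" "?G \<le> ?\<tau> * (?F + ?G)"
            using F0 G0 mult_nonneg_nonneg[of "\<bar>t\<bar>" "?F + ?G"] by (simp_all add: distrib_right)
        qed (use F0 G0 L2 CE(1) in auto)
        also have "\<dots> \<le> C * (?\<tau> * (?F + ?G))"
          unfolding distrib_right[symmetric]
          using F0 G0 L2 CE(1) by (intro mult_right_mono) (auto simp: C_def)
        finally show ?thesis by (simp add: mult.assoc)
      qed
      finally have conclU: "Z_norm s p (schroedinger t u) \<le> C * (1 + \<bar>t\<bar>) * Z_norm s p u"
        by (simp add: normu)
      show ?thesis using inZ conclU conclV unfolding V_def by blast
    qed
    then show ?thesis using mh aL unfolding a_def by blast
  qed
  then show ?thesis using C by blast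
qed

lemma defect_norm_tendsto_0:
  fixes h :: "real ^ 'n::finite \<Rightarrow> complex"
  assumes s: "0 < s" "s < 1" and mh [measurable]: "h \<in> borel_measurable borel"
    and a: "(\<lambda>\<xi>. of_real (norm \<xi> powr s) * h \<xi>) \<in> Lp_functions 2"
  shows "(defect_norm s h \<longlongrightarrow> 0) (at 0)"
proof -
  have "(\<lambda>n. defect_norm s h (X n)) \<longlonglongrightarrow> 0" if X: "X \<longlonglongrightarrow> 0" for X :: "nat \<Rightarrow> real"
  proof -
    obtain M where M: "\<And>n. \<bar>X n\<bar> \<le> M"
      using convergent_imp_Bseq[OF convergentI[OF X]] unfolding Bseq_def real_norm_def by blast
    let ?A = "\<lambda>t \<xi>. (1 + norm \<xi> powr (2 * s)) * (norm ((schroedinger_symbol t \<xi> - 1) * h \<xi>))\<^sup>2"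
    let ?a = "\<lambda>\<xi>. (norm (of_real (norm \<xi> powr s) * h \<xi>))\<^sup>2"
    have "(\<lambda>n. (LINT \<xi>|lborel. ?A (X n) \<xi>)) \<longlonglongrightarrow> (LINT \<xi>|(lborel :: (real ^ 'n) measure). (0::real))"
    proof (rule integral_dominated_convergence[where w = "\<lambda>\<xi>. 4 * (2 + M) * ?a \<xi>"])
      show "integrable lborel (\<lambda>\<xi>. 4 * (2 + M) * ?a \<xi>)"
        using a unfolding Lp_functions_2_iff by (intro integrable_mult_right) blast
      have "norm (?A (X n) \<xi>) \<le> 4 * (2 + M) * ?a \<xi>" for n \<xi>
      proof -
        have "norm (?A (X n) \<xi>) = ?A (X n) \<xi>" by simp
        also have "\<dots> \<le> 4 * (2 + \<bar>X n\<bar>) * ?a \<xi>" by (rule defect_le[OF s])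
        also have "\<dots> \<le> 4 * (2 + M) * ?a \<xi>"
          using M[of n] by (intro mult_right_mono) auto
        finally show ?thesis .
      qed
      then show "AE \<xi> in lborel. norm (?A (X n) \<xi>) \<le> 4 * (2 + M) * ?a \<xi>" for n
        by (intro AE_I2)
      have "(\<lambda>n. ?A (X n) \<xi>) \<longlonglongrightarrow> (1 + norm \<xi> powr (2 * s)) * (norm ((schroedinger_symbol 0 \<xi> - 1) * h \<xi>))\<^sup>2" for \<xi>
        unfolding cis_conv_exp by (intro tendsto_intros X)
      then show "AE \<xi> in lborel. (\<lambda>n. ?A (X n) \<xi>) \<longlonglongrightarrow> 0"
        by (intro AE_I2) simp
    qed measurable
    then have "(\<lambda>n. defect_norm s h (X n)) \<longlonglongrightarrow> sqrt 0"
      unfolding defect_norm_def by (intro tendsto_intros) simp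
    then show ?thesis by simp
  qed
  then show ?thesis
    unfolding tendsto_at_iff_sequentially comp_def by blast
qed

theorem theorem1p1:
  fixes s p :: real
  assumes "0 < s" and "s < min (real CARD('n::finite) / 2) 1"
    and "2 < p" and "p < 2 * real CARD('n) / (real CARD('n) - 2 * s)"
  shows "strongly_continuous_group_on (Z_space s p :: 'n functional set) (Z_norm s p) schroedinger \<and>
    (\<exists>C>0. \<forall>u\<^sub>0 \<in> (Z_space s p :: 'n functional set). \<forall>t::real.
        Z_norm s p (schroedinger t u\<^sub>0) \<le> C * (1 + \<bar>t\<bar>) * Z_norm s p u\<^sub>0)"
proof -
  obtain C where C: "C > 0" and pert: "\<And>u. u \<in> (Z_space s p :: 'n functional set) \<Longrightarrow> \<exists>h::real ^ 'n \<Rightarrow> complex. h \<in> borel_measurable borel \<and>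
      (\<lambda>\<xi>. of_real (norm \<xi> powr s) * h \<xi>) \<in> Lp_functions 2 \<and>
      (\<forall>t. schroedinger t u \<in> Z_space s p \<and>
           Z_norm s p (schroedinger t u) \<le> C * (1 + \<bar>t\<bar>) * Z_norm s p u \<and>
           Z_norm s p (\<lambda>\<phi>. schroedinger t u \<phi> - u \<phi>) \<le> C * defect_norm s h t)"
    using schroedinger_perturbation[OF assms] by blast
  have bd: "Z_norm s p (schroedinger t u) \<le> C * (1 + \<bar>t\<bar>) * Z_norm s p u"
    and stay: "schroedinger t u \<in> Z_space s p" if "u \<in> (Z_space s p :: 'n functional set)" for t u
    using pert[OF that] by blast+
  have "strongly_continuous_group_on (Z_space s p :: 'n functional set) (Z_norm s p) schroedinger"
    unfolding strongly_continuous_group_on_def bounded_linear_operator_on_def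
  proof (intro conjI allI ballI)
    show "\<exists>M. \<forall>u\<in>(Z_space s p :: 'n functional set). Z_norm s p (schroedinger t u) \<le> M * Z_norm s p u" for t
      using bd by blast
    show "schroedinger 0 u = u" if "u \<in> (Z_space s p :: 'n functional set)" for u
      using that by (intro schroedinger_0) (simp add: Z_space_def Lp_space_def)
    show "((\<lambda>t. Z_norm s p (\<lambda>\<phi>. schroedinger t u \<phi> - u \<phi>)) \<longlongrightarrow> 0) (at 0)"
      if u: "u \<in> (Z_space s p :: 'n functional set)" for u
    proof -
      obtain h :: "real ^ 'n \<Rightarrow> complex" where h: "h \<in> borel_measurable borel" "(\<lambda>\<xi>. of_real (norm \<xi> powr s) * h \<xi>) \<in> Lp_functions 2"
        and le: "\<And>t. Z_norm s p (\<lambda>\<phi>. schroedinger t u \<phi> - u \<phi>) \<le> C * defect_norm s h t"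
        using pert[OF u] by blast
      have lim: "((\<lambda>t. C * defect_norm s h t) \<longlongrightarrow> C * 0) (at 0)"
        using assms by (intro tendsto_mult tendsto_const defect_norm_tendsto_0 h) auto
      have nonneg: "0 \<le> Z_norm s p T" for T :: "'n functional"
        by (simp add: Z_norm_def Lp_norm_def hom_sobolev_norm_def Lp_fun_norm_def)
      show ?thesis
      proof (rule tendsto_sandwich)
        show "\<forall>\<^sub>F t in at 0. 0 \<le> Z_norm s p (\<lambda>\<phi>. schroedinger t u \<phi> - u \<phi>)"
          by (intro always_eventually allI nonneg)
        show "\<forall>\<^sub>F t in at 0. Z_norm s p (\<lambda>\<phi>. schroedinger t u \<phi> - u \<phi>) \<le> C * defect_norm s h t"
          by (intro always_eventually allI le)
        show "((\<lambda>t. C * defect_norm s h t) \<longlongrightarrow> 0) (at 0)" using lim by simp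
      qed (rule tendsto_const)
    qed
  qed (simp_all add: stay schroedinger_lincomb schroedinger_add)
  then show ?thesis using C bd by blast
qed

end
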